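(* All the following properties are decidable for additive cellular automata over any finite abelian group: (1) topological transitivity; (2) ergodicity; (3) topological mixing; (4) weak topological transitivity; (5) total transitivity; (6) weak ergodic mixing; (7) ergodic mixing. That is, for each property in this list there is an algorithm which, given a finite abelian group $G$, a radius $r\in\mathbb{N}$ and the local rule $\delta:G^{2r+1}\to G$ of an additive cellular automaton $F$ over $G$, decides whether $F$ has that property.
   Context: $\mathbb{N}=\{0,1,2,\ldots\}$. For a finite set $S$, the configuration space $S^{\mathbb{Z}}$ is the set of maps $c:\mathbb{Z}\to S$, equipped with the product topology of the discrete topology on $S$, and with $\mu$ the product measure induced by the uniform probability distribution over $S$, on the $\sigma$-algebra $\mathcal{M}$ of measurable sets. A (one-dimensional) cellular automaton with local rule $\delta:S^{2r+1}\to S$ of radius $r\in\mathbb{N}$ is the map $F:S^{\mathbb{Z}}\to S^{\mathbb{Z}}$, $F(c)_i=\delta(c_{i-r},\ldots,c_{i+r})$. An additive cellular automaton over a finite abelian group $G$ is a cellular automaton $F:G^{\mathbb{Z}}\to G^{\mathbb{Z}}$ that is an endomorphism of the (componentwise) group $G^{\mathbb{Z}}$. Equivalently, its local rule has the form $\delta(x_{-r},\ldots,x_r)=\sum_{i=-r}^r\delta_i(x_i)$ with each $\delta_i$ an endomorphism of $G$. Topological properties of a continuous map $F:\mathcal{X}\to\mathcal{X}$: $F$ is topologically transitive if for all nonempty open $U,V\subseteq\mathcal{X}$ there is a natural number $h$ with $F^h(U)\cap V\neq\emptyset$; topologically mixing if for all nonempty open $U,V$ there is $h_0$ such that $F^h(U)\cap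 V\ne\emptyset$ for every $h\ge h_0$; weakly topologically transitive (topologically weakly mixing) if $F\times F$ on $\mathcal{X}\times\mathcal{X}$ is topologically transitive; totally transitive if $F^h$ is topologically transitive for all integers $h\geq 1$. Ergodic properties (with respect to $\mu$; each presupposes, as part of the property, that $F$ preserves $\mu$, i.e. $\mu(E)=\mu(F^{-1}(E))$ for all $E\in\mathcal{M}$): $F$ is ergodic if every $E\in\mathcal{M}$ with $E=F^{-1}(E)$ satisfies $\mu(E)(1-\mu(E))=0$; ergodic mixing if $\lim_{h\to\infty}\mu(F^{-h}(A)\cap B)=\mu(A)\mu(B)$ for all $A,B\in\mathcal{M}$; weakly ergodic mixing if $\lim_{h\to\infty}\frac1h\sum_{i=0}^{h-1}|\mu(F^{-i}(A)\cap B)-\mu(A)\mu(B)|=0$ for all $A,B\in\mathcal{M}$. *)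

theory Defs
  imports "HOL-Probability.Probability" "HOL-Algebra.Product_Groups" "HOL-Library.Nat_Bijection"
begin

section \<open>Algorithms: partial recursive functions\<close>

datatype recf =
    Zero
  | Succ
  | Proj nat
  | Comp recf "recf list"
  | PrimRec recf recf
  | Mu recf

text \<open>
  \<open>rec_eval p xs y\<close>: the program \<open>p\<close> halts on the argument tuple \<open>xs\<close> with result \<open>y\<close>.
  Recursion and minimization act on the first argument; \<open>Zero\<close> may be applied to any tuple.
\<close>

inductive rec_eval :: "recf \<Rightarrow> nat list \<Rightarrow> nat \<Rightarrow> bool" where
  eval_Zero: "rec_eval Zero xs 0"
| eval_Succ: "rec_eval Succ [x] (Suc x)"
| eval_Proj: "i < length xs \<Longrightarrow> rec_eval (Proj i) xs (xs ! i)"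
| eval_Comp: "list_all2 (\<lambda>g y. rec_eval g xs y) gs ys \<Longrightarrow> rec_eval f ys z
    \<Longrightarrow> rec_eval (Comp f gs) xs z"
| eval_PrimRec_0: "rec_eval f xs y \<Longrightarrow> rec_eval (PrimRec f g) (0 # xs) y"
| eval_PrimRec_Suc: "rec_eval (PrimRec f g) (n # xs) y \<Longrightarrow> rec_eval g (n # y # xs) z
    \<Longrightarrow> rec_eval (PrimRec f g) (Suc n # xs) z"
| eval_Mu: "rec_eval f (n # xs) 0 \<Longrightarrow> (\<forall>m<n. \<exists>y>0. rec_eval f (m # xs) y)
    \<Longrightarrow> rec_eval (Mu f) xs n"

inductive_cases rec_eval_ZeroE: "rec_eval Zero xs y"
inductive_cases rec_eval_SuccE: "rec_eval Succ xs y"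
inductive_cases rec_eval_ProjE: "rec_eval (Proj i) xs y"
inductive_cases rec_eval_CompE: "rec_eval (Comp f gs) xs y"
inductive_cases rec_eval_PrimRec_0E: "rec_eval (PrimRec f g) (0 # xs) y"
inductive_cases rec_eval_PrimRec_SucE: "rec_eval (PrimRec f g) (Suc n # xs) y"
inductive_cases rec_eval_MuE: "rec_eval (Mu f) xs y"

lemma rec_eval_deterministic:
  "rec_eval p xs y \<Longrightarrow> rec_eval p xs y' \<Longrightarrow> y = y'"
proof (induction arbitrary: y' rule: rec_eval.induct)
  case (eval_Zero xs)
  then show ?case by (rule rec_eval_ZeroE) simp
next
  case (eval_Succ x)
  then show ?case by (rule rec_eval_SuccE) simp
next
  case (eval_Proj i xs)
  from eval_Proj.prems show ?case by (rule rec_eval_ProjE) simp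
next
  case (eval_Comp xs gs ys f z)
  from eval_Comp.prems obtain ys' where
    ys': "list_all2 (\<lambda>g y. rec_eval g xs y) gs ys'" "rec_eval f ys' y'"
    by (rule rec_eval_CompE) (rule that)
  have "ys = ys'"
  proof (rule nth_equalityI)
    show "length ys = length ys'"
      using list_all2_lengthD[OF eval_Comp.IH(1)] list_all2_lengthD[OF ys'(1)] by simp
    show "ys ! i = ys' ! i" if "i < length ys" for i
      using eval_Comp.IH(1) ys'(1) that by (simp add: list_all2_conv_all_nth)
  qed
  with ys'(2) show ?case by (simp add: eval_Comp.IH(2))
next
  case (eval_PrimRec_0 f xs y g)
  from eval_PrimRec_0.prems have "rec_eval f xs y'" by (rule rec_eval_PrimRec_0E) simp
  then show ?case by (rule eval_PrimRec_0.IH)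
next
  case (eval_PrimRec_Suc f g n xs y z)
  from eval_PrimRec_Suc.prems obtain y'' where
    "rec_eval (PrimRec f g) (n # xs) y''" "rec_eval g (n # y'' # xs) y'"
    by (rule rec_eval_PrimRec_SucE) (rule that)
  with eval_PrimRec_Suc.IH show ?case by metis
next
  case (eval_Mu f n xs)
  from eval_Mu.prems have y':
      "rec_eval f (y' # xs) 0 \<and> (\<forall>m<y'. \<exists>y>0. rec_eval f (m # xs) y)"
    by (rule rec_eval_MuE) simp
  have "\<not> n < y'"
    using eval_Mu.IH(1) y' by fastforce
  moreover have "\<not> y' < n"
    using eval_Mu.IH(2) y' by fastforce
  ultimately show ?case by simp
qed


section \<open>Cellular automata over a group\<close>

definition config_group :: "nat monoid \<Rightarrow> (int \<Rightarrow> nat) monoid" where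
  "config_group G = product_group UNIV (\<lambda>_. G)"

definition config_topology :: "nat monoid \<Rightarrow> (int \<Rightarrow> nat) topology" where
  "config_topology G = product_topology (\<lambda>_. discrete_topology (carrier G)) UNIV"

definition config_measure :: "nat monoid \<Rightarrow> (int \<Rightarrow> nat) measure" where
  "config_measure G = PiM UNIV (\<lambda>_. uniform_count_measure (carrier G))"

definition local_rule :: "nat monoid \<Rightarrow> nat \<Rightarrow> (nat list \<Rightarrow> nat) \<Rightarrow> bool" where
  "local_rule G r \<delta> \<longleftrightarrow>
     (\<forall>xs. length xs = 2 * r + 1 \<and> set xs \<subseteq> carrier G \<longrightarrow> \<delta> xs \<in> carrier G)"

definition ca_map :: "nat \<Rightarrow> (nat list \<Rightarrow> nat) \<Rightarrow> (int \<Rightarrow> nat) \<Rightarrow> (int \<Rightarrow> nat)" where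
  "ca_map r \<delta> c = (\<lambda>i. \<delta> (map c [i - int r..i + int r]))"

definition additive_ca :: "nat monoid \<Rightarrow> nat \<Rightarrow> (nat list \<Rightarrow> nat) \<Rightarrow> bool" where
  "additive_ca G r \<delta> \<longleftrightarrow>
     local_rule G r \<delta> \<and> ca_map r \<delta> \<in> hom (config_group G) (config_group G)"


section \<open>Topological properties\<close>

definition top_transitive :: "'a topology \<Rightarrow> ('a \<Rightarrow> 'a) \<Rightarrow> bool" where
  "top_transitive X F \<longleftrightarrow>
     (\<forall>U V. openin X U \<and> openin X V \<and> U \<noteq> {} \<and> V \<noteq> {} \<longrightarrow>
        (\<exists>h::nat. (F ^^ h) ` U \<inter> V \<noteq> {}))"

definition top_mixing :: "'a topology \<Rightarrow> ('a \<Rightarrow> 'a) \<Rightarrow> bool" where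
  "top_mixing X F \<longleftrightarrow>
     (\<forall>U V. openin X U \<and> openin X V \<and> U \<noteq> {} \<and> V \<noteq> {} \<longrightarrow>
        (\<exists>h0::nat. \<forall>h\<ge>h0. (F ^^ h) ` U \<inter> V \<noteq> {}))"

definition weakly_top_transitive :: "'a topology \<Rightarrow> ('a \<Rightarrow> 'a) \<Rightarrow> bool" where
  "weakly_top_transitive X F \<longleftrightarrow> top_transitive (prod_topology X X) (map_prod F F)"

definition totally_transitive :: "'a topology \<Rightarrow> ('a \<Rightarrow> 'a) \<Rightarrow> bool" where
  "totally_transitive X F \<longleftrightarrow> (\<forall>h::nat. h \<ge> 1 \<longrightarrow> top_transitive X (F ^^ h))"


section \<open>Ergodic properties\<close>

definition preserves_measure :: "'a measure \<Rightarrow> ('a \<Rightarrow> 'a) \<Rightarrow> bool" where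
  "preserves_measure M F \<longleftrightarrow>
     F \<in> measurable M M \<and> (\<forall>E\<in>sets M. measure M E = measure M (F -` E \<inter> space M))"

definition ergodic :: "'a measure \<Rightarrow> ('a \<Rightarrow> 'a) \<Rightarrow> bool" where
  "ergodic M F \<longleftrightarrow> preserves_measure M F \<and>
     (\<forall>E\<in>sets M. E = F -` E \<inter> space M \<longrightarrow> measure M E * (1 - measure M E) = 0)"

definition ergodic_mixing :: "'a measure \<Rightarrow> ('a \<Rightarrow> 'a) \<Rightarrow> bool" where
  "ergodic_mixing M F \<longleftrightarrow> preserves_measure M F \<and>
     (\<forall>A\<in>sets M. \<forall>B\<in>sets M.
        (\<lambda>h. measure M (((F ^^ h) -` A \<inter> space M) \<inter> B))
          \<longlonglongrightarrow> measure M A * measure M B)"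

definition weakly_ergodic_mixing :: "'a measure \<Rightarrow> ('a \<Rightarrow> 'a) \<Rightarrow> bool" where
  "weakly_ergodic_mixing M F \<longleftrightarrow> preserves_measure M F \<and>
     (\<forall>A\<in>sets M. \<forall>B\<in>sets M.
        (\<lambda>h. 1 / real h * (\<Sum>i<h.
            \<bar>measure M (((F ^^ i) -` A \<inter> space M) \<inter> B) - measure M A * measure M B\<bar>))
          \<longlonglongrightarrow> 0)"


section \<open>Instances and decidability\<close>

text \<open>
  A finite abelian group is given to an algorithm by its Cayley table, with its elements
  named \<open>0, \<dots>, n - 1\<close>. The naming is arbitrary: the neutral element need not be \<open>0\<close>, and
  the operation is unrelated to arithmetic on numbers.
\<close>

definition fin_abelian_group :: "nat monoid \<Rightarrow> bool" where
  "fin_abelian_group G \<longleftrightarrow>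
     comm_group G \<and> finite (carrier G) \<and> carrier G = {..<card (carrier G)}"

text \<open>
  An instance is coded by the number of the list consisting of \<open>n\<close>, \<open>r\<close>, the \<open>n\<^sup>2\<close> entries of
  the Cayley table, and the \<open>n\<close>-to-the-\<open>(2 * r + 1)\<close> values of the local rule.
\<close>

definition instance_code :: "nat monoid \<Rightarrow> nat \<Rightarrow> (nat list \<Rightarrow> nat) \<Rightarrow> nat" where
  "instance_code G r \<delta> =
     (let n = card (carrier G) in
      list_encode ([n, r]
        @ [x \<otimes>\<^bsub>G\<^esub> y. x \<leftarrow> [0..<n], y \<leftarrow> [0..<n]]
        @ map \<delta> (List.n_lists (2 * r + 1) [0..<n])))"

text \<open>One program has to work uniformly for all groups, radii and local rules.\<close>

definition decidable_for_additive_ca ::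
    "(nat monoid \<Rightarrow> ((int \<Rightarrow> nat) \<Rightarrow> (int \<Rightarrow> nat)) \<Rightarrow> bool) \<Rightarrow> bool" where
  "decidable_for_additive_ca P \<longleftrightarrow>
     (\<exists>p. \<forall>G r \<delta>. fin_abelian_group G \<and> additive_ca G r \<delta> \<longrightarrow>
        rec_eval p [instance_code G r \<delta>] (if P G (ca_map r \<delta>) then 1 else 0))"

end

theory Submission
  imports Defs
begin

text \<open>
  All seven properties are equivalent to the absence of a nontrivial finite factor: there is no
  proper open subgroup \<open>U\<close> of \<open>G\<^sup>\<int>\<close> with \<open>F U \<subseteq> U\<close>. Such a \<open>U\<close> and its complement violate
  transitivity, and the union of the preimages of \<open>U\<close> violates ergodicity. Conversely, without
  such a \<open>U\<close> the map \<open>x \<mapsto> (x, F\<^sup>h x)\<close>, restricted to a finite window, is onto for all large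
  \<open>h\<close>; a homomorphism onto a finite group maps the invariant measure to the uniform one, which
  gives mixing on cylinders.

  If some \<open>U\<close> exists, one of minimal index has index at most \<open>n = |G|\<close>: the maps
  \<open>x \<mapsto> \<sigma>\<^sup>i x mod U\<close> for \<open>i < L\<close> are independent, yet they are determined by \<open>L + O(1)\<close> cells.
  By a pigeonhole argument it can moreover be chosen to depend on at most \<open>n ^ (n ^ (2 * r))\<close> cells
  only, so a bounded search decides whether it exists.
\<close>

section \<open>Closure properties of recursive functions\<close>

text \<open>The window of an open subgroup has no a priori bound, so a plain search for
  \<open>U\<close> could never certify its absence; the difficulty is a bound computable from
  \<open>n\<close> and \<open>r\<close>. The pigeonhole step counts maps from words of length
  \<open>2 * r\<close> to cosets, hence needs a bound on the number of cosets that does not depend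
  on \<open>U\<close>; this is the purpose of the estimate by \<open>n\<close>. Minimal index makes
  it available: a minimal \<open>U\<close> lies in no larger proper factor, so
  \<open>U V = C\<close> for every invariant subgroup \<open>V\<close> not contained in
  \<open>U\<close>. Deleting a block replaces \<open>U\<close> by a preimage, whose index cannot
  grow, so minimality survives. The length \<open>2 * r\<close> is the width of the region in which
  \<open>F\<close> feels a cut. One criterion serves seven properties because transitivity and
  ergodicity, the weakest on either side, already exclude \<open>U\<close>, while its absence yields
  ergodic mixing, from which the other six follow. Only subgroups and cosets occur, no matrices or
  polynomials, so an arbitrary \<open>G\<close> is treated without decomposing it.\<close>

definition recursive :: "nat \<Rightarrow> (nat list \<Rightarrow> nat) \<Rightarrow> bool" where
  "recursive k f \<longleftrightarrow> (\<exists>p. \<forall>xs. length xs = k \<longrightarrow> rec_eval p xs (f xs))"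

lemma recursive_cong:
  assumes "recursive k f" "\<And>xs. length xs = k \<Longrightarrow> f xs = g xs"
  shows "recursive k g"
  using assms unfolding recursive_def by metis

lemma recursive_nth: "i < k \<Longrightarrow> recursive k (\<lambda>xs. xs ! i)"
  unfolding recursive_def by (intro exI[of _ "Proj i"]) (auto intro: eval_Proj)

lemma recursive_comp:
  assumes f: "recursive (length gs) f" and gs: "\<And>g. g \<in> set gs \<Longrightarrow> recursive k g"
  shows "recursive k (\<lambda>xs. f (map (\<lambda>g. g xs) gs))"
proof -
  obtain p where p: "\<And>xs. length xs = length gs \<Longrightarrow> rec_eval p xs (f xs)"
    using f by (auto simp: recursive_def)
  have "\<exists>q. \<forall>xs. length xs = k \<longrightarrow> rec_eval q xs (g xs)" if "g \<in> set gs" for g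
    using gs[OF that] by (auto simp: recursive_def)
  then obtain q where q: "\<And>g xs. g \<in> set gs \<Longrightarrow> length xs = k \<Longrightarrow> rec_eval (q g) xs (g xs)"
    by metis
  have "rec_eval (Comp p (map q gs)) xs (f (map (\<lambda>g. g xs) gs))" if "length xs = k" for xs
    by (rule eval_Comp[of xs _ "map (\<lambda>g. g xs) gs"])
      (auto simp: list_all2_conv_all_nth that intro!: q p)
  then show ?thesis by (auto simp: recursive_def)
qed

lemma recursive_comp1:
  assumes "recursive 1 (\<lambda>xs. f (xs ! 0))" "recursive k a"
  shows "recursive k (\<lambda>xs. f (a xs))"
  using recursive_comp[of "[a]" "\<lambda>xs. f (xs ! 0)" k] assms by auto

text \<open>Binders push their variable onto the front of the argument tuple, so an expression that
  ignores the new variable reads the tail: weakening for de Bruijn indices.\<close>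

lemma recursive_tl:
  assumes "recursive k f"
  shows "recursive (Suc k) (\<lambda>xs. f (tl xs))"
proof -
  have "recursive (Suc k) (\<lambda>xs. f (map (\<lambda>g. g xs) (map (\<lambda>i xs. xs ! Suc i) [0..<k])))"
    using assms by (intro recursive_comp) (auto intro: recursive_nth)
  then show ?thesis
    by (rule recursive_cong) (auto intro!: arg_cong[of _ _ f] nth_equalityI simp: nth_tl)
qed

lemma recursive_nth_funpow_tl:
  assumes "i + d < k"
  shows "recursive k (\<lambda>xs. (tl ^^ d) xs ! i)"
proof (rule recursive_cong[OF recursive_nth[OF assms]])
  have "(tl ^^ d) xs = drop d xs" for xs :: "nat list"
    by (induction d) (auto simp: drop_Suc tl_drop)
  then show "xs ! (i + d) = (tl ^^ d) xs ! i" if "length xs = k" for xs :: "nat list"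
    using that assms by (simp add: add.commute)
qed

text \<open>Under nested binders an outer variable is an entry of an iterated tail. Six tails
  suffice: in \<open>has_factor\<close> the code \<open>z\<close> is read under the six binders
  \<open>w\<close>, \<open>S\<close>, \<open>x\<close>, \<open>y\<close>, \<open>u\<close>,
  \<open>i\<close>.\<close>

lemma recursive_nth_tl:
  "i + 1 < k \<Longrightarrow> recursive k (\<lambda>xs. tl xs ! i)"
  "i + 2 < k \<Longrightarrow> recursive k (\<lambda>xs. tl (tl xs) ! i)"
  "i + 3 < k \<Longrightarrow> recursive k (\<lambda>xs. tl (tl (tl xs)) ! i)"
  "i + 4 < k \<Longrightarrow> recursive k (\<lambda>xs. tl (tl (tl (tl xs))) ! i)"
  "i + 5 < k \<Longrightarrow> recursive k (\<lambda>xs. tl (tl (tl (tl (tl xs)))) ! i)"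
  "i + 6 < k \<Longrightarrow> recursive k (\<lambda>xs. tl (tl (tl (tl (tl (tl xs))))) ! i)"
  using recursive_nth_funpow_tl[of i 1 k] recursive_nth_funpow_tl[of i 2 k]
    recursive_nth_funpow_tl[of i 3 k] recursive_nth_funpow_tl[of i 4 k]
    recursive_nth_funpow_tl[of i 5 k] recursive_nth_funpow_tl[of i 6 k]
  by (simp_all add: eval_nat_numeral)

lemma recursive_Suc:
  assumes "recursive k a"
  shows "recursive k (\<lambda>xs. Suc (a xs))"
proof (rule recursive_comp1[OF _ assms])
  show "recursive 1 (\<lambda>xs. Suc (xs ! 0))"
    unfolding recursive_def
    by (intro exI[of _ Succ]) (auto simp: length_Suc_conv intro: eval_Succ)
qed

lemma recursive_const: "recursive k (\<lambda>xs. c)"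
proof (induction c)
  case 0
  show ?case
    unfolding recursive_def by (intro exI[of _ Zero]) (auto intro: eval_Zero)
qed (rule recursive_Suc)

lemma recursive_rec_nat:
  assumes a: "recursive k a" and b: "recursive k b"
    and g: "recursive (Suc (Suc k)) (\<lambda>ys. g (ys ! 0) (ys ! 1) (tl (tl ys)))"
  shows "recursive k (\<lambda>xs. rec_nat (b xs) (\<lambda>m y. g m y xs) (a xs))"
proof -
  let ?f = "\<lambda>ys. rec_nat (b (tl ys)) (\<lambda>m y. g m y (tl ys)) (ys ! 0)"
  obtain p where p: "\<And>xs. length xs = k \<Longrightarrow> rec_eval p xs (b xs)"
    using b by (auto simp: recursive_def)
  obtain q where q: "\<And>xs. length xs = Suc (Suc k) \<Longrightarrow>
      rec_eval q xs (g (xs ! 0) (xs ! 1) (tl (tl xs)))"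
    using g by (auto simp: recursive_def)
  have "rec_eval (PrimRec p q) (n # xs) (rec_nat (b xs) (\<lambda>m y. g m y xs) n)"
    if "length xs = k" for n xs
  proof (induction n)
    case 0
    then show ?case using p[OF that] by (auto intro: eval_PrimRec_0)
  next
    case (Suc n)
    from Suc show ?case
      using q[of "n # rec_nat (b xs) (\<lambda>m y. g m y xs) n # xs"] that
      by (auto intro!: eval_PrimRec_Suc)
  qed
  then have "recursive (Suc k) ?f"
    unfolding recursive_def by (intro exI[of _ "PrimRec p q"]) (auto simp: length_Suc_conv)
  then have "recursive k (\<lambda>xs. ?f (map (\<lambda>g. g xs) (a # map (\<lambda>i xs. xs ! i) [0..<k])))"
    using a by (intro recursive_comp) (auto intro: recursive_nth)
  then show ?thesis
    by (rule recursive_cong) (auto simp: o_def map_nth)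
qed

lemmas recursive_basic = recursive_nth recursive_nth_tl recursive_Suc recursive_const

section \<open>Arithmetic and bounded quantifiers\<close>

lemma recursive_add:
  assumes "recursive k a" "recursive k b"
  shows "recursive k (\<lambda>xs. a xs + b xs)"
proof -
  have "recursive k (\<lambda>xs. rec_nat (b xs) (\<lambda>m y. Suc y) (a xs))"
    by (intro recursive_rec_nat assms recursive_basic) simp
  moreover have "rec_nat y (\<lambda>m. Suc) x = x + y" for x y
    by (induction x) auto
  ultimately show ?thesis by simp
qed

lemma recursive_sum:
  assumes "recursive k b" "recursive (Suc k) (\<lambda>ys. f (ys ! 0) (tl ys))"
  shows "recursive k (\<lambda>xs. \<Sum>i<b xs. f i xs)"
proof -
  have "recursive (Suc k) (\<lambda>xs. xs ! 0)" by (rule recursive_nth) simp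
  \<comment> \<open>The step function of the recursion receives the accumulator as entry 1, between
    the index and the parameters; projections skip it.\<close>
  moreover have "recursive (Suc (Suc k)) (\<lambda>ys. f (ys ! 0) (tl (tl ys)))"
  proof (rule recursive_cong)
    show "recursive (Suc (Suc k)) (\<lambda>xs. (\<lambda>ys. f (ys ! 0) (tl ys)) (map (\<lambda>g. g xs)
          ((\<lambda>xs. xs ! 0) # map (\<lambda>i xs. xs ! Suc (Suc i)) [0..<k])))"
      using assms(2) by (intro recursive_comp) (auto intro: recursive_nth)
    show "(\<lambda>ys. f (ys ! 0) (tl ys)) (map (\<lambda>g. g xs)
          ((\<lambda>xs. xs ! 0) # map (\<lambda>i xs. xs ! Suc (Suc i)) [0..<k]))
        = f (xs ! 0) (tl (tl xs))" if "length xs = Suc (Suc k)" for xs :: "nat list"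
      using that by (auto intro!: arg_cong[of _ _ "f (xs ! 0)"] nth_equalityI simp: nth_tl)
  qed
  ultimately have "recursive k (\<lambda>xs. rec_nat 0 (\<lambda>m y. y + f m xs) (b xs))"
    by (intro recursive_rec_nat assms recursive_add recursive_basic) auto
  moreover have "rec_nat 0 (\<lambda>m y. y + g m) n = (\<Sum>i<n. g i)" for g :: "nat \<Rightarrow> nat" and n :: nat
    by (induction n) auto
  ultimately show ?thesis by simp
qed

lemma recursive_mult:
  assumes "recursive k a" "recursive k b"
  shows "recursive k (\<lambda>xs. a xs * b xs)"
proof -
  have "recursive k (\<lambda>xs. \<Sum>i<a xs. b xs)"
    by (intro recursive_sum recursive_tl assms)
  then show ?thesis by simp
qed

lemma recursive_diff:
  assumes "recursive k a" "recursive k b"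
  shows "recursive k (\<lambda>xs. a xs - b xs)"
proof -
  \<comment> \<open>The predecessor is the recursion that returns its index and forgets the previous
    value.\<close>
  have "recursive k (\<lambda>xs. rec_nat 0 (\<lambda>m y. m) (c xs))" if "recursive k c" for k c
    by (intro recursive_rec_nat that recursive_basic) simp
  moreover have "rec_nat 0 (\<lambda>m y. m) x = x - 1" for x
    by (cases x) auto
  ultimately have pred: "recursive k (\<lambda>xs. c xs - 1)" if "recursive k c" for k c
    using that by simp
  have "recursive k (\<lambda>xs. rec_nat (a xs) (\<lambda>m y. y - 1) (b xs))"
    by (intro recursive_rec_nat assms pred recursive_basic) simp
  moreover have "rec_nat x (\<lambda>m y. y - 1) y = x - y" for x y :: nat
    by (induction y) auto
  ultimately show ?thesis by simp
qed

lemma recursive_not: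
  assumes "recursive k (\<lambda>xs. of_bool (P xs))"
  shows "recursive k (\<lambda>xs. of_bool (\<not> P xs))"
proof -
  have "recursive k (\<lambda>xs. 1 - of_bool (P xs))"
    by (intro recursive_diff recursive_const assms)
  then show ?thesis by (rule recursive_cong) simp
qed

lemma recursive_conj:
  assumes "recursive k (\<lambda>xs. of_bool (P xs))" "recursive k (\<lambda>xs. of_bool (Q xs))"
  shows "recursive k (\<lambda>xs. of_bool (P xs \<and> Q xs))"
  using recursive_mult[OF assms] by (simp add: of_bool_conj)

lemma recursive_imp:
  assumes "recursive k (\<lambda>xs. of_bool (P xs))" "recursive k (\<lambda>xs. of_bool (Q xs))"
  shows "recursive k (\<lambda>xs. of_bool (P xs \<longrightarrow> Q xs))"
  using recursive_not[OF recursive_conj[OF assms(1) recursive_not[OF assms(2)]]] by simp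

lemma recursive_iff:
  assumes "recursive k (\<lambda>xs. of_bool (P xs))" "recursive k (\<lambda>xs. of_bool (Q xs))"
  shows "recursive k (\<lambda>xs. of_bool (P xs \<longleftrightarrow> Q xs))"
  by (rule recursive_cong[OF recursive_conj[OF recursive_imp[OF assms] recursive_imp[OF assms(2,1)]]])
    auto

lemma recursive_eq:
  assumes "recursive k a" "recursive k b"
  shows "recursive k (\<lambda>xs. of_bool (a xs = b xs))"
proof -
  have "recursive k (\<lambda>xs. 1 - ((a xs - b xs) + (b xs - a xs)))"
    by (intro recursive_diff recursive_add recursive_const assms)
  then show ?thesis by (rule recursive_cong) auto
qed

text \<open>A bounded quantifier is a bounded sum that counts the counterexamples. Predicates are
  represented by \<open>of_bool\<close>, so the rules for functions cover them.\<close>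

lemma recursive_all:
  assumes "recursive k b" "recursive (Suc k) (\<lambda>ys. of_bool (P (ys ! 0) (tl ys)))"
  shows "recursive k (\<lambda>xs. of_bool (\<forall>i<b xs. P i xs))"
proof -
  have "recursive k (\<lambda>xs. of_bool ((\<Sum>i<b xs. of_bool (\<not> P i xs)) = (0 :: nat)))"
    by (intro recursive_eq recursive_sum recursive_not recursive_const assms)
  then show ?thesis by (rule recursive_cong) auto
qed

lemma recursive_ex:
  assumes "recursive k b" "recursive (Suc k) (\<lambda>ys. of_bool (P (ys ! 0) (tl ys)))"
  shows "recursive k (\<lambda>xs. of_bool (\<exists>i<b xs. P i xs))"
proof -
  have "recursive k (\<lambda>xs. of_bool (\<not> (\<forall>i<b xs. \<not> P i xs)))"
    by (intro recursive_all recursive_not assms)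
  then show ?thesis by (rule recursive_cong) auto
qed

lemma recursive_if:
  assumes "recursive k (\<lambda>xs. of_bool (P xs))" "recursive k a" "recursive k b"
  shows "recursive k (\<lambda>xs. if P xs then a xs else b xs)"
proof -
  have "recursive k (\<lambda>xs. of_bool (P xs) * a xs + of_bool (\<not> P xs) * b xs)"
    by (intro recursive_add recursive_mult recursive_not assms)
  then show ?thesis by (rule recursive_cong) auto
qed

lemma recursive_power:
  assumes "recursive k a" "recursive k b"
  shows "recursive k (\<lambda>xs. a xs ^ b xs)"
proof -
  have "recursive k (\<lambda>xs. rec_nat 1 (\<lambda>m y. y * a xs) (b xs))"
    by (intro recursive_rec_nat recursive_mult recursive_basic assms recursive_tl) simp
  moreover have "rec_nat 1 (\<lambda>m y. y * x) n = x ^ n" for x n :: nat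
    by (induction n) auto
  ultimately show ?thesis by simp
qed

lemma recursive_mod:
  assumes "recursive k a" "recursive k b"
  shows "recursive k (\<lambda>xs. a xs mod b xs)"
proof -
  \<comment> \<open>A counter that wraps at \<open>b\<close>. For \<open>b = 0\<close> it never
    wraps and ends at \<open>a\<close>, which is \<open>a mod 0\<close>.\<close>
  have "recursive k (\<lambda>xs. rec_nat 0 (\<lambda>m y. if Suc y = b xs then 0 else Suc y) (a xs))"
    by (intro recursive_rec_nat recursive_if recursive_eq recursive_basic assms recursive_tl) simp_all
  moreover have "rec_nat 0 (\<lambda>m y. if Suc y = b then 0 else Suc y) a = a mod b" for a b :: nat
    by (induction a) (auto simp: mod_Suc)
  ultimately show ?thesis by simp
qed

lemma recursive_div:
  assumes "recursive k a" "recursive k b"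
  shows "recursive k (\<lambda>xs. a xs div b xs)"
proof -
  \<comment> \<open>Counts the multiples of \<open>b\<close> among \<open>1, ..., a\<close>; for
    \<open>b = 0\<close> there are none, in accordance with \<open>a div 0 = 0\<close>.\<close>
  have "recursive k (\<lambda>xs. rec_nat 0 (\<lambda>m y. if Suc m mod b xs = 0 then Suc y else y) (a xs))"
    by (intro recursive_rec_nat recursive_if recursive_eq recursive_mod recursive_basic assms
        recursive_tl) simp_all
  moreover have "rec_nat 0 (\<lambda>m y. if Suc m mod b = 0 then Suc y else y) a = a div b" for a b :: nat
    by (induction a) (auto simp: div_Suc)
  ultimately show ?thesis by simp
qed

lemmas recursive_intros = recursive_basic recursive_add recursive_mult recursive_diff recursive_power
  recursive_div recursive_mod recursive_if recursive_sum recursive_not recursive_conj recursive_imp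
  recursive_iff recursive_eq recursive_all recursive_ex

text \<open>Exhaustive search for the pair \<open>(a, b)\<close> with \<open>z = Suc (prod_encode (a, b))\<close>.\<close>

definition code_hd :: "nat \<Rightarrow> nat" where
  "code_hd z = (\<Sum>a<z. \<Sum>b<z. if (a + b) * Suc (a + b) div 2 + a = z - 1 then a else 0)"

definition code_tl :: "nat \<Rightarrow> nat" where
  "code_tl z = (\<Sum>a<z. \<Sum>b<z. if (a + b) * Suc (a + b) div 2 + a = z - 1 then b else 0)"

definition code_nth :: "nat \<Rightarrow> nat \<Rightarrow> nat" where
  "code_nth z i = code_hd (rec_nat z (\<lambda>_. code_tl) i)"

text \<open>Injectivity of \<open>prod_encode\<close> leaves at most one nonzero term, and the range
  contains it because both components are at most the code. The formula in the condition is
  \<open>prod_encode\<close> with \<open>triangle\<close> unfolded, so that only arithmetic already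
  known to be recursive occurs.\<close>

lemma sum_prod_encode:
  "(\<Sum>a<Suc (prod_encode (x, y)). \<Sum>b<Suc (prod_encode (x, y)).
     if (a + b) * Suc (a + b) div 2 + a = Suc (prod_encode (x, y)) - 1 then f a b else 0) = f x y"
  (is "(\<Sum>a<?z. \<Sum>b<?z. ?g a b) = _")
proof -
  have "?g a b = (if (a, b) = (x, y) then f a b else 0)" for a b
    using prod_encode_eq[of "(a, b)" "(x, y)"]
    by (simp add: prod_encode_def triangle_def)
  then have "(\<Sum>a<?z. \<Sum>b<?z. ?g a b)
      = (\<Sum>a<?z. \<Sum>b<?z. if (a, b) = (x, y) then f a b else 0)"
    by (simp only:)
  also have "\<dots> = (\<Sum>c\<in>{..<?z} \<times> {..<?z}. if c = (x, y) then f x y else 0)"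
    unfolding sum.cartesian_product by (intro sum.cong) (auto split: if_splits)
  also have "\<dots> = f x y"
    using le_prod_encode_1[of x y] le_prod_encode_2[of y x]
    by (simp add: less_Suc_eq_le del: lessThan_Suc sum.lessThan_Suc)
  finally show ?thesis .
qed

lemma code_hd_encode: "code_hd (list_encode (x # xs)) = x"
  and code_tl_encode: "code_tl (list_encode (x # xs)) = list_encode xs"
  unfolding code_hd_def code_tl_def list_encode.simps by (rule sum_prod_encode)+

lemma code_nth_encode:
  assumes "i < length xs"
  shows "code_nth (list_encode xs) i = xs ! i"
proof -
  have "rec_nat (list_encode xs) (\<lambda>_. code_tl) j = list_encode (drop j xs)" if "j \<le> i" for j
    using that
  proof (induction j)
    case (Suc j)
    then have "drop j xs = xs ! j # drop (Suc j) xs" using assms by (simp add: Cons_nth_drop_Suc)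
    with Suc show ?case by (simp add: code_tl_encode del: list_encode.simps)
  qed simp
  moreover have "drop i xs = xs ! i # drop (Suc i) xs" using assms by (simp add: Cons_nth_drop_Suc)
  ultimately show ?thesis by (simp add: code_nth_def code_hd_encode del: list_encode.simps)
qed

lemma recursive_code_nth:
  assumes "recursive k a" "recursive k b"
  shows "recursive k (\<lambda>xs. code_nth (a xs) (b xs))"
proof -
  have hd: "recursive k (\<lambda>xs. code_hd (c xs))" if "recursive k c" for k c
    by (rule recursive_comp1[OF _ that], unfold code_hd_def) (intro recursive_intros; simp)
  have tl: "recursive k (\<lambda>xs. code_tl (c xs))" if "recursive k c" for k c
    by (rule recursive_comp1[OF _ that], unfold code_tl_def) (intro recursive_intros; simp)
  show ?thesis
    unfolding code_nth_def by (intro hd recursive_rec_nat tl assms recursive_basic) simp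
qed

section \<open>Open subgroups of the configuration group\<close>

locale finite_config =
  fixes G :: "nat monoid"
  assumes fin_abelian: "fin_abelian_group G"
begin

abbreviation "X \<equiv> config_group G"
abbreviation "C \<equiv> carrier (config_group G)"
abbreviation "n \<equiv> card (carrier G)"
abbreviation "e \<equiv> \<one>\<^bsub>config_group G\<^esub>"

sublocale G: comm_group G
  using fin_abelian by (simp add: fin_abelian_group_def)

lemma finite_G: "finite (carrier G)" and carrier_G: "carrier G = {..<n}"
  using fin_abelian by (simp_all add: fin_abelian_group_def)

lemma n_pos: "n > 0"
  using finite_G G.one_closed by (auto simp: card_gt_0_iff)

lemma carrier_config: "x \<in> C \<longleftrightarrow> (\<forall>i. x i \<in> carrier G)"
  by (auto simp: config_group_def)

lemma configI: "(\<And>i. x i \<in> carrier G) \<Longrightarrow> x \<in> C"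
  by (simp add: carrier_config)

lemma config_nth [simp]: "x \<in> C \<Longrightarrow> x i \<in> carrier G"
  by (simp add: carrier_config)

lemma mult_config [simp]: "(x \<otimes>\<^bsub>X\<^esub> y) i = x i \<otimes>\<^bsub>G\<^esub> y i"
  by (simp add: config_group_def)

lemma one_config [simp]: "e i = \<one>\<^bsub>G\<^esub>"
  by (simp add: config_group_def)

sublocale X: comm_group X
proof -
  interpret X: group X
    unfolding config_group_def by (rule product_group) (rule G.is_group)
  show "comm_group X"
    by (rule X.group_comm_groupI) (auto intro!: ext G.m_comm)
qed

lemma inv_config [simp]: "x \<in> C \<Longrightarrow> (inv\<^bsub>X\<^esub> x) i = inv\<^bsub>G\<^esub> (x i)"
  by (simp add: config_group_def)

text \<open>For a subgroup \<open>U\<close> and a finite \<open>W\<close> this is openness: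
  \<open>U\<close> contains the basic neighbourhood of the identity given by \<open>W\<close>. For
  subgroups it also means that membership in \<open>U\<close> can be read from the cells in
  \<open>W\<close>.\<close>

definition determined :: "(int \<Rightarrow> nat) set \<Rightarrow> int set \<Rightarrow> bool" where
  "determined U W \<longleftrightarrow> (\<forall>x\<in>C. (\<forall>i\<in>W. x i = \<one>\<^bsub>G\<^esub>) \<longrightarrow> x \<in> U)"

lemma determinedD: "determined U W \<Longrightarrow> x \<in> C \<Longrightarrow> (\<And>i. i \<in> W \<Longrightarrow> x i = \<one>\<^bsub>G\<^esub>) \<Longrightarrow> x \<in> U"
  by (auto simp: determined_def)

lemma determined_mono: "determined U W \<Longrightarrow> W \<subseteq> W' \<Longrightarrow> U \<subseteq> U' \<Longrightarrow> determined U' W'"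
  unfolding determined_def by blast

section \<open>Cosets and index\<close>

definition cosets :: "(int \<Rightarrow> nat) set \<Rightarrow> (int \<Rightarrow> nat) set set" where
  "cosets U = (\<lambda>x. U #>\<^bsub>X\<^esub> x) ` C"

abbreviation index :: "(int \<Rightarrow> nat) set \<Rightarrow> nat" where
  "index U \<equiv> card (cosets U)"

lemma coset_in_cosets: "x \<in> C \<Longrightarrow> U #>\<^bsub>X\<^esub> x \<in> cosets U"
  unfolding cosets_def by (rule imageI)

lemma coset_eq_iff:
  assumes "subgroup U X" "x \<in> C" "y \<in> C"
  shows "U #>\<^bsub>X\<^esub> x = U #>\<^bsub>X\<^esub> y \<longleftrightarrow> x \<otimes>\<^bsub>X\<^esub> inv\<^bsub>X\<^esub> y \<in> U"
  using subgroup.rcos_module[OF assms(1) X.is_group assms(3,2)] X.repr_independence[OF _ assms(3,1)]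
    X.rcos_self[OF assms(2,1)] by metis

lemma coset_eqI:
  assumes "subgroup U X" "determined U W" "x \<in> C" "y \<in> C" "\<And>i. i \<in> W \<Longrightarrow> x i = y i"
  shows "U #>\<^bsub>X\<^esub> x = U #>\<^bsub>X\<^esub> y"
  using assms by (subst coset_eq_iff) (auto intro!: determinedD[OF assms(2)])

lemma mem_determined_iff:
  assumes U: "subgroup U X" "determined U W" and "x \<in> C" "y \<in> C" "\<And>i. i \<in> W \<Longrightarrow> y i = x i"
  shows "y \<in> U \<longleftrightarrow> x \<in> U"
  using coset_eqI[OF U assms(4,3,5)] X.coset_join1[OF _ _ U(1)] X.coset_join2[OF _ U(1)] assms(3,4)
  by metis

lemma coset_mult_cong:
  assumes U: "subgroup U X" and "x \<in> C" "y \<in> C" "x' \<in> C" "y' \<in> C"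
    and "U #>\<^bsub>X\<^esub> x = U #>\<^bsub>X\<^esub> x'" "U #>\<^bsub>X\<^esub> y = U #>\<^bsub>X\<^esub> y'"
  shows "U #>\<^bsub>X\<^esub> (x \<otimes>\<^bsub>X\<^esub> y) = U #>\<^bsub>X\<^esub> (x' \<otimes>\<^bsub>X\<^esub> y')"
proof -
  have "(x \<otimes>\<^bsub>X\<^esub> y) \<otimes>\<^bsub>X\<^esub> inv\<^bsub>X\<^esub> (x' \<otimes>\<^bsub>X\<^esub> y')
      = (x \<otimes>\<^bsub>X\<^esub> inv\<^bsub>X\<^esub> x') \<otimes>\<^bsub>X\<^esub> (y \<otimes>\<^bsub>X\<^esub> inv\<^bsub>X\<^esub> y')"
    using assms by (simp add: X.inv_mult X.m_ac)
  then show ?thesis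
    using assms by (simp add: coset_eq_iff subgroup.m_closed)
qed

text \<open>Serves two purposes: \<open>cut W\<close> and \<open>cut (- W)\<close> split a
  configuration into two factors, and \<open>cut W\<close> extends a function known on
  \<open>W\<close> only to a configuration.\<close>

definition cut :: "int set \<Rightarrow> (int \<Rightarrow> nat) \<Rightarrow> int \<Rightarrow> nat" where
  "cut W x = (\<lambda>i. if i \<in> W then x i else \<one>\<^bsub>G\<^esub>)"

lemma cut_closed [simp]: "x \<in> C \<Longrightarrow> cut W x \<in> C"
  by (auto simp: cut_def intro!: configI)

lemma cut_PiE [simp]: "x \<in> W \<rightarrow>\<^sub>E carrier G \<Longrightarrow> cut W x \<in> C"
  by (auto simp: cut_def intro!: configI)

lemma cut_mult_cut: "x \<in> C \<Longrightarrow> W' = - W \<Longrightarrow> cut W x \<otimes>\<^bsub>X\<^esub> cut W' x = x"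
  by (auto simp: cut_def)

text \<open>Every coset has a representative that is trivial outside \<open>W\<close>, and there are
  finitely many of these.\<close>

lemma finite_cosets:
  assumes "subgroup U X" "determined U W" "finite W"
  shows "finite (cosets U)"
proof -
  have "cosets U \<subseteq> (\<lambda>x. U #>\<^bsub>X\<^esub> cut W x) ` (W \<rightarrow>\<^sub>E carrier G)"
    unfolding cosets_def
  proof (intro image_subsetI)
    fix x assume x: "x \<in> C"
    have "U #>\<^bsub>X\<^esub> x = U #>\<^bsub>X\<^esub> cut W (restrict x W)"
      using assms x by (intro coset_eqI[of U W]) (auto simp: cut_def intro!: configI)
    then show "U #>\<^bsub>X\<^esub> x \<in> (\<lambda>x. U #>\<^bsub>X\<^esub> cut W x) ` (W \<rightarrow>\<^sub>E carrier G)"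
      using x by (auto simp del: restrict_apply intro!: image_eqI[of _ _ "restrict x W"])
  qed
  then show ?thesis
    by (rule finite_subset) (intro finite_imageI finite_PiE finite_G assms)
qed

text \<open>The hypothesis makes \<open>f\<close> factor through \<open>g\<close> on
  \<open>A\<close>. Finiteness is asked of the image of \<open>g\<close>, since \<open>A\<close>
  will be the whole configuration space.\<close>

lemma card_image_le_card_image:
  assumes "finite (g ` A)" "\<And>x y. x \<in> A \<Longrightarrow> y \<in> A \<Longrightarrow> g x = g y \<Longrightarrow> f x = f y"
  shows "card (f ` A) \<le> card (g ` A)"
proof -
  have "f ` A = (\<lambda>z. f (SOME x. x \<in> A \<and> g x = z)) ` g ` A"
  proof -
    have "f (SOME y. y \<in> A \<and> g y = g x) = f x" if "x \<in> A" for x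
      using someI[of "\<lambda>y. y \<in> A \<and> g y = g x" x] that assms(2) by blast
    then show ?thesis by (simp add: image_image cong: image_cong)
  qed
  then show ?thesis using card_image_le[OF assms(1)] by metis
qed

lemma subgroup_vimage:
  assumes U: "subgroup U X" and T: "T \<in> hom X X"
  shows "subgroup {x \<in> C. T x \<in> U} X"
proof -
  interpret T: group_hom X X T
    using T by (simp add: group_hom_def group_hom_axioms_def)
  show ?thesis
    using U by (intro X.subgroupI) (auto simp: subgroup.m_inv_closed subgroup.m_closed
        subgroup.one_closed intro!: exI[of _ e])
qed

text \<open>\<open>T\<close> induces an injection of the quotient by the preimage into the quotient
  by \<open>U\<close>. For \<open>T\<close> a shift or a gap insertion this keeps the index
  minimal.\<close>

lemma index_vimage_le:
  assumes U: "subgroup U X" "finite (cosets U)" and T: "T \<in> hom X X"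
  shows "index {x \<in> C. T x \<in> U} \<le> index U"
proof -
  interpret T: group_hom X X T
    using T by (simp add: group_hom_def group_hom_axioms_def)
  let ?V = "{x \<in> C. T x \<in> U}"
  have eq: "?V #>\<^bsub>X\<^esub> x = ?V #>\<^bsub>X\<^esub> y \<longleftrightarrow> U #>\<^bsub>X\<^esub> T x = U #>\<^bsub>X\<^esub> T y" if "x \<in> C" "y \<in> C" for x y
    using that U by (simp add: coset_eq_iff subgroup_vimage T)
  have sub: "(\<lambda>x. U #>\<^bsub>X\<^esub> T x) ` C \<subseteq> cosets U"
    by (auto simp: cosets_def)
  have "index ?V \<le> card ((\<lambda>x. U #>\<^bsub>X\<^esub> T x) ` C)"
    unfolding cosets_def using eq finite_subset[OF sub U(2)] by (intro card_image_le_card_image) auto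
  also have "\<dots> \<le> index U"
    by (rule card_mono[OF U(2) sub])
  finally show ?thesis .
qed

text \<open>The canonical map from the cosets of \<open>U\<close> to those of \<open>V\<close> is
  onto, and it identifies the coset of an element of \<open>V - U\<close> with that of the
  identity.\<close>

lemma index_less:
  assumes U: "subgroup U X" "finite (cosets U)" and V: "subgroup V X" and "U \<subset> V"
  shows "index V < index U"
proof -
  obtain z where z: "z \<in> V" "z \<notin> U" using assms by blast
  then have zC: "z \<in> C" using subgroup.mem_carrier[OF V] by blast
  have U_V: "V #>\<^bsub>X\<^esub> x = V #>\<^bsub>X\<^esub> y" if "U #>\<^bsub>X\<^esub> x = U #>\<^bsub>X\<^esub> y" "x \<in> C" "y \<in> C" for x y
    using that \<open>U \<subset> V\<close> U V by (auto simp: coset_eq_iff)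
  let ?h = "\<lambda>K. V #>\<^bsub>X\<^esub> (SOME x. x \<in> C \<and> U #>\<^bsub>X\<^esub> x = K)"
  have h: "?h (U #>\<^bsub>X\<^esub> x) = V #>\<^bsub>X\<^esub> x" if "x \<in> C" for x
    using someI[of "\<lambda>y. y \<in> C \<and> U #>\<^bsub>X\<^esub> y = U #>\<^bsub>X\<^esub> x" x] that U_V by blast
  then have im: "?h ` cosets U = cosets V"
    by (simp add: cosets_def image_image cong: image_cong)
  have "\<not> inj_on ?h (cosets U)"
  proof
    assume inj: "inj_on ?h (cosets U)"
    have "?h (U #>\<^bsub>X\<^esub> z) = ?h (U #>\<^bsub>X\<^esub> e)"
      using z zC V by (subst (1 2) h) (auto simp: coset_eq_iff)
    then have "U #>\<^bsub>X\<^esub> z = U #>\<^bsub>X\<^esub> e"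
      by (rule inj_onD[OF inj _ coset_in_cosets[OF zC] coset_in_cosets[OF X.one_closed]])
    then show False using z zC U by (simp add: coset_eq_iff)
  qed
  then have "card (?h ` cosets U) \<noteq> index U"
    using eq_card_imp_inj_on[OF U(2)] by blast
  then have "card (?h ` cosets U) < index U"
    using card_image_le[OF U(2)] le_neq_implies_less by blast
  then show ?thesis by (simp only: im)
qed

section \<open>Shifts and the sites that a subgroup sees\<close>

definition shift :: "int \<Rightarrow> (int \<Rightarrow> nat) \<Rightarrow> int \<Rightarrow> nat" where
  "shift d x = (\<lambda>i. x (i + d))"

lemma shift_apply [simp]: "shift d x i = x (i + d)"
  by (simp add: shift_def)

lemma shift_closed [simp]: "x \<in> C \<Longrightarrow> shift d x \<in> C"
  by (auto intro!: configI)

lemma shift_hom: "shift d \<in> hom X X"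
  by (auto simp: hom_def)

lemma shift_zero: "shift 0 x = x"
  by (simp add: shift_def)

lemma shift_mult: "shift d (x \<otimes>\<^bsub>X\<^esub> y) = shift d x \<otimes>\<^bsub>X\<^esub> shift d y"
  and shift_one: "shift d e = e"
  and shift_inv: "x \<in> C \<Longrightarrow> shift d (inv\<^bsub>X\<^esub> x) = inv\<^bsub>X\<^esub> (shift d x)"
  by (auto intro!: ext)

text \<open>If no configuration supported at \<open>s\<close> leaves \<open>U\<close>, the component
  at \<open>s\<close> can be split off without affecting membership.\<close>

lemma determined_remove:
  assumes U: "subgroup U X" "determined U (insert s W)"
    and s: "\<And>x. x \<in> C \<Longrightarrow> (\<And>i. i \<noteq> s \<Longrightarrow> x i = \<one>\<^bsub>G\<^esub>) \<Longrightarrow> x \<in> U"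
  shows "determined U W"
  unfolding determined_def
proof (intro ballI impI)
  fix x assume x: "x \<in> C" "\<forall>i\<in>W. x i = \<one>\<^bsub>G\<^esub>"
  have "cut {s} x \<in> U" by (rule s) (use x in \<open>simp_all add: cut_def[of "{s}"] configI\<close>)
  moreover have "cut (- {s}) x \<in> U"
    by (rule determinedD[OF U(2)]) (use x in \<open>auto simp: cut_def[of "- {s}"] configI\<close>)
  ultimately show "x \<in> U"
    using subgroup.m_closed[OF U(1)] cut_mult_cut[OF x(1) refl, of "{s}"] by metis
qed

text \<open>Otherwise the sites of \<open>W\<close> could be removed one by one, and a subgroup
  determined by the empty set is everything.\<close>

lemma ex_single_site:
  assumes "finite W" "subgroup U X" "determined U W" "U \<noteq> C"
  shows "\<exists>s\<in>W. \<exists>x\<in>C. x \<notin> U \<and> (\<forall>i. i \<noteq> s \<longrightarrow> x i = \<one>\<^bsub>G\<^esub>)"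
  using assms
proof (induction W rule: finite_induct)
  case empty
  then show ?case using subgroup.subset[of U X] by (auto simp: determined_def)
next
  case (insert s W)
  then show ?case using determined_remove[of U s W] by blast
qed

end

section \<open>Additive automata and their finite factors\<close>

locale additive_automaton = finite_config +
  fixes r :: nat and \<delta> :: "nat list \<Rightarrow> nat"
  assumes additive: "additive_ca G r \<delta>"
begin

abbreviation "F \<equiv> ca_map r \<delta>"

lemma F_hom: "F \<in> hom X X"
  using additive by (simp add: additive_ca_def)

sublocale F: group_hom X X F
  by (simp add: group_hom_def group_hom_axioms_def F_hom)

lemma F_cong:
  assumes "\<And>j. \<bar>j - i\<bar> \<le> int r \<Longrightarrow> x j = y j"
  shows "F x i = F y i"
proof -
  have "map x [i - int r..i + int r] = map y [i - int r..i + int r]"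
    using assms by auto
  then show ?thesis unfolding ca_map_def by (rule arg_cong)
qed

lemma F_one_outside:
  assumes "\<And>j. \<bar>j - i\<bar> \<le> int r \<Longrightarrow> x j = \<one>\<^bsub>G\<^esub>"
  shows "F x i = \<one>\<^bsub>G\<^esub>"
  using F_cong[of i x e] assms F.hom_one by simp

lemma F_shift: "F (shift d x) = shift d (F x)"
proof (rule ext)
  fix i
  have "map (shift d x) [i - int r..i + int r] = map x [i + d - int r..i + d + int r]"
    by (rule nth_equalityI) (auto simp: algebra_simps)
  then show "F (shift d x) i = shift d (F x) i"
    by (simp add: ca_map_def)
qed

text \<open>The quotient of the configuration group by such a \<open>U\<close> is a nontrivial finite factor of the
  automaton.\<close>

definition proper_factor :: "(int \<Rightarrow> nat) set \<Rightarrow> bool" where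
  "proper_factor U \<longleftrightarrow> subgroup U X \<and> U \<noteq> C \<and> F ` U \<subseteq> U \<and> (\<exists>W. finite W \<and> determined U W)"

lemma finite_cosets_factor: "proper_factor U \<Longrightarrow> finite (cosets U)"
  unfolding proper_factor_def using finite_cosets by blast

lemma proper_factor_shift:
  assumes "proper_factor U"
  shows "proper_factor {x \<in> C. shift d x \<in> U}"
  unfolding proper_factor_def
proof (intro conjI)
  from assms have U: "subgroup U X" "U \<noteq> C" "F ` U \<subseteq> U" "\<exists>W. finite W \<and> determined U W"
    by (auto simp: proper_factor_def)
  then obtain W where W: "finite W" "determined U W" by blast
  show "subgroup {x \<in> C. shift d x \<in> U} X"
    by (rule subgroup_vimage[OF U(1) shift_hom])
  obtain y where y: "y \<in> C" "y \<notin> U"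
    using U(1,2) subgroup.subset by blast
  then have "shift (- d) y \<in> C" "shift d (shift (- d) y) \<notin> U"
    by (simp, simp add: shift_def)
  then show "{x \<in> C. shift d x \<in> U} \<noteq> C"
    by blast
  show "F ` {x \<in> C. shift d x \<in> U} \<subseteq> {x \<in> C. shift d x \<in> U}"
    using U(3) by (auto simp: F_shift[symmetric])
  have "determined {x \<in> C. shift d x \<in> U} ((\<lambda>i. i + d) ` W)"
    unfolding determined_def using determinedD[OF W(2)] by auto
  with W(1) show "\<exists>W. finite W \<and> determined {x \<in> C. shift d x \<in> U} W"
    by blast
qed

text \<open>The codings of the iterated shifts modulo a minimal kernel are independent of each other,
  because the leftmost site that the kernel sees is invisible to the proper shifts.\<close>

lemma shifts_onto:
  assumes U: "proper_factor U" and min: "\<And>V. proper_factor V \<Longrightarrow> index U \<le> index V"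
    and a: "\<And>i. i < L \<Longrightarrow> a i \<in> C"
  shows "\<exists>x\<in>C. \<forall>i<L. U #>\<^bsub>X\<^esub> shift (int i) x = U #>\<^bsub>X\<^esub> a i"
  using a
proof (induction L arbitrary: a)
  case 0
  show ?case by (auto intro: X.one_closed)
next
  case (Suc L)
  from U obtain W where U': "subgroup U X" "U \<noteq> C" "F ` U \<subseteq> U" and W: "finite W" "determined U W"
    by (auto simp: proper_factor_def)
  \<comment> \<open>Multiplying a solution by an element of \<open>V\<close> keeps the cosets of its
    shifts by \<open>1, ..., L\<close>. So it remains to see that \<open>V\<close> meets every coset
    of \<open>U\<close>.\<close>
  define V where "V = {x \<in> C. \<forall>i<L. shift (int (Suc i)) x \<in> U}"
  have V: "subgroup V X"
    using subgroup.m_closed[OF U'(1)] subgroup.m_inv_closed[OF U'(1)] subgroup.one_closed[OF U'(1)]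
    by (intro X.subgroupI) (auto simp: V_def shift_mult shift_inv shift_one intro!: exI[of _ e])
  have FV: "F ` V \<subseteq> V"
    using U'(3) by (auto simp: V_def F_shift[symmetric])
  let ?Z = "U <#>\<^bsub>X\<^esub> V"
  have Z: "subgroup ?Z X" by (rule X.mult_subgroups[OF U'(1) V])
  have UZ: "U \<subseteq> ?Z"
  proof
    fix u assume "u \<in> U"
    moreover have "u \<otimes>\<^bsub>X\<^esub> e = u" using \<open>u \<in> U\<close> subgroup.mem_carrier[OF U'(1)] by simp
    ultimately show "u \<in> ?Z" using subgroup.one_closed[OF V] unfolding set_mult_def by blast
  qed
  have VZ: "V \<subseteq> ?Z"
  proof
    fix u assume "u \<in> V"
    moreover have "e \<otimes>\<^bsub>X\<^esub> u = u" using \<open>u \<in> V\<close> subgroup.mem_carrier[OF V] by simp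
    ultimately show "u \<in> ?Z" using subgroup.one_closed[OF U'(1)] unfolding set_mult_def by blast
  qed
  have FZ: "F ` ?Z \<subseteq> ?Z"
  proof (intro image_subsetI)
    fix z assume "z \<in> ?Z"
    then obtain u v where uv: "u \<in> U" "v \<in> V" "z = u \<otimes>\<^bsub>X\<^esub> v" by (auto simp: set_mult_def)
    then have "F z = F u \<otimes>\<^bsub>X\<^esub> F v"
      using subgroup.mem_carrier[OF U'(1)] subgroup.mem_carrier[OF V] by simp
    moreover have "F u \<in> U" "F v \<in> V" using uv U'(3) FV by auto
    ultimately show "F z \<in> ?Z" unfolding set_mult_def by blast
  qed
  \<comment> \<open>Were \<open>U V\<close> proper, minimality of the index would force
    \<open>U V = U\<close> and so \<open>V \<subseteq> U\<close>; the configuration found below lies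
    in \<open>V\<close> but not in \<open>U\<close>.\<close>
  have "?Z = C"
  proof (rule ccontr)
    assume "?Z \<noteq> C"
    with Z FZ W UZ have "proper_factor ?Z"
      unfolding proper_factor_def using determined_mono[OF W(2) order_refl UZ] by blast
    then have "\<not> index ?Z < index U" using min by force
    then have "U = ?Z"
      using index_less[OF U'(1) finite_cosets[OF U'(1) W(2,1)] Z] UZ by blast
    then have "V \<subseteq> U" using VZ by simp
    \<comment> \<open>\<open>?S\<close> collects the sites that \<open>U\<close> sees. A
      configuration outside \<open>U\<close> supported at the leftmost one is carried to invisible
      sites by every proper left shift, hence lies in \<open>V\<close>.\<close>
    let ?S = "{s. \<exists>x\<in>C. x \<notin> U \<and> (\<forall>i. i \<noteq> s \<longrightarrow> x i = \<one>\<^bsub>G\<^esub>)}"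
    have "?S \<subseteq> W"
    proof
      fix s assume "s \<in> ?S"
      then obtain x where x: "x \<in> C" "x \<notin> U" "\<And>i. i \<noteq> s \<Longrightarrow> x i = \<one>\<^bsub>G\<^esub>" by blast
      show "s \<in> W"
      proof (rule ccontr)
        assume "s \<notin> W"
        then have "x i = \<one>\<^bsub>G\<^esub>" if "i \<in> W" for i using that x(3)[of i] by metis
        then show False using determinedD[OF W(2) x(1)] x(2) by blast
      qed
    qed
    then have "finite ?S" using W(1) finite_subset by blast
    moreover have "?S \<noteq> {}" using ex_single_site[OF W(1) U'(1) W(2) U'(2)] by blast
    ultimately have s: "Min ?S \<in> ?S" "\<And>t. t \<in> ?S \<Longrightarrow> Min ?S \<le> t"
      using Min_in Min_le by blast+
    then obtain x where x: "x \<in> C" "x \<notin> U" "\<And>i. i \<noteq> Min ?S \<Longrightarrow> x i = \<one>\<^bsub>G\<^esub>"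
      by blast
    have "shift (int (Suc i)) x \<in> U" for i
    proof (rule ccontr)
      assume "shift (int (Suc i)) x \<notin> U"
      moreover have "\<forall>j. j \<noteq> Min ?S - int (Suc i) \<longrightarrow> shift (int (Suc i)) x j = \<one>\<^bsub>G\<^esub>"
        using x(3) by auto
      ultimately have "Min ?S - int (Suc i) \<in> ?S" using shift_closed[OF x(1)] by blast
      then show False using s(2) by force
    qed
    then have "x \<in> V" using x by (auto simp: V_def)
    then show False using \<open>V \<subseteq> U\<close> x by blast
  qed
  have "\<exists>x\<in>C. \<forall>i<L. U #>\<^bsub>X\<^esub> shift (int i) x = U #>\<^bsub>X\<^esub> a (Suc i)"
    using Suc.prems by (intro Suc.IH) auto
  then obtain x0 where x0: "x0 \<in> C" "\<And>i. i < L \<Longrightarrow> U #>\<^bsub>X\<^esub> shift (int i) x0 = U #>\<^bsub>X\<^esub> a (Suc i)"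
    by blast
  \<comment> \<open>Moves the solution of the induction hypothesis from the shifts
    \<open>0, ..., L - 1\<close> to the shifts \<open>1, ..., L\<close>, which leaves shift
    \<open>0\<close> to be corrected.\<close>
  define x where "x = shift (- 1) x0"
  have x: "x \<in> C" using x0 by (simp add: x_def)
  have xi: "U #>\<^bsub>X\<^esub> shift (int (Suc i)) x = U #>\<^bsub>X\<^esub> a (Suc i)" if "i < L" for i
    using x0(2)[OF that] by (simp add: x_def shift_def algebra_simps)
  have a0: "a 0 \<in> C" using Suc.prems by simp
  \<comment> \<open>The factor \<open>v\<close> is the correction: \<open>a 0\<close> and the
    product of \<open>x\<close> and \<open>v\<close> differ by \<open>u\<close>, an element of
    \<open>U\<close>.\<close>
  have "a 0 \<otimes>\<^bsub>X\<^esub> inv\<^bsub>X\<^esub> x \<in> ?Z" using \<open>?Z = C\<close> a0 x by simp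
  then obtain u v where uv: "u \<in> U" "v \<in> V" "a 0 \<otimes>\<^bsub>X\<^esub> inv\<^bsub>X\<^esub> x = u \<otimes>\<^bsub>X\<^esub> v"
    by (auto simp: set_mult_def)
  have uC: "u \<in> C" and vC: "v \<in> C"
    using uv subgroup.mem_carrier[OF U'(1)] subgroup.mem_carrier[OF V] by auto
  have "U #>\<^bsub>X\<^esub> shift (int i) (x \<otimes>\<^bsub>X\<^esub> v) = U #>\<^bsub>X\<^esub> a i" if "i < Suc L" for i
  proof (cases i)
    case 0
    have "(x \<otimes>\<^bsub>X\<^esub> v) \<otimes>\<^bsub>X\<^esub> inv\<^bsub>X\<^esub> a 0 = inv\<^bsub>X\<^esub> u"
    proof -
      have "a 0 = u \<otimes>\<^bsub>X\<^esub> v \<otimes>\<^bsub>X\<^esub> x"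
        using uv(3) a0 x uC vC by (metis X.inv_solve_right' X.m_closed X.inv_closed)
      then show ?thesis
        using x uC vC by (simp add: X.inv_mult X.m_ac X.inv_solve_left')
    qed
    then show ?thesis
      using 0 x vC a0 uv(1) U'(1) by (simp add: shift_zero coset_eq_iff subgroup.m_inv_closed)
  next
    case (Suc j)
    then have "shift (int i) v \<in> U" "j < L" using uv(2) that by (auto simp: V_def)
    then have "U #>\<^bsub>X\<^esub> (shift (int i) x \<otimes>\<^bsub>X\<^esub> shift (int i) v) = U #>\<^bsub>X\<^esub> (a i \<otimes>\<^bsub>X\<^esub> e)"
      using Suc xi[of j] x vC Suc.prems that U'(1)
      by (intro coset_mult_cong) (auto simp: coset_eq_iff)
    then show ?thesis using Suc.prems that x vC by (simp add: shift_mult)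
  qed
  then show ?case using x vC by blast
qed

text \<open>A comparison of growth rates: with more than \<open>n\<close> cosets there would be at
  least \<open>(n + 1) ^ L\<close> coset patterns for the shifts \<open>0, ..., L - 1\<close>, all
  of them read from \<open>w + L\<close> cells with \<open>n\<close> values each.\<close>

lemma index_le:
  assumes U: "proper_factor U" and min: "\<And>V. proper_factor V \<Longrightarrow> index U \<le> index V"
  shows "index U \<le> n"
proof (rule ccontr)
  assume "\<not> index U \<le> n"
  then have big: "Suc n \<le> index U" by simp
  from U obtain W where U': "subgroup U X" and W: "finite W" "determined U W"
    by (auto simp: proper_factor_def)
  obtain l where l: "W \<subseteq> {- l..l}"
  proof -
    have "bdd_above (abs ` W)" using W(1) by simp
    then obtain l where "\<And>i. i \<in> W \<Longrightarrow> \<bar>i\<bar> \<le> l" by (auto simp: bdd_above_def)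
    then show ?thesis by (intro that[of l]) fastforce
  qed
  define w where "w = nat (2 * l + 1)"
  have "Suc n ^ L \<le> n ^ (w + L)" for L
  proof -
    \<comment> \<open>Contains the window of every shift by \<open>0, ..., L - 1\<close>; the upper
      end leaves one spare cell, still within the count \<open>w + L\<close>.\<close>
    define D where "D = {- l..l + int L}"
    have D: "finite D" "card D \<le> w + L" by (auto simp: D_def w_def)
    let ?\<psi> = "\<lambda>x. \<lambda>i\<in>{..<L}. U #>\<^bsub>X\<^esub> shift (int i) (cut D x)"
    have "{..<L} \<rightarrow>\<^sub>E cosets U \<subseteq> ?\<psi> ` (D \<rightarrow>\<^sub>E carrier G)"
    proof
      fix k assume k: "k \<in> {..<L} \<rightarrow>\<^sub>E cosets U"
      then have "\<forall>i\<in>{..<L}. \<exists>a\<in>C. k i = U #>\<^bsub>X\<^esub> a" by (auto simp: cosets_def PiE_def Pi_def image_iff)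
      then obtain a where a: "\<And>i. i < L \<Longrightarrow> a i \<in> C" "\<And>i. i < L \<Longrightarrow> k i = U #>\<^bsub>X\<^esub> a i"
        by (metis lessThan_iff)
      obtain x where x: "x \<in> C" "\<And>i. i < L \<Longrightarrow> U #>\<^bsub>X\<^esub> shift (int i) x = U #>\<^bsub>X\<^esub> a i"
        using shifts_onto[OF U min, of L a] a(1) by auto
      have "U #>\<^bsub>X\<^esub> shift (int i) (cut D (restrict x D)) = U #>\<^bsub>X\<^esub> shift (int i) x" if "i < L" for i
        using x(1) l that by (intro coset_eqI[OF U' W(2)]) (auto simp: cut_def D_def intro!: configI)
      then have "k = ?\<psi> (restrict x D)"
        using k x a by (auto simp: fun_eq_iff PiE_def extensional_def)
      then show "k \<in> ?\<psi> ` (D \<rightarrow>\<^sub>E carrier G)"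
        using x(1) by (intro image_eqI) auto
    qed
    moreover have "finite (D \<rightarrow>\<^sub>E carrier G)" using D finite_G by (intro finite_PiE) auto
    ultimately have "card ({..<L} \<rightarrow>\<^sub>E cosets U) \<le> card (D \<rightarrow>\<^sub>E carrier G)"
      by (rule surj_card_le[rotated])
    then have "index U ^ L \<le> n ^ card D" using D by (simp add: card_funcsetE)
    also have "\<dots> \<le> n ^ (w + L)" using D n_pos by (intro power_increasing) auto
    finally show ?thesis using power_mono[OF big, of L] by simp
  qed
  \<comment> \<open>The constant \<open>n ^ w\<close> is overtaken because
    \<open>Suc n / n > 1\<close>.\<close>
  moreover obtain L where "real (n ^ w) < (real (Suc n) / real n) ^ L"
    using real_arch_pow[of "real (Suc n) / real n" "real (n ^ w)"] n_pos by (auto simp: field_simps)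
  then have "real (n ^ w) * real n ^ L < real (Suc n) ^ L"
    using n_pos by (simp add: power_divide field_simps)
  then have "real (n ^ (w + L)) < real (Suc n ^ L)"
    by (simp add: power_add)
  then have "n ^ (w + L) < Suc n ^ L"
    by (simp only: of_nat_less_iff)
  ultimately show False by (meson leD)
qed

text \<open>Composing a local homomorphism with \<open>insert_gap i j\<close> deletes its components at the
  sites \<open>i, \<dots>, j - 1\<close>.\<close>

definition insert_gap :: "int \<Rightarrow> int \<Rightarrow> (int \<Rightarrow> nat) \<Rightarrow> int \<Rightarrow> nat" where
  "insert_gap i j x = (\<lambda>y. if y < i then x y else if y < j then \<one>\<^bsub>G\<^esub> else x (y - (j - i)))"

lemma insert_gap_closed [simp]: "x \<in> C \<Longrightarrow> insert_gap i j x \<in> C"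
  unfolding insert_gap_def by (rule configI) simp

lemma insert_gap_hom: "insert_gap i j \<in> hom X X"
  by (rule homI) (simp, simp add: insert_gap_def fun_eq_iff)

lemma insert_gap_right:
  assumes "i < j" "\<And>y. y < i \<Longrightarrow> x y = \<one>\<^bsub>G\<^esub>"
  shows "insert_gap i j x = shift (i - j) x"
  using assms by (auto simp: insert_gap_def algebra_simps)

text \<open>The hypothesis \<open>state\<close> says that \<open>U\<close> cannot tell a word of
  length \<open>2 * r\<close> at site \<open>i\<close> from the same word at site \<open>j\<close>.
  Far to the left the insertion does nothing, far to the right it is a shift, and both commute with
  \<open>F\<close>; the disturbance near the cut is confined to such words.\<close>

lemma insert_gap_commutes:
  assumes U: "subgroup U X" "F ` U \<subseteq> U" and ij: "i < j"
    and state: "\<And>z. z \<in> C \<Longrightarrow> (\<And>y. y < i \<or> i + 2 * int r \<le> y \<Longrightarrow> z y = \<one>\<^bsub>G\<^esub>) \<Longrightarrow>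
      U #>\<^bsub>X\<^esub> z = U #>\<^bsub>X\<^esub> shift (i - j) z"
    and x: "x \<in> C"
  shows "U #>\<^bsub>X\<^esub> insert_gap i j (F x) = U #>\<^bsub>X\<^esub> F (insert_gap i j x)"
proof -
  let ?T = "insert_gap i j"
  interpret T: group_hom X X ?T
    by (simp add: group_hom_def group_hom_axioms_def insert_gap_hom)
  \<comment> \<open>Sites left of \<open>i\<close> are not moved. What remains is a word of length
    \<open>2 * r\<close> at site \<open>i\<close>, to which \<open>state\<close> applies.\<close>
  have near: "U #>\<^bsub>X\<^esub> ?T z = U #>\<^bsub>X\<^esub> z" if z: "z \<in> C" "\<And>y. i + 2 * int r \<le> y \<Longrightarrow> z y = \<one>\<^bsub>G\<^esub>" for z
  proof -
    have "?T (cut {..<i} z) = cut {..<i} z"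
      using ij by (auto simp: insert_gap_def cut_def)
    moreover have "U #>\<^bsub>X\<^esub> ?T (cut {i..} z) = U #>\<^bsub>X\<^esub> cut {i..} z"
    proof (subst insert_gap_right[OF ij])
      show "U #>\<^bsub>X\<^esub> shift (i - j) (cut {i..} z) = U #>\<^bsub>X\<^esub> cut {i..} z"
        using z by (intro state[symmetric] cut_closed) (auto simp: cut_def)
    qed (simp add: cut_def)
    ultimately have "U #>\<^bsub>X\<^esub> (?T (cut {..<i} z) \<otimes>\<^bsub>X\<^esub> ?T (cut {i..} z))
        = U #>\<^bsub>X\<^esub> (cut {..<i} z \<otimes>\<^bsub>X\<^esub> cut {i..} z)"
      using z U(1) by (intro coset_mult_cong) auto
    then show ?thesis using z by (simp add: T.hom_mult[symmetric] cut_mult_cut set_eq_iff not_less del: T.hom_mult)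
  qed
  \<comment> \<open>Splitting at \<open>i + r\<close> leaves a margin of \<open>r\<close> on each
    side: \<open>F x1\<close> still vanishes from \<open>i + 2 * r\<close> on, and
    \<open>F x2\<close> still vanishes left of \<open>i\<close>.\<close>
  let ?W = "{..<i + int r}" and ?W' = "{i + int r..}"
  define x1 where "x1 = cut ?W x"
  define x2 where "x2 = cut ?W' x"
  have x12: "x1 \<in> C" "x2 \<in> C" "x = x1 \<otimes>\<^bsub>X\<^esub> x2"
    using x by (auto simp: x1_def x2_def cut_mult_cut)
  have "U #>\<^bsub>X\<^esub> ?T (F x1) = U #>\<^bsub>X\<^esub> F x1"
  proof (rule near)
    show "F x1 y = \<one>\<^bsub>G\<^esub>" if "i + 2 * int r \<le> y" for y
      by (rule F_one_outside) (use that in \<open>auto simp: x1_def cut_def\<close>)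
  qed (use x12(1) in simp)
  also have "\<dots> = U #>\<^bsub>X\<^esub> F (?T x1)"
  proof -
    have "U #>\<^bsub>X\<^esub> ?T x1 = U #>\<^bsub>X\<^esub> x1"
      by (rule near[OF x12(1)]) (simp add: x1_def cut_def)
    then have "x1 \<otimes>\<^bsub>X\<^esub> inv\<^bsub>X\<^esub> ?T x1 \<in> U" using x12(1) U(1) by (metis coset_eq_iff insert_gap_closed)
    then have "F (x1 \<otimes>\<^bsub>X\<^esub> inv\<^bsub>X\<^esub> ?T x1) \<in> U" using U(2) by blast
    then show ?thesis using x12(1) U(1) by (simp add: coset_eq_iff)
  qed
  finally have 1: "U #>\<^bsub>X\<^esub> ?T (F x1) = U #>\<^bsub>X\<^esub> F (?T x1)" .
  have "?T x2 = shift (i - j) x2"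
    by (rule insert_gap_right[OF ij]) (auto simp: x2_def cut_def)
  moreover have "?T (F x2) = shift (i - j) (F x2)"
    by (rule insert_gap_right[OF ij]) (rule F_one_outside, auto simp: x2_def cut_def)
  ultimately have 2: "?T (F x2) = F (?T x2)"
    by (simp add: F_shift)
  have "U #>\<^bsub>X\<^esub> (?T (F x1) \<otimes>\<^bsub>X\<^esub> ?T (F x2)) = U #>\<^bsub>X\<^esub> (F (?T x1) \<otimes>\<^bsub>X\<^esub> F (?T x2))"
    by (rule coset_mult_cong[OF U(1)]) (use x12(1,2) 1 2 in simp_all)
  then show ?thesis using x12 by simp
qed

text \<open>Normalises windows to start at site \<open>0\<close>, so that a window is described by
  its length and minimal windows can be chosen.\<close>

lemma ex_proper_factor_shift_zero:
  assumes "proper_factor U"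
  shows "\<exists>V w. proper_factor V \<and> index V \<le> index U \<and> determined V {0..<int w}"
proof -
  from assms obtain W where U': "subgroup U X" and W: "finite W" "determined U W"
    by (auto simp: proper_factor_def)
  obtain l where l: "W \<subseteq> {- l..l}"
  proof -
    have "bdd_above (abs ` W)" using W(1) by simp
    then obtain l where "\<And>i. i \<in> W \<Longrightarrow> \<bar>i\<bar> \<le> l" by (auto simp: bdd_above_def)
    then show ?thesis by (intro that[of l]) fastforce
  qed
  let ?V = "{x \<in> C. shift l x \<in> U}"
  have "determined ?V {0..<int (nat (2 * l + 1))}"
    unfolding determined_def
  proof (intro ballI impI CollectI conjI)
    fix x assume x: "x \<in> C" "\<forall>i\<in>{0..<int (nat (2 * l + 1))}. x i = \<one>\<^bsub>G\<^esub>"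
    show "shift l x \<in> U" using x l by (intro determinedD[OF W(2)]) fastforce+
  qed
  then show ?thesis
    using proper_factor_shift[OF assms] index_vimage_le[OF U' finite_cosets[OF U' W(2,1)] shift_hom]
    by blast
qed

text \<open>If \<open>U\<close> needs a longer window, then two of the maps from \<open>G\<close>-words of length \<open>2 * r\<close> to the
  cosets of \<open>U\<close>, obtained by placing the word at different sites, coincide, and the block between
  these sites can be deleted.\<close>

lemma ex_short_factor:
  assumes "proper_factor U0"
  shows "\<exists>U w. proper_factor U \<and> determined U {0..<int w} \<and> w \<le> n ^ (n ^ (2 * r))"
proof -
  \<comment> \<open>Two nested minima: the index, which makes \<open>index_le\<close> applicable,
    and then the window length among factors of that index, which a deletion would
    contradict.\<close>
  define m where "m = (LEAST m. \<exists>U. proper_factor U \<and> index U = m)"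
  have m: "\<exists>U. proper_factor U \<and> index U = m"
    unfolding m_def by (rule LeastI_ex) (use assms in blast)
  have m_le: "m \<le> index V" if "proper_factor V" for V
    unfolding m_def by (rule Least_le) (use that in blast)
  let ?P = "\<lambda>w. \<exists>U. proper_factor U \<and> index U = m \<and> determined U {0..<int w}"
  have ex: "\<exists>w. ?P w"
    using m ex_proper_factor_shift_zero m_le by (metis le_antisym)
  define w where "w = (LEAST w. ?P w)"
  obtain U where U: "proper_factor U" "index U = m" "determined U {0..<int w}"
    using LeastI_ex[OF ex] unfolding w_def by blast
  have w_le: "w \<le> w'" if "proper_factor V" "index V \<le> m" "determined V {0..<int w'}" for V w'
    unfolding w_def by (rule Least_le) (use that m_le in \<open>blast intro: le_antisym\<close>)
  have U': "subgroup U X" "U \<noteq> C" "F ` U \<subseteq> U"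
    using U(1) by (auto simp: proper_factor_def)
  have finU: "finite (cosets U)" by (rule finite_cosets_factor[OF U(1)])
  have "w \<noteq> 0"
    using U(3) U'(2) subgroup.subset[OF U'(1)] by (auto simp: determined_def)
  \<comment> \<open>Otherwise site \<open>0\<close> could be dropped and the window shifted, against
    the minimality of \<open>w\<close>. The element found here will show that the factor stays
    proper after the deletion.\<close>
  have "\<exists>x\<in>C. x \<notin> U \<and> (\<forall>i. i \<noteq> 0 \<longrightarrow> x i = \<one>\<^bsub>G\<^esub>)"
  proof (rule ccontr)
    assume contr: "\<not> ?thesis"
    have "determined U (insert 0 {1..<int w})"
      using U(3) by (rule determined_mono) auto
    then have det: "determined U {1..<int w}"
      by (rule determined_remove[OF U'(1)]) (use contr in blast)
    have "determined {x \<in> C. shift (- 1) x \<in> U} {0..<int (w - 1)}"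
      unfolding determined_def
    proof (intro ballI impI CollectI conjI)
      fix x assume x: "x \<in> C" "\<forall>i\<in>{0..<int (w - 1)}. x i = \<one>\<^bsub>G\<^esub>"
      show "shift (- 1) x \<in> U"
        by (rule determinedD[OF det]) (use x \<open>w \<noteq> 0\<close> in simp_all)
    qed
    from w_le[OF proper_factor_shift[OF U(1)] _ this] show False
      using index_vimage_le[OF U'(1) finU shift_hom, of "- 1"] U(2) \<open>w \<noteq> 0\<close> by linarith
  qed
  then obtain x0 where x0: "x0 \<in> C" "x0 \<notin> U" "\<And>i. i \<noteq> 0 \<Longrightarrow> x0 i = \<one>\<^bsub>G\<^esub>" by blast
  have "w \<le> n ^ (n ^ (2 * r))"
  proof (rule ccontr)
    let ?B = "n ^ (n ^ (2 * r))"
    assume "\<not> w \<le> ?B"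
    then have w: "Suc ?B \<le> w" by simp
    let ?A = "{0..<2 * int r} \<rightarrow>\<^sub>E carrier G"
    \<comment> \<open>\<open>st i\<close> records how \<open>U\<close> sees the words placed at site
      \<open>i\<close>. There are at most \<open>m ^ (n ^ (2 * r))\<close> such maps, and this is at
      most \<open>?B\<close> because the minimal index \<open>m\<close> is at most
      \<open>n\<close>.\<close>
    define st where "st = (\<lambda>i. \<lambda>z\<in>?A. U #>\<^bsub>X\<^esub> shift (- int i) (cut {0..<2 * int r} z))"
    have finA: "finite ?A" using finite_G by (intro finite_PiE) auto
    have "st ` {1..Suc ?B} \<subseteq> ?A \<rightarrow>\<^sub>E cosets U"
      unfolding st_def image_subset_iff restrict_PiE_iff
      by (intro ballI coset_in_cosets shift_closed cut_PiE)
    then have "card (st ` {1..Suc ?B}) \<le> card (?A \<rightarrow>\<^sub>E cosets U)"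
      using finA finU finite_G by (intro card_mono finite_PiE) auto
    also have "\<dots> = m ^ (n ^ (2 * r))"
      using finA finU U(2) by (simp add: card_funcsetE nat_mult_distrib)
    also have "\<dots> \<le> ?B"
      using index_le[OF U(1)] m_le U(2) by (intro power_mono) auto
    finally have "\<not> inj_on st {1..Suc ?B}"
      by (intro pigeonhole) simp
    \<comment> \<open>Positions start at \<open>1\<close> so that site \<open>0\<close> is kept, and
      end at \<open>Suc ?B\<close>, which is at most \<open>w\<close>, so that the deleted sites
      \<open>i, ..., j - 1\<close> lie inside the window.\<close>
    then obtain i j where ij: "1 \<le> i" "i < j" "j \<le> Suc ?B" "st i = st j"
      by (fastforce simp: inj_on_def linorder_neq_iff)
    let ?T = "insert_gap (int i) (int j)"
    have comm: "U #>\<^bsub>X\<^esub> ?T (F x) = U #>\<^bsub>X\<^esub> F (?T x)" if "x \<in> C" for x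
    proof (rule insert_gap_commutes[OF U'(1,3) _ _ that])
      fix z assume z: "z \<in> C" "\<And>y. y < int i \<or> int i + 2 * int r \<le> y \<Longrightarrow> z y = \<one>\<^bsub>G\<^esub>"
      define z' where "z' = restrict (shift (int i) z) {0..<2 * int r}"
      have "z' \<in> ?A" using z(1) by (auto simp: z'_def)
      then have "U #>\<^bsub>X\<^esub> shift (- int i) (cut {0..<2 * int r} z')
          = U #>\<^bsub>X\<^esub> shift (- int j) (cut {0..<2 * int r} z')"
        using fun_cong[OF ij(4), of z'] by (simp add: st_def)
      moreover have "cut {0..<2 * int r} z' = shift (int i) z"
      proof (rule ext)
        fix y
        show "cut {0..<2 * int r} z' y = shift (int i) z y"
          using z(2)[of "y + int i"] by (auto simp: cut_def z'_def)
      qed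
      ultimately show "U #>\<^bsub>X\<^esub> z = U #>\<^bsub>X\<^esub> shift (int i - int j) z"
        by (simp add: shift_def algebra_simps)
    qed (use ij in simp)
    let ?V = "{x \<in> C. ?T x \<in> U}"
    have det: "determined ?V {0..<int (w - (j - i))}"
      unfolding determined_def
    proof (intro ballI impI CollectI conjI)
      fix x assume x: "x \<in> C" "\<forall>y\<in>{0..<int (w - (j - i))}. x y = \<one>\<^bsub>G\<^esub>"
      show "?T x \<in> U"
      proof (rule determinedD[OF U(3)])
        fix y assume "y \<in> {0..<int w}"
        then show "?T x y = \<one>\<^bsub>G\<^esub>"
          using x(2)[rule_format, of y] x(2)[rule_format, of "y - (int j - int i)"] ij w
          by (auto simp: insert_gap_def)
      qed (use x in simp)
    qed
    have "proper_factor ?V"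
      unfolding proper_factor_def
    proof (intro conjI)
      show "subgroup ?V X" by (rule subgroup_vimage[OF U'(1) insert_gap_hom])
      \<comment> \<open>\<open>x0\<close> lives at site \<open>0\<close>, left of the gap, so the
        insertion does not change it.\<close>
      have "?T x0 y = x0 y" for y
        using ij x0(3)[of y] x0(3)[of "y - (int j - int i)"] by (auto simp: insert_gap_def)
      then have "?T x0 = x0" by (rule ext)
      then have "x0 \<notin> ?V" using x0(2) by simp
      then show "?V \<noteq> C" using x0(1) by blast
      show "F ` ?V \<subseteq> ?V"
      proof (intro image_subsetI CollectI conjI)
        fix x assume "x \<in> ?V"
        then have x: "x \<in> C" "?T x \<in> U" by auto
        then have "F (?T x) \<in> U" using U'(3) by blast
        then have "U #>\<^bsub>X\<^esub> F (?T x) = U #>\<^bsub>X\<^esub> e"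
          using x(1) U'(1) by (simp add: coset_eq_iff)
        then have "U #>\<^bsub>X\<^esub> ?T (F x) = U #>\<^bsub>X\<^esub> e"
          using comm[OF x(1)] by simp
        then show "?T (F x) \<in> U" using x U'(1) by (simp add: coset_eq_iff)
      qed (auto)
      show "\<exists>W. finite W \<and> determined ?V W"
        using det by blast
    qed
    moreover have "index ?V \<le> m"
      using index_vimage_le[OF U'(1) finU insert_gap_hom] U(2) by simp
    ultimately have "w \<le> w - (j - i)" using det by (rule w_le)
    then show False using ij w by linarith
  qed
  then show ?thesis using U by blast
qed

end

section \<open>The uniform measure\<close>

context finite_config
begin

abbreviation "\<mu> \<equiv> config_measure G"

sublocale coords: product_prob_space "\<lambda>_::int. uniform_count_measure (carrier G)" UNIV
proof -
  interpret prob_space "uniform_count_measure (carrier G)"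
    using finite_G G.one_closed by (intro prob_space_uniform_count_measure) auto
  show "product_prob_space (\<lambda>_::int. uniform_count_measure (carrier G))"
    by unfold_locales
qed

lemma space_config: "space \<mu> = C"
  by (simp add: config_measure_def space_PiM space_uniform_count_measure config_group_def)

sublocale prob_space \<mu>
  unfolding config_measure_def by (rule coords.prob_space_axioms)

lemma measurable_nth: "{x \<in> C. x i \<in> A} \<in> sets \<mu>"
proof -
  have "(\<lambda>x. x i) \<in> measurable \<mu> (uniform_count_measure (carrier G))"
    unfolding config_measure_def by (rule measurable_component_singleton) simp
  from measurable_sets[OF this, of "A \<inter> carrier G"]
  have "(\<lambda>x. x i) -` (A \<inter> carrier G) \<inter> C \<in> sets \<mu>"
    by (simp add: sets_uniform_count_measure space_config)
  also have "(\<lambda>x. x i) -` (A \<inter> carrier G) \<inter> C = {x \<in> C. x i \<in> A}"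
    by auto
  finally show ?thesis .
qed

lemma measurable_cylinder:
  assumes "finite W"
  shows "{x \<in> C. \<forall>i\<in>W. x i = k i} \<in> sets \<mu>"
  using sets.sets_Collect_finite_All[of W \<mu> "\<lambda>i x. x i = k i"] measurable_nth[of _ "{k _}"] assms
  by (simp add: space_config)

lemma measurable_window:
  assumes "finite W"
  shows "{x \<in> C. restrict x W \<in> P} \<in> sets \<mu>"
proof -
  have "{x \<in> C. restrict x W \<in> P} = (\<Union>p\<in>P \<inter> (W \<rightarrow>\<^sub>E carrier G). {x \<in> C. \<forall>i\<in>W. x i = p i})"
  proof (intro equalityI subsetI)
    fix x assume "x \<in> {x \<in> C. restrict x W \<in> P}"
    then show "x \<in> (\<Union>p\<in>P \<inter> (W \<rightarrow>\<^sub>E carrier G). {x \<in> C. \<forall>i\<in>W. x i = p i})"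
      by (auto intro!: bexI[of _ "restrict x W"])
  next
    fix x assume "x \<in> (\<Union>p\<in>P \<inter> (W \<rightarrow>\<^sub>E carrier G). {x \<in> C. \<forall>i\<in>W. x i = p i})"
    then obtain p where p: "p \<in> P" "p \<in> W \<rightarrow>\<^sub>E carrier G" "x \<in> C" "\<And>i. i \<in> W \<Longrightarrow> x i = p i"
      by blast
    then have "restrict x W = p" by (auto simp: fun_eq_iff PiE_def extensional_def)
    with p show "x \<in> {x \<in> C. restrict x W \<in> P}" by simp
  qed
  moreover have "finite (P \<inter> (W \<rightarrow>\<^sub>E carrier G))"
    using assms finite_G by (intro finite_Int disjI2 finite_PiE) auto
  ultimately show ?thesis
    using measurable_cylinder[OF assms] by (auto intro!: sets.finite_UN)
qed

text \<open>Formulated for all larger windows so that two generators can be described on one common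
  window.\<close>

lemma prod_algebra_window:
  assumes "A \<in> prod_algebra UNIV (\<lambda>_::int. uniform_count_measure (carrier G))"
  shows "\<exists>J. finite J \<and> (\<forall>W. J \<subseteq> W \<longrightarrow> (\<exists>P. A = {x \<in> C. restrict x W \<in> P}))"
proof -
  obtain J E where A: "A = prod_emb UNIV (\<lambda>_. uniform_count_measure (carrier G)) J (Pi\<^sub>E J E)"
    and J: "finite J"
    using assms by (rule prod_algebraE) auto
  have "A = {x \<in> C. restrict x W \<in> {p. restrict p J \<in> Pi\<^sub>E J E}}" if "J \<subseteq> W" for W
  proof -
    have "restrict (restrict x W) J = restrict x J" for x :: "int \<Rightarrow> nat"
      using that by (auto simp: fun_eq_iff)
    then show ?thesis
      unfolding A prod_emb_def space_uniform_count_measure config_group_def mem_Collect_eq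
      by (auto simp del: restrict_apply)
  qed
  then have "\<exists>P. A = {x \<in> C. restrict x W \<in> P}" if "J \<subseteq> W" for W
    by (intro exI) (use that in simp)
  with J show ?thesis by (intro exI[of _ J]) simp
qed

lemma sets_config: "sets \<mu> = sigma_sets C (prod_algebra UNIV (\<lambda>_. uniform_count_measure (carrier G)))"
  by (simp add: config_measure_def sets_PiM space_uniform_count_measure config_group_def)

section \<open>Uniqueness of the product measure and invariance under translations\<close>

lemma distr_eq_config:
  assumes f: "f \<in> measurable \<mu> \<mu>"
    and eq: "\<And>J E. finite J \<Longrightarrow> (\<And>j. j \<in> J \<Longrightarrow> E j \<subseteq> carrier G) \<Longrightarrow>
      measure \<mu> {x \<in> C. \<forall>j\<in>J. f x j \<in> E j} = measure \<mu> {x \<in> C. \<forall>j\<in>J. x j \<in> E j}"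
  shows "distr \<mu> \<mu> f = \<mu>"
proof -
  let ?N = "\<lambda>_::int. uniform_count_measure (carrier G)"
  have "distr \<mu> \<mu> f = PiM UNIV ?N"
  proof (rule coords.PiM_eq)
    show "sets (distr \<mu> \<mu> f) = sets (PiM UNIV ?N)" by (simp add: config_measure_def)
    fix J :: "int set" and E :: "int \<Rightarrow> nat set"
    assume J: "finite J" and E: "\<And>j. j \<in> J \<Longrightarrow> E j \<in> sets (uniform_count_measure (carrier G))"
    have emb: "prod_emb UNIV ?N J (Pi\<^sub>E J E) = {x \<in> C. \<forall>j\<in>J. x j \<in> E j}"
      by (auto simp: prod_emb_def space_uniform_count_measure config_group_def)
    have emb_sets: "prod_emb UNIV ?N J (Pi\<^sub>E J E) \<in> sets \<mu>"
      unfolding config_measure_def using J E by (intro sets_PiM_I) auto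
    have f_C: "f x \<in> C" if "x \<in> C" for x
      using measurable_space[OF f] that by (simp add: space_config)
    have "emeasure (distr \<mu> \<mu> f) (prod_emb UNIV ?N J (Pi\<^sub>E J E))
        = emeasure \<mu> {x \<in> C. \<forall>j\<in>J. f x j \<in> E j}"
      using f_C by (subst emeasure_distr[OF f emb_sets])
        (auto simp: emb space_config intro!: arg_cong[of _ _ "emeasure \<mu>"])
    also have "\<dots> = emeasure \<mu> {x \<in> C. \<forall>j\<in>J. x j \<in> E j}"
      using E by (simp add: emeasure_eq_measure eq[OF J] sets_uniform_count_measure)
    also have "\<dots> = (\<Prod>j\<in>J. emeasure (uniform_count_measure (carrier G)) (E j))"
      unfolding emb[symmetric] config_measure_def using J E by (intro coords.emeasure_PiM_emb) auto
    finally show "emeasure (distr \<mu> \<mu> f) (prod_emb UNIV ?N J (Pi\<^sub>E J E))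
        = (\<Prod>j\<in>J. emeasure (uniform_count_measure (carrier G)) (E j))" .
  qed
  then show ?thesis by (simp add: config_measure_def)
qed

lemma measurable_configI:
  assumes "\<And>x. x \<in> C \<Longrightarrow> f x \<in> C" "\<And>i g. {x \<in> C. f x i = g} \<in> sets \<mu>"
  shows "f \<in> measurable \<mu> \<mu>"
proof -
  have "f \<in> measurable \<mu> (PiM UNIV (\<lambda>_. uniform_count_measure (carrier G)))"
  proof (rule measurable_PiM_single)
    show "f \<in> space \<mu> \<rightarrow> (\<Pi>\<^sub>E i\<in>UNIV. space (uniform_count_measure (carrier G)))"
      using assms(1) by (auto simp: space_config space_uniform_count_measure)
    fix A :: "nat set" and i :: int assume "A \<in> sets (uniform_count_measure (carrier G))"
    then have "finite A" using finite_G finite_subset by (auto simp: sets_uniform_count_measure)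
    moreover have "{x \<in> space \<mu>. f x i \<in> A} = (\<Union>g\<in>A. {x \<in> C. f x i = g})"
      by (auto simp: space_config)
    ultimately show "{x \<in> space \<mu>. f x i \<in> A} \<in> sets \<mu>"
      using assms(2) by (auto intro!: sets.finite_UN)
  qed
  then show ?thesis by (simp add: config_measure_def)
qed

lemma measurable_translate:
  assumes a: "a \<in> C"
  shows "(\<lambda>x. x \<otimes>\<^bsub>X\<^esub> a) \<in> measurable \<mu> \<mu>"
proof (rule measurable_configI)
  fix i g
  have eq: "{x \<in> C. (x \<otimes>\<^bsub>X\<^esub> a) i = g} = {x \<in> C. x i \<in> {h. h \<otimes>\<^bsub>G\<^esub> a i = g}}" by simp
  show "{x \<in> C. (x \<otimes>\<^bsub>X\<^esub> a) i = g} \<in> sets \<mu>" unfolding eq by (rule measurable_nth)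
qed (use a in simp)

lemma measure_product:
  assumes "finite J" "\<And>j. j \<in> J \<Longrightarrow> E j \<subseteq> carrier G"
  shows "measure \<mu> {x \<in> C. \<forall>j\<in>J. x j \<in> E j} = (\<Prod>j\<in>J. real (card (E j)) / real n)"
proof -
  have "{x \<in> C. \<forall>j\<in>J. x j \<in> E j}
      = prod_emb UNIV (\<lambda>_. uniform_count_measure (carrier G)) J (Pi\<^sub>E J E)"
    by (auto simp: prod_emb_def space_uniform_count_measure config_group_def)
  then have "measure \<mu> {x \<in> C. \<forall>j\<in>J. x j \<in> E j}
      = (\<Prod>j\<in>J. measure (uniform_count_measure (carrier G)) (E j))"
    using assms unfolding config_measure_def
    by (simp add: coords.measure_PiM_emb sets_uniform_count_measure)
  also have "\<dots> = (\<Prod>j\<in>J. real (card (E j)) / real n)"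
    using assms finite_G by (intro prod.cong) (auto simp: measure_uniform_count_measure)
  finally show ?thesis .
qed

text \<open>\<open>\<mu>\<close> is the Haar measure of the compact group of configurations: at each
  site a translation permutes \<open>G\<close>, so it preserves the size of every side of a
  rectangle.\<close>

lemma translate_invariant:
  assumes a: "a \<in> C" and A: "A \<in> sets \<mu>"
  shows "measure \<mu> {x \<in> C. x \<otimes>\<^bsub>X\<^esub> a \<in> A} = measure \<mu> A"
proof -
  have "distr \<mu> \<mu> (\<lambda>x. x \<otimes>\<^bsub>X\<^esub> a) = \<mu>"
  proof (rule distr_eq_config[OF measurable_translate[OF a]])
    fix J :: "int set" and E :: "int \<Rightarrow> nat set"
    assume J: "finite J" and E: "\<And>j. j \<in> J \<Longrightarrow> E j \<subseteq> carrier G"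
    define E' where "E' = (\<lambda>j. {g \<in> carrier G. g \<otimes>\<^bsub>G\<^esub> a j \<in> E j})"
    have "card (E' j) = card (E j)" if "j \<in> J" for j
    proof (rule bij_betw_same_card[of "\<lambda>g. g \<otimes>\<^bsub>G\<^esub> a j"], rule bij_betwI)
      show "(\<lambda>g. g \<otimes>\<^bsub>G\<^esub> a j) \<in> E' j \<rightarrow> E j" by (auto simp: E'_def)
      show "(\<lambda>g. g \<otimes>\<^bsub>G\<^esub> inv\<^bsub>G\<^esub> a j) \<in> E j \<rightarrow> E' j"
        using E[OF that] a by (auto simp: E'_def G.m_assoc subset_iff)
    qed (use E[OF that] a in \<open>auto simp: E'_def G.m_assoc subset_iff\<close>)
    then have "measure \<mu> {x \<in> C. \<forall>j\<in>J. x j \<in> E' j} = measure \<mu> {x \<in> C. \<forall>j\<in>J. x j \<in> E j}"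
      using J E by (subst (1 2) measure_product) (auto simp: E'_def)
    moreover have "{x \<in> C. \<forall>j\<in>J. (x \<otimes>\<^bsub>X\<^esub> a) j \<in> E j} = {x \<in> C. \<forall>j\<in>J. x j \<in> E' j}"
      by (auto simp: E'_def)
    ultimately show "measure \<mu> {x \<in> C. \<forall>j\<in>J. (x \<otimes>\<^bsub>X\<^esub> a) j \<in> E j}
        = measure \<mu> {x \<in> C. \<forall>j\<in>J. x j \<in> E j}" by simp
  qed
  then have "measure \<mu> A = measure (distr \<mu> \<mu> (\<lambda>x. x \<otimes>\<^bsub>X\<^esub> a)) A" by simp
  also have "\<dots> = measure \<mu> {x \<in> C. x \<otimes>\<^bsub>X\<^esub> a \<in> A}"
    by (subst measure_distr[OF measurable_translate[OF a] A])
      (auto simp: space_config intro!: arg_cong[of _ _ "measure \<mu>"])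
  finally show ?thesis by simp
qed

text \<open>The fibres of \<open>\<psi>\<close> are translates of each other.\<close>

lemma uniform_fibres:
  assumes fin: "finite (\<psi> ` C)" and meas: "\<And>k. {x \<in> C. \<psi> x = k} \<in> sets \<mu>"
    and fib: "\<And>x a. x \<in> C \<Longrightarrow> a \<in> C \<Longrightarrow> \<psi> x = \<psi> a \<longleftrightarrow> \<psi> (x \<otimes>\<^bsub>X\<^esub> inv\<^bsub>X\<^esub> a) = \<psi> e"
  shows "measure \<mu> {x \<in> C. \<psi> x \<in> S} = card (S \<inter> \<psi> ` C) / card (\<psi> ` C)"
proof -
  let ?m = "measure \<mu> {x \<in> C. \<psi> x = \<psi> e}"
  have fibre: "measure \<mu> {x \<in> C. \<psi> x = k} = ?m" if k: "k \<in> \<psi> ` C" for k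
  proof -
    obtain a where a: "a \<in> C" "k = \<psi> a" using k by blast
    then have "{x \<in> C. \<psi> x = k} = {x \<in> C. x \<otimes>\<^bsub>X\<^esub> inv\<^bsub>X\<^esub> a \<in> {x \<in> C. \<psi> x = \<psi> e}}"
      using fib[OF _ a(1)] by auto
    then show ?thesis
      using translate_invariant[of "inv\<^bsub>X\<^esub> a" "{x \<in> C. \<psi> x = \<psi> e}"] meas a by simp
  qed
  have total: "measure \<mu> {x \<in> C. \<psi> x \<in> S} = card (S \<inter> \<psi> ` C) * ?m" for S
  proof -
    have "{x \<in> C. \<psi> x \<in> S} = (\<Union>k\<in>S \<inter> \<psi> ` C. {x \<in> C. \<psi> x = k})" by auto
    also have "measure \<mu> \<dots> = (\<Sum>k\<in>S \<inter> \<psi> ` C. measure \<mu> {x \<in> C. \<psi> x = k})"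
      using fin meas by (intro finite_measure_finite_Union) (auto simp: disjoint_family_on_def)
    also have "\<dots> = (\<Sum>k\<in>S \<inter> \<psi> ` C. ?m)" by (rule sum.cong[OF refl]) (rule fibre, erule IntD2)
    finally show ?thesis by simp
  qed
  have "1 = card (\<psi> ` C) * ?m"
    using total[of UNIV] prob_space by (simp add: space_config)
  moreover have "m = 1 / c" if "1 = c * m" for c m :: real
    using that by (cases "c = 0") (simp_all add: eq_divide_eq mult.commute)
  ultimately have "?m = 1 / card (\<psi> ` C)" by blast
  then show ?thesis unfolding total[of S] by simp
qed

section \<open>Distributions of homomorphisms read on a window\<close>

lemma restrict_eq_iff: "restrict x W = restrict y W \<longleftrightarrow> (\<forall>i\<in>W. x i = y i)"
  by (auto simp: fun_eq_iff restrict_def)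

lemma restrict_carrier: "(\<lambda>x. restrict x W) ` C = W \<rightarrow>\<^sub>E carrier G"
proof (intro equalityI subsetI)
  fix p assume p: "p \<in> W \<rightarrow>\<^sub>E carrier G"
  then have "p = restrict (cut W p) W"
    by (auto simp: fun_eq_iff cut_def PiE_def extensional_def)
  then show "p \<in> (\<lambda>x. restrict x W) ` C" using p by (intro image_eqI) auto
qed auto

text \<open>Supplies the fibre hypothesis of \<open>uniform_fibres\<close> for maps that read
  \<open>f x\<close> on a window. Restricted functions carry no group structure here, so the
  statement speaks of values at sites.\<close>

lemma hom_fibres:
  assumes "f \<in> hom X X" "x \<in> C" "a \<in> C"
  shows "(\<forall>i\<in>W. f x i = f a i) \<longleftrightarrow> (\<forall>i\<in>W. f (x \<otimes>\<^bsub>X\<^esub> inv\<^bsub>X\<^esub> a) i = f e i)"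
proof -
  interpret f: group_hom X X f
    using assms(1) by (simp add: group_hom_def group_hom_axioms_def)
  have "f (x \<otimes>\<^bsub>X\<^esub> inv\<^bsub>X\<^esub> a) i = f x i \<otimes>\<^bsub>G\<^esub> inv\<^bsub>G\<^esub> (f a i)" for i
    using assms by simp
  moreover have "f x i \<in> carrier G" "f a i \<in> carrier G" for i
    using assms f.hom_closed by simp_all
  ultimately show ?thesis
    by (auto simp: G.r_inv) (metis G.inv_equality G.inv_inv G.inv_closed)
qed

lemma measure_window:
  assumes W: "finite W"
  shows "measure \<mu> {x \<in> C. restrict x W \<in> P}
    = card (P \<inter> (W \<rightarrow>\<^sub>E carrier G)) / card (W \<rightarrow>\<^sub>E carrier G)"
  unfolding restrict_carrier[symmetric]
proof (rule uniform_fibres)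
  show "finite ((\<lambda>x. restrict x W) ` C)"
    unfolding restrict_carrier using W finite_G by (intro finite_PiE) auto
  show "{x \<in> C. restrict x W = k} \<in> sets \<mu>" for k
    using measurable_window[OF W, of "{k}"] by simp
  show "restrict x W = restrict a W \<longleftrightarrow> restrict (x \<otimes>\<^bsub>X\<^esub> inv\<^bsub>X\<^esub> a) W = restrict e W"
    if "x \<in> C" "a \<in> C" for x a
    unfolding restrict_eq_iff using hom_fibres[of "\<lambda>x. x" x a W] that by (simp add: hom_def)
qed

text \<open>By \<open>onto\<close> the pair of words read from \<open>x\<close> and from
  \<open>f x\<close> takes every value in \<open>?K \<times> ?K\<close>, and all values are equally
  likely; so the two words are independent.\<close>

lemma measure_joint_window:
  assumes W: "finite W" and f: "f \<in> hom X X" "f \<in> measurable \<mu> \<mu>"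
    and onto: "\<And>a b. a \<in> C \<Longrightarrow> b \<in> C \<Longrightarrow> \<exists>x\<in>C. \<forall>i\<in>W. x i = a i \<and> f x i = b i"
  shows "measure \<mu> {x \<in> C. restrict x W \<in> P \<and> restrict (f x) W \<in> Q}
    = measure \<mu> {x \<in> C. restrict x W \<in> P} * measure \<mu> {x \<in> C. restrict x W \<in> Q}"
proof -
  let ?K = "W \<rightarrow>\<^sub>E carrier G"
  let ?\<psi> = "\<lambda>x. (restrict x W, restrict (f x) W)"
  have f_C: "f x \<in> C" if "x \<in> C" for x using f(1) that by (auto simp: hom_def)
  have im: "?\<psi> ` C = ?K \<times> ?K"
  proof (rule equalityI[OF image_subsetI subsetI])
    fix x assume "x \<in> C"
    then show "?\<psi> x \<in> ?K \<times> ?K"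
      unfolding restrict_carrier[symmetric] by (intro SigmaI imageI f_C)
  next
    fix k assume "k \<in> ?K \<times> ?K"
    then obtain a b where ab: "a \<in> C" "b \<in> C" "k = (restrict a W, restrict b W)"
      unfolding restrict_carrier[symmetric] by auto
    obtain x where "x \<in> C" "\<forall>i\<in>W. x i = a i \<and> f x i = b i" using onto[OF ab(1,2)] by blast
    then show "k \<in> ?\<psi> ` C" unfolding ab(3) by (intro image_eqI[of _ _ x]) (auto simp: restrict_eq_iff)
  qed
  have finK: "finite ?K" using W finite_G by (intro finite_PiE) auto
  have meas: "{x \<in> C. restrict x W \<in> P \<and> restrict (f x) W \<in> Q} \<in> sets \<mu>" for P Q
  proof -
    have "f -` {x \<in> C. restrict x W \<in> Q} \<inter> space \<mu> \<in> sets \<mu>"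
      by (rule measurable_sets[OF f(2) measurable_window[OF W]])
    moreover have "{x \<in> C. restrict x W \<in> P \<and> restrict (f x) W \<in> Q}
        = {x \<in> C. restrict x W \<in> P} \<inter> (f -` {x \<in> C. restrict x W \<in> Q} \<inter> space \<mu>)"
      using f_C by (auto simp: space_config)
    ultimately show ?thesis using measurable_window[OF W] by auto
  qed
  have "measure \<mu> {x \<in> C. ?\<psi> x \<in> P \<times> Q} = card ((P \<times> Q) \<inter> ?\<psi> ` C) / card (?\<psi> ` C)"
  proof (rule uniform_fibres)
    show "finite (?\<psi> ` C)" using finK by (simp add: im)
    show "{x \<in> C. ?\<psi> x = k} \<in> sets \<mu>" for k
      using meas[of "{fst k}" "{snd k}"] by (auto simp: prod_eq_iff)
    show "?\<psi> x = ?\<psi> a \<longleftrightarrow> ?\<psi> (x \<otimes>\<^bsub>X\<^esub> inv\<^bsub>X\<^esub> a) = ?\<psi> e" if "x \<in> C" "a \<in> C" for x a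
      unfolding prod.inject restrict_eq_iff
      using hom_fibres[of "\<lambda>x. x" x a W] hom_fibres[OF f(1), of x a W] that by (simp add: hom_def)
  qed
  also have "(P \<times> Q) \<inter> ?\<psi> ` C = (P \<inter> ?K) \<times> (Q \<inter> ?K)" unfolding im by auto
  also have "real (card ((P \<inter> ?K) \<times> (Q \<inter> ?K))) / real (card (?\<psi> ` C))
      = (card (P \<inter> ?K) / card ?K) * (card (Q \<inter> ?K) / card ?K)"
    unfolding im by (simp add: card_cartesian_product)
  finally show ?thesis
    unfolding measure_window[OF W] mem_Times_iff fst_conv snd_conv .
qed

end

section \<open>Automata without finite factors\<close>

context additive_automaton
begin

lemma Fpow_hom: "F ^^ h \<in> hom X X"
proof (induction h)
  case 0
  then show ?case by (simp add: hom_def)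
next
  case (Suc h)
  from Suc show ?case using F_hom by (simp add: hom_def Pi_iff)
qed

sublocale Fpow: group_hom X X "F ^^ h" for h
  by (simp add: group_hom_def group_hom_axioms_def Fpow_hom)

lemma Fpow_local:
  assumes "finite W"
  shows "\<exists>W'. finite W' \<and> (\<forall>x y. (\<forall>i\<in>W'. x i = y i) \<longrightarrow> (\<forall>i\<in>W. (F ^^ h) x i = (F ^^ h) y i))"
  using assms
proof (induction h arbitrary: W)
  case 0
  then show ?case by (intro exI[of _ W]) simp
next
  case (Suc h)
  let ?V = "\<Union>i\<in>W. {i - int r..i + int r}"
  have "finite ?V" using Suc.prems by blast
  from Suc.IH[OF this] obtain W' where W': "finite W'"
      "\<forall>x y. (\<forall>i\<in>W'. x i = y i) \<longrightarrow> (\<forall>i\<in>?V. (F ^^ h) x i = (F ^^ h) y i)"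
    by (elim exE conjE)
  have "(F ^^ Suc h) x i = (F ^^ Suc h) y i" if "\<forall>i\<in>W'. x i = y i" "i \<in> W" for x y i
  proof -
    have "F ((F ^^ h) x) i = F ((F ^^ h) y) i"
    proof (rule F_cong)
      fix j assume "\<bar>j - i\<bar> \<le> int r"
      then have "j \<in> ?V" using that(2) by (intro UN_I[of i]) auto
      then show "(F ^^ h) x j = (F ^^ h) y j" by (rule W'(2)[THEN spec, THEN spec, THEN mp, THEN bspec, OF that(1)])
    qed
    then show ?thesis by simp
  qed
  then show ?case by (intro exI[of _ W'] conjI W'(1) allI impI ballI)
qed

lemma Fpow_localE:
  assumes "finite W"
  obtains W' where "finite W'"
    "\<And>x y i. (\<And>j. j \<in> W' \<Longrightarrow> x j = y j) \<Longrightarrow> i \<in> W \<Longrightarrow> (F ^^ h) x i = (F ^^ h) y i"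
proof -
  obtain W' where W': "finite W'"
      "\<forall>x y. (\<forall>i\<in>W'. x i = y i) \<longrightarrow> (\<forall>i\<in>W. (F ^^ h) x i = (F ^^ h) y i)"
    using Fpow_local[OF assms, of h] by (elim exE conjE)
  show ?thesis
    by (rule that[OF W'(1)], rule W'(2)[rule_format]) blast+
qed

definition factor_free :: bool where
  "factor_free \<longleftrightarrow> (\<forall>U. \<not> proper_factor U)"

text \<open>The configurations that agree on \<open>W\<close> with some value of \<open>F\<close>
  form an open subgroup. It contains the image of \<open>F\<close>, hence is invariant, and without
  factors it must be everything.\<close>

lemma factor_free_locally_onto:
  assumes free: "factor_free" and "finite W" "y \<in> C"
  shows "\<exists>x\<in>C. \<forall>i\<in>W. (F ^^ h) x i = y i"
  using assms(2,3)
proof (induction h arbitrary: W y)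
  case 0
  then show ?case by auto
next
  case (Suc h)
  define U where "U = {x \<in> C. \<exists>z\<in>C. \<forall>i\<in>W. x i = F z i}"
  have U: "subgroup U X"
  proof (rule X.subgroupI)
    show "U \<subseteq> C" by (auto simp: U_def)
    have "e \<in> U" unfolding U_def using F.hom_one by (intro CollectI conjI bexI[of _ e]) auto
    then show "U \<noteq> {}" by blast
  next
    fix a assume "a \<in> U"
    then obtain z where "a \<in> C" "z \<in> C" "\<forall>i\<in>W. a i = F z i" by (auto simp: U_def)
    then show "inv\<^bsub>X\<^esub> a \<in> U"
      unfolding U_def by (intro CollectI conjI bexI[of _ "inv\<^bsub>X\<^esub> z"]) (simp_all add: F.hom_inv)
  next
    fix a b assume "a \<in> U" "b \<in> U"
    then obtain z t where "a \<in> C" "z \<in> C" "\<forall>i\<in>W. a i = F z i" "b \<in> C" "t \<in> C" "\<forall>i\<in>W. b i = F t i"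
      unfolding U_def by blast
    then show "a \<otimes>\<^bsub>X\<^esub> b \<in> U"
      unfolding U_def by (intro CollectI conjI bexI[of _ "z \<otimes>\<^bsub>X\<^esub> t"]) simp_all
  qed
  have "F x \<in> U" if "x \<in> U" for x using that F.hom_closed unfolding U_def by blast
  moreover have "determined U W"
    unfolding determined_def U_def
    by (intro ballI impI CollectI conjI bexI[of _ e]) (simp_all add: F.hom_one)
  ultimately have "U = C"
    using free U Suc.prems(1) unfolding factor_free_def proper_factor_def by blast
  then obtain z where z: "z \<in> C" "\<forall>i\<in>W. y i = F z i" using Suc.prems(2) by (auto simp: U_def)
  obtain W' where W': "finite W'"
      "\<And>x y i. (\<And>j. j \<in> W' \<Longrightarrow> x j = y j) \<Longrightarrow> i \<in> W \<Longrightarrow> (F ^^ 1) x i = (F ^^ 1) y i"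
    using Fpow_localE[OF Suc.prems(1)] by blast
  obtain x where x: "x \<in> C" "\<forall>i\<in>W'. (F ^^ h) x i = z i" using Suc.IH[OF W'(1) z(1)] by blast
  have "(F ^^ Suc h) x i = y i" if "i \<in> W" for i
    using W'(2)[of "(F ^^ h) x" z, OF _ that] x(2) z(2) that by simp
  then show ?case using x(1) by blast
qed

text \<open>If the joint image of \<open>x\<close> and \<open>(F ^^ h) x\<close> on \<open>W\<close> is the same proper subgroup for \<open>h1 < h2\<close>,
  then \<open>y \<mapsto> (F ^^ (h2 - h1)) y / y\<close> takes its values in a proper open subgroup \<open>U\<close>, and the
  elements whose first \<open>h2 - h1\<close> iterates lie in \<open>U\<close> form an invariant subgroup.\<close>

lemma factor_free_jointly_onto:
  assumes free: "factor_free" and W: "finite W"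
  shows "eventually (\<lambda>h. \<forall>a\<in>C. \<forall>b\<in>C. \<exists>x\<in>C. \<forall>i\<in>W. x i = a i \<and> (F ^^ h) x i = b i) sequentially"
proof (rule ccontr)
  define P where "P h \<longleftrightarrow> (\<forall>a\<in>C. \<forall>b\<in>C. \<exists>x\<in>C. \<forall>i\<in>W. x i = a i \<and> (F ^^ h) x i = b i)" for h
  assume "\<not> ?thesis"
  then have "\<not> eventually P sequentially" unfolding P_def[abs_def] .
  then have inf: "infinite {h. \<not> P h}"
    by (simp add: cofinite_eq_sequentially[symmetric] eventually_cofinite)
  let ?K = "W \<rightarrow>\<^sub>E carrier G"
  \<comment> \<open>There are finitely many subsets of \<open>?K \<times> ?K\<close>, so infinitely
    many failures repeat a joint image.\<close>
  define I where "I h = (\<lambda>x. (restrict x W, restrict ((F ^^ h) x) W)) ` C" for h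
  have "I h \<subseteq> ?K \<times> ?K" for h
    unfolding I_def restrict_carrier[symmetric] using Fpow.hom_closed by blast
  then have "I ` {h. \<not> P h} \<subseteq> Pow (?K \<times> ?K)" by blast
  moreover have "finite (Pow (?K \<times> ?K))"
    using W finite_G by (intro finite_Pow_iff[THEN iffD2] finite_cartesian_product finite_PiE) auto
  ultimately have "finite (I ` {h. \<not> P h})" by (rule finite_subset)
  from pigeonhole_infinite[OF inf this] obtain h1
    where h1: "\<not> P h1" "infinite {h \<in> {h. \<not> P h}. I h = I h1}" by blast
  then obtain h2 where h2: "h1 < h2" "I h2 = I h1"
    unfolding infinite_nat_iff_unbounded by blast
  define k where "k = h2 - h1"
  have k: "k > 0" "h2 = k + h1" using h2(1) by (auto simp: k_def)
  \<comment> \<open>The fibre of the joint image over the trivial word, as a set of configurations.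
    Were it everything, any second word could be reached from a given first one by a correction that
    is trivial on \<open>W\<close>; so failure at \<open>h1\<close> makes \<open>U\<close>
    proper.\<close>
  define U where "U = {y \<in> C. \<exists>x\<in>C. \<forall>i\<in>W. x i = \<one>\<^bsub>G\<^esub> \<and> (F ^^ h1) x i = y i}"
  have U: "subgroup U X"
  proof (rule X.subgroupI)
    show "U \<subseteq> C" by (auto simp: U_def)
    have "e \<in> U" unfolding U_def by (intro CollectI conjI bexI[of _ e]) simp_all
    then show "U \<noteq> {}" by blast
  next
    fix a assume "a \<in> U"
    then obtain z where "a \<in> C" "z \<in> C" "\<forall>i\<in>W. z i = \<one>\<^bsub>G\<^esub> \<and> (F ^^ h1) z i = a i"
      by (auto simp: U_def)
    then show "inv\<^bsub>X\<^esub> a \<in> U"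
      unfolding U_def by (intro CollectI conjI bexI[of _ "inv\<^bsub>X\<^esub> z"]) simp_all
  next
    fix a b assume "a \<in> U" "b \<in> U"
    then obtain z t where "a \<in> C" "z \<in> C" "\<forall>i\<in>W. z i = \<one>\<^bsub>G\<^esub> \<and> (F ^^ h1) z i = a i"
        "b \<in> C" "t \<in> C" "\<forall>i\<in>W. t i = \<one>\<^bsub>G\<^esub> \<and> (F ^^ h1) t i = b i"
      unfolding U_def by blast
    then show "a \<otimes>\<^bsub>X\<^esub> b \<in> U"
      unfolding U_def by (intro CollectI conjI bexI[of _ "z \<otimes>\<^bsub>X\<^esub> t"]) simp_all
  qed
  have detU: "determined U W"
    unfolding determined_def U_def
    by (intro ballI impI CollectI conjI bexI[of _ e]) simp_all
  have "U \<noteq> C"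
  proof
    assume "U = C"
    have "\<exists>x\<in>C. \<forall>i\<in>W. x i = a i \<and> (F ^^ h1) x i = b i" if ab: "a \<in> C" "b \<in> C" for a b
    proof -
      let ?y = "b \<otimes>\<^bsub>X\<^esub> inv\<^bsub>X\<^esub> ((F ^^ h1) a)"
      have "?y \<in> U" using \<open>U = C\<close> ab by simp
      then obtain x where x: "x \<in> C" "\<And>i. i \<in> W \<Longrightarrow> x i = \<one>\<^bsub>G\<^esub>"
          "\<And>i. i \<in> W \<Longrightarrow> (F ^^ h1) x i = ?y i"
        by (auto simp: U_def)
      have "(F ^^ h1) (x \<otimes>\<^bsub>X\<^esub> a) i = b i" if "i \<in> W" for i
        using x(1) x(3)[OF that] ab by (simp add: G.m_assoc)
      moreover have "(x \<otimes>\<^bsub>X\<^esub> a) i = a i" if "i \<in> W" for i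
        using x(2)[OF that] ab by simp
      ultimately show ?thesis using x(1) ab(1) by (intro bexI[of _ "x \<otimes>\<^bsub>X\<^esub> a"]) simp_all
    qed
    with h1(1) show False unfolding P_def by blast
  qed
  \<comment> \<open>On windows, \<open>x0\<close> shows \<open>y\<close> at time \<open>h1\<close>,
    and on \<open>W\<close> it then shows \<open>(F ^^ k) y\<close> at time \<open>h2\<close>.
    Equality of the joint images yields \<open>x1\<close> that agrees with \<open>x0\<close> on
    \<open>W\<close> and shows \<open>(F ^^ k) y\<close> there already at time \<open>h1\<close>;
    the quotient of \<open>x1\<close> by \<open>x0\<close> is the witness.\<close>
  have step: "(F ^^ k) y \<otimes>\<^bsub>X\<^esub> inv\<^bsub>X\<^esub> y \<in> U" if y: "y \<in> C" for y
  proof -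
    obtain W' where W': "finite W'"
        "\<And>x y i. (\<And>j. j \<in> W' \<Longrightarrow> x j = y j) \<Longrightarrow> i \<in> W \<Longrightarrow> (F ^^ k) x i = (F ^^ k) y i"
      using Fpow_localE[OF W] by blast
    obtain x0 where x0: "x0 \<in> C" "\<And>i. i \<in> W \<union> W' \<Longrightarrow> (F ^^ h1) x0 i = y i"
      using factor_free_locally_onto[OF free finite_UnI[OF W W'(1)] y] by blast
    have x0_k: "(F ^^ h2) x0 i = (F ^^ k) y i" if "i \<in> W" for i
      unfolding k(2) funpow_add o_apply using x0(2) that by (intro W'(2)) auto
    have "(restrict x0 W, restrict ((F ^^ h2) x0) W) \<in> I h2"
      unfolding I_def by (rule image_eqI[OF refl x0(1)])
    then have "(restrict x0 W, restrict ((F ^^ h2) x0) W) \<in> I h1" by (simp only: h2(2))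
    then obtain x1 where "x1 \<in> C"
        "(restrict x0 W, restrict ((F ^^ h2) x0) W) = (restrict x1 W, restrict ((F ^^ h1) x1) W)"
      unfolding I_def by (elim imageE)
    then have x1: "x1 \<in> C" "restrict x0 W = restrict x1 W"
        "restrict ((F ^^ h2) x0) W = restrict ((F ^^ h1) x1) W"
      by (simp_all only: prod.inject)
    have "(x1 \<otimes>\<^bsub>X\<^esub> inv\<^bsub>X\<^esub> x0) i = \<one>\<^bsub>G\<^esub>" if "i \<in> W" for i
      using x1(1,2) x0(1) that by (simp add: restrict_eq_iff)
    moreover have "(F ^^ h1) (x1 \<otimes>\<^bsub>X\<^esub> inv\<^bsub>X\<^esub> x0) i = ((F ^^ k) y \<otimes>\<^bsub>X\<^esub> inv\<^bsub>X\<^esub> y) i" if "i \<in> W" for i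
    proof -
      have "(F ^^ h1) x1 i = (F ^^ k) y i" "(F ^^ h1) x0 i = y i"
        using x1(3) x0_k[OF that] x0(2) that by (simp_all add: restrict_eq_iff)
      then show ?thesis using x1(1) x0(1) y by simp
    qed
    ultimately show ?thesis
      unfolding U_def using x1(1) x0(1) y
      by (intro CollectI conjI bexI[of _ "x1 \<otimes>\<^bsub>X\<^esub> inv\<^bsub>X\<^esub> x0"]) simp_all
  qed
  \<comment> \<open>With \<open>k\<close> consecutive iterates in \<open>U\<close>, the only new one
    for \<open>F y\<close> is \<open>(F ^^ k) y\<close>, the product of
    \<open>(F ^^ k) y / y\<close> and \<open>y\<close>, both in \<open>U\<close>.\<close>
  define V where "V = {y \<in> C. \<forall>j<k. (F ^^ j) y \<in> U}"
  have "subgroup V X"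
  proof (rule X.subgroupI)
    show "V \<subseteq> C" by (auto simp: V_def)
    have "e \<in> V" unfolding V_def using subgroup.one_closed[OF U] by simp
    then show "V \<noteq> {}" by blast
  next
    fix a assume "a \<in> V"
    then show "inv\<^bsub>X\<^esub> a \<in> V" unfolding V_def using subgroup.m_inv_closed[OF U] by simp
  next
    fix a b assume "a \<in> V" "b \<in> V"
    then show "a \<otimes>\<^bsub>X\<^esub> b \<in> V" unfolding V_def using subgroup.m_closed[OF U] by simp
  qed
  moreover have "V \<noteq> C"
  proof -
    have "V \<subseteq> U" unfolding V_def using k(1) by (auto dest!: spec[of _ 0])
    then show ?thesis using \<open>U \<noteq> C\<close> subgroup.subset[OF U] by blast
  qed
  moreover have "F ` V \<subseteq> V"
  proof (intro image_subsetI)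
    fix y assume "y \<in> V"
    then have y: "y \<in> C" "\<And>j. j < k \<Longrightarrow> (F ^^ j) y \<in> U" by (auto simp: V_def)
    have "(F ^^ j) (F y) \<in> U" if "j < k" for j
    proof -
      have eq: "(F ^^ j) (F y) = (F ^^ Suc j) y" by (simp add: funpow_swap1)
      show ?thesis
      proof (cases "Suc j < k")
        case True
        then show ?thesis using y(2)[of "Suc j"] eq by simp
      next
        case False
        with that have "Suc j = k" by simp
        have "((F ^^ k) y \<otimes>\<^bsub>X\<^esub> inv\<^bsub>X\<^esub> y) \<otimes>\<^bsub>X\<^esub> y \<in> U"
          using step[OF y(1)] y(2)[of 0] k(1) subgroup.m_closed[OF U] by simp
        then show ?thesis using y(1) eq \<open>Suc j = k\<close> by (simp add: X.m_assoc del: funpow.simps)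
      qed
    qed
    then show "F y \<in> V" using y(1) by (simp add: V_def)
  qed
  moreover have "\<exists>W'. finite W' \<and> determined V W'"
  proof -
    have "\<exists>W'. finite W' \<and> (\<forall>x\<in>C. (\<forall>i\<in>W'. x i = \<one>\<^bsub>G\<^esub>) \<longrightarrow> (F ^^ j) x \<in> U)" for j
    proof -
      obtain W' where W': "finite W'"
          "\<And>x y i. (\<And>l. l \<in> W' \<Longrightarrow> x l = y l) \<Longrightarrow> i \<in> W \<Longrightarrow> (F ^^ j) x i = (F ^^ j) y i"
        using Fpow_localE[OF W] by blast
      have "(F ^^ j) x \<in> U" if x: "x \<in> C" "\<forall>i\<in>W'. x i = \<one>\<^bsub>G\<^esub>" for x
      proof (rule determinedD[OF detU])
        fix i assume "i \<in> W"
        then have "(F ^^ j) x i = (F ^^ j) e i" using x(2) by (intro W'(2)) simp_all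
        then show "(F ^^ j) x i = \<one>\<^bsub>G\<^esub>" by simp
      qed (use x in simp)
      then show ?thesis using W'(1) by blast
    qed
    then obtain N where N: "\<And>j. finite (N j)"
        "\<And>j x. x \<in> C \<Longrightarrow> \<forall>i\<in>N j. x i = \<one>\<^bsub>G\<^esub> \<Longrightarrow> (F ^^ j) x \<in> U" by metis
    have "determined V (\<Union>j<k. N j)"
      unfolding determined_def V_def
    proof (intro ballI impI CollectI conjI allI)
      fix x j assume "x \<in> C" "\<forall>i\<in>\<Union>j<k. N j. x i = \<one>\<^bsub>G\<^esub>" "j < k"
      then show "(F ^^ j) x \<in> U" by (intro N(2)) auto
    qed
    then show ?thesis using N(1) by blast
  qed
  ultimately show False
    using free unfolding factor_free_def proper_factor_def by blast
qed

section \<open>Measurability and invariance of the measure\<close>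

lemma F_measurable: "F \<in> measurable \<mu> \<mu>"
proof (rule measurable_configI)
  fix i g
  let ?W = "{i - int r..i + int r}"
  have "F x i = F (cut ?W (restrict x ?W)) i" for x
    by (rule F_cong) (auto simp: cut_def)
  then have eq: "{x \<in> C. F x i = g} = {x \<in> C. restrict x ?W \<in> {p. F (cut ?W p) i = g}}"
    by simp
  show "{x \<in> C. F x i = g} \<in> sets \<mu>"
    unfolding eq by (rule measurable_window) simp
qed (rule F.hom_closed)

lemma Fpow_measurable: "F ^^ h \<in> measurable \<mu> \<mu>"
  by (rule measurable_compose_n[OF F_measurable])

text \<open>Reading \<open>F x\<close> on a window gives every word by local surjectivity, and the
  fibres have equal measure, so the image of \<open>\<mu>\<close> is uniform on each window.\<close>

lemma distr_F:
  assumes "factor_free"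
  shows "distr \<mu> \<mu> F = \<mu>"
proof (rule distr_eq_config[OF F_measurable])
  fix J :: "int set" and E :: "int \<Rightarrow> nat set"
  assume J: "finite J" and E: "\<And>j. j \<in> J \<Longrightarrow> E j \<subseteq> carrier G"
  let ?K = "J \<rightarrow>\<^sub>E carrier G"
  let ?\<psi> = "\<lambda>x. restrict (F x) J"
  have im: "?\<psi> ` C = ?K"
  proof (rule equalityI[OF image_subsetI subsetI])
    show "?\<psi> x \<in> ?K" if "x \<in> C" for x
      unfolding restrict_carrier[symmetric] by (intro imageI F.hom_closed that)
  next
    fix p assume "p \<in> ?K"
    then obtain y where y: "y \<in> C" "p = restrict y J"
      unfolding restrict_carrier[symmetric] by blast
    obtain x where "x \<in> C" "\<forall>i\<in>J. (F ^^ 1) x i = y i"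
      using factor_free_locally_onto[OF assms J y(1)] by blast
    then show "p \<in> ?\<psi> ` C" unfolding y(2) by (intro image_eqI[of _ _ x]) (auto simp: restrict_eq_iff)
  qed
  have meas: "{x \<in> C. ?\<psi> x \<in> P} \<in> sets \<mu>" for P
  proof -
    have "F -` {x \<in> C. restrict x J \<in> P} \<inter> space \<mu> \<in> sets \<mu>"
      by (rule measurable_sets[OF F_measurable measurable_window[OF J]])
    moreover have "F -` {x \<in> C. restrict x J \<in> P} \<inter> space \<mu> = {x \<in> C. ?\<psi> x \<in> P}"
      using F.hom_closed by (auto simp: space_config)
    ultimately show ?thesis by simp
  qed
  have "measure \<mu> {x \<in> C. ?\<psi> x \<in> P} = card (P \<inter> ?\<psi> ` C) / card (?\<psi> ` C)" for P
  proof (rule uniform_fibres)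
    show "finite (?\<psi> ` C)" unfolding im using J finite_G by (intro finite_PiE) auto
    show "{x \<in> C. ?\<psi> x = k} \<in> sets \<mu>" for k using meas[of "{k}"] by simp
    show "?\<psi> x = ?\<psi> a \<longleftrightarrow> ?\<psi> (x \<otimes>\<^bsub>X\<^esub> inv\<^bsub>X\<^esub> a) = ?\<psi> e" if "x \<in> C" "a \<in> C" for x a
      unfolding restrict_eq_iff by (rule hom_fibres[OF F_hom that])
  qed
  then have *: "measure \<mu> {x \<in> C. ?\<psi> x \<in> P} = measure \<mu> {x \<in> C. restrict x J \<in> P}" for P
    unfolding im measure_window[OF J] .
  have "restrict x J \<in> Pi\<^sub>E J E \<longleftrightarrow> (\<forall>j\<in>J. x j \<in> E j)" for x :: "int \<Rightarrow> nat"
    by (rule restrict_PiE_iff)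
  with *[of "Pi\<^sub>E J E"] show "measure \<mu> {x \<in> C. \<forall>j\<in>J. F x j \<in> E j} = measure \<mu> {x \<in> C. \<forall>j\<in>J. x j \<in> E j}"
    by simp
qed

lemma preserves_config:
  assumes "factor_free"
  shows "preserves_measure \<mu> F"
  unfolding preserves_measure_def
proof (intro conjI ballI F_measurable)
  fix A assume A: "A \<in> sets \<mu>"
  have "measure \<mu> (F -` A \<inter> space \<mu>) = measure (distr \<mu> \<mu> F) A"
    by (rule measure_distr[OF F_measurable A, symmetric])
  then show "measure \<mu> A = measure \<mu> (F -` A \<inter> space \<mu>)" by (simp add: distr_F[OF assms])
qed

end

section \<open>Mixing, ergodicity and transitivity\<close>

lemma cesaro_null:
  fixes a :: "nat \<Rightarrow> real"
  assumes "a \<longlonglongrightarrow> 0"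
  shows "(\<lambda>h. 1 / real h * (\<Sum>i<h. a i)) \<longlonglongrightarrow> 0"
proof (rule LIMSEQ_I)
  fix \<epsilon> :: real assume "\<epsilon> > 0"
  then obtain N where N: "\<And>i. i \<ge> N \<Longrightarrow> \<bar>a i\<bar> < \<epsilon> / 2"
    using LIMSEQ_D[OF assms, of "\<epsilon> / 2"] by auto
  define S where "S = (\<Sum>i<N. \<bar>a i\<bar>)"
  \<comment> \<open>From \<open>K\<close> on, the fixed contribution \<open>S\<close> of the first
    \<open>N\<close> terms uses less than half of the allowed error.\<close>
  obtain K :: nat where K: "2 * S / \<epsilon> < real K" using reals_Archimedean2 by blast
  have "norm (1 / real h * (\<Sum>i<h. a i) - 0) < \<epsilon>" if h: "h \<ge> N + K + 1" for h
  proof -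
    have "\<bar>\<Sum>i<h. a i\<bar> \<le> (\<Sum>i<h. \<bar>a i\<bar>)" by (rule sum_abs)
    also have "\<dots> = S + (\<Sum>i\<in>{N..<h}. \<bar>a i\<bar>)"
    proof -
      have eq: "{..<h} = {..<N} \<union> {N..<h}" using h by auto
      show ?thesis unfolding S_def by (subst eq, rule sum.union_disjoint) auto
    qed
    also have "(\<Sum>i\<in>{N..<h}. \<bar>a i\<bar>) \<le> (\<Sum>i\<in>{N..<h}. \<epsilon> / 2)"
      by (rule sum_mono, rule less_imp_le, rule N) simp
    also have "\<dots> \<le> h * (\<epsilon> / 2)"
      using \<open>\<epsilon> > 0\<close> by (simp add: divide_simps)
    finally have "\<bar>\<Sum>i<h. a i\<bar> \<le> S + h * (\<epsilon> / 2)" by simp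
    also have "S < h * (\<epsilon> / 2)"
    proof -
      have "S < K * (\<epsilon> / 2)" using K \<open>\<epsilon> > 0\<close> by (simp add: field_simps)
      also have "\<dots> \<le> h * (\<epsilon> / 2)" using h \<open>\<epsilon> > 0\<close> by (intro mult_right_mono) auto
      finally show ?thesis .
    qed
    finally have "\<bar>\<Sum>i<h. a i\<bar> < \<epsilon> * h" by simp
    then have "\<bar>\<Sum>i<h. a i\<bar> / h < \<epsilon>"
      using h by (subst pos_divide_less_eq) simp_all
    then show ?thesis by (simp add: abs_mult)
  qed
  then show "\<exists>no. \<forall>h\<ge>no. norm (1 / real h * (\<Sum>i<h. a i) - 0) < \<epsilon>" by blast
qed

lemma preserves_measure_funpow:
  assumes "preserves_measure M F" "A \<in> sets M"
  shows "measure M ((F ^^ h) -` A \<inter> space M) = measure M A"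
proof (induction h)
  case 0
  have "A \<inter> space M = A" using sets.sets_into_space[OF assms(2)] by blast
  then show ?case by simp
next
  case (Suc h)
  have F: "F \<in> measurable M M" using assms(1) by (simp add: preserves_measure_def)
  define B where "B = (F ^^ h) -` A \<inter> space M"
  have "B \<in> sets M"
    unfolding B_def by (rule measurable_sets[OF measurable_compose_n[OF F] assms(2)])
  then have "measure M (F -` B \<inter> space M) = measure M B"
    using assms(1) by (simp add: preserves_measure_def)
  moreover have "(F ^^ Suc h) -` A \<inter> space M = F -` B \<inter> space M"
    unfolding funpow_Suc_right B_def using measurable_space[OF F] by auto
  ultimately show ?case using Suc by (simp only: B_def)
qed

text \<open>Tannery's theorem exchanges the limit with the countable sum, the summable bound being
  \<open>prob (A k)\<close>. This is the union step of both Dynkin inductions below.\<close>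

lemma (in prob_space) tendsto_measure_UN:
  fixes A :: "nat \<Rightarrow> 'a set" and S :: "nat \<Rightarrow> nat \<Rightarrow> 'a set"
  assumes disj: "disjoint_family A" and A: "\<And>k. A k \<in> sets M"
    and S: "\<And>k h. S k h \<in> sets M" "\<And>h. disjoint_family (\<lambda>k. S k h)"
    and bound: "\<And>k h. prob (S k h) \<le> prob (A k)"
    and lim: "\<And>k. (\<lambda>h. prob (S k h)) \<longlonglongrightarrow> prob (A k) * c"
  shows "(\<lambda>h. prob (\<Union>k. S k h)) \<longlonglongrightarrow> prob (\<Union>k. A k) * c"
proof -
  have A_sums: "(\<lambda>k. prob (A k)) sums prob (\<Union>k. A k)"
    using A disj by (intro finite_measure_UNION) auto
  have S_sums: "(\<lambda>k. prob (S k h)) sums prob (\<Union>k. S k h)" for h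
    using S by (intro finite_measure_UNION) auto
  have "(\<lambda>h. suminf (\<lambda>k. prob (S k h))) \<longlonglongrightarrow> suminf (\<lambda>k. prob (A k) * c)"
    using tannerys_theorem[of "\<lambda>k h. prob (S k h)" "\<lambda>k. prob (A k) * c" sequentially "\<lambda>k. prob (A k)"]
      lim bound sums_summable[OF A_sums] by (simp add: always_eventually)
  moreover have "suminf (\<lambda>k. prob (A k) * c) = prob (\<Union>k. A k) * c"
    using sums_mult2[OF A_sums, of c] by (simp add: sums_iff)
  ultimately show ?thesis using S_sums by (simp add: sums_iff)
qed

text \<open>Mixing passes from a generating pi-system to all events by Dynkin induction in one
  argument at a time. The bound for the union step comes from measure preservation in the first
  argument and from monotonicity in the second.\<close>

lemma (in prob_space) ergodic_mixingI:
  assumes pres: "preserves_measure M F"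
    and E: "sets M = sigma_sets (space M) E" "Int_stable E" "E \<subseteq> Pow (space M)"
    and lim: "\<And>A B. A \<in> E \<Longrightarrow> B \<in> E \<Longrightarrow>
      (\<lambda>h. prob ((F ^^ h) -` A \<inter> space M \<inter> B)) \<longlonglongrightarrow> prob A * prob B"
  shows "ergodic_mixing M F"
proof -
  have F: "F \<in> measurable M M" using pres by (simp add: preserves_measure_def)
  have vim: "(F ^^ h) -` A \<inter> space M \<in> sets M" if "A \<in> sets M" for A h
    by (rule measurable_sets[OF measurable_compose_n[OF F] that])
  have F_space: "(F ^^ h) x \<in> space M" if "x \<in> space M" for x h
    using measurable_space[OF measurable_compose_n[OF F] that] .
  have lim1: "(\<lambda>h. prob ((F ^^ h) -` A \<inter> space M \<inter> B)) \<longlonglongrightarrow> prob A * prob B"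
    if A: "A \<in> sigma_sets (space M) E" and B: "B \<in> E" for A B
    using E(2,3) A
  proof (induction rule: sigma_sets_induct_disjoint)
    case (basic A)
    then show ?case using lim B by blast
  next
    case empty
    show ?case by simp
  next
    case (compl A)
    then have A: "A \<in> sets M" using E(1) by simp
    have B': "B \<in> sets M" using B E(1) by auto
    have "prob ((F ^^ h) -` (space M - A) \<inter> space M \<inter> B)
        = prob B - prob ((F ^^ h) -` A \<inter> space M \<inter> B)" for h
    proof -
      have "(F ^^ h) -` (space M - A) \<inter> space M \<inter> B = B - ((F ^^ h) -` A \<inter> space M \<inter> B)"
        using F_space sets.sets_into_space[OF B'] by auto
      then show ?thesis using vim[OF A] B' by (simp add: finite_measure_Diff)
    qed
    moreover have "prob (space M - A) * prob B = prob B - prob A * prob B"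
      unfolding prob_compl[OF A] by (simp add: algebra_simps)
    ultimately show ?case using tendsto_diff[OF tendsto_const compl(2)] by simp
  next
    case (union A)
    then have A: "A k \<in> sets M" for k using E(1) by auto
    have B': "B \<in> sets M" using B E(1) by auto
    have "(\<lambda>h. prob (\<Union>k. (F ^^ h) -` A k \<inter> space M \<inter> B)) \<longlonglongrightarrow> prob (\<Union>k. A k) * prob B"
    proof (rule tendsto_measure_UN[OF union(1) A])
      show "(F ^^ h) -` A k \<inter> space M \<inter> B \<in> sets M" for k h using vim[OF A] B' by blast
      show "disjoint_family (\<lambda>k. (F ^^ h) -` A k \<inter> space M \<inter> B)" for h
        using union(1) unfolding disjoint_family_on_def by blast
      show "prob ((F ^^ h) -` A k \<inter> space M \<inter> B) \<le> prob (A k)" for k h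
        unfolding preserves_measure_funpow[OF pres A, symmetric, of k h]
        by (rule finite_measure_mono[OF _ vim[OF A]]) blast
    qed (rule union(3))
    moreover have "(F ^^ h) -` (\<Union>k. A k) \<inter> space M \<inter> B = (\<Union>k. (F ^^ h) -` A k \<inter> space M \<inter> B)" for h
      by blast
    ultimately show ?case by simp
  qed
  have lim2: "(\<lambda>h. prob ((F ^^ h) -` A \<inter> space M \<inter> B)) \<longlonglongrightarrow> prob A * prob B"
    if A: "A \<in> sets M" and B: "B \<in> sigma_sets (space M) E" for A B
    using E(2,3) B
  proof (induction rule: sigma_sets_induct_disjoint)
    case (basic B)
    then show ?case using lim1 A E(1) by blast
  next
    case empty
    show ?case by simp
  next
    case (compl B)
    then have B: "B \<in> sets M" using E(1) by simp
    have "prob ((F ^^ h) -` A \<inter> space M \<inter> (space M - B))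
        = prob A - prob ((F ^^ h) -` A \<inter> space M \<inter> B)" for h
    proof -
      define S where "S = (F ^^ h) -` A \<inter> space M"
      have S: "S \<in> sets M" "prob S = prob A"
        unfolding S_def by (rule vim[OF A], rule preserves_measure_funpow[OF pres A])
      have "S \<inter> (space M - B) = S - S \<inter> B" using S_def by blast
      then show ?thesis unfolding S_def[symmetric]
        using finite_measure_Diff[of S "S \<inter> B"] S B by (simp only: sets.Int Int_lower1)
    qed
    moreover have "prob A * prob (space M - B) = prob A - prob A * prob B"
      unfolding prob_compl[OF B] by (simp add: algebra_simps)
    ultimately show ?case using tendsto_diff[OF tendsto_const compl(2)] by simp
  next
    case (union B)
    then have B: "B k \<in> sets M" for k using E(1) by auto
    have "(\<lambda>h. prob (\<Union>k. (F ^^ h) -` A \<inter> space M \<inter> B k)) \<longlonglongrightarrow> prob (\<Union>k. B k) * prob A"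
    proof (rule tendsto_measure_UN[OF union(1) B])
      show "(F ^^ h) -` A \<inter> space M \<inter> B k \<in> sets M" for k h using vim[OF A] B by blast
      show "disjoint_family (\<lambda>k. (F ^^ h) -` A \<inter> space M \<inter> B k)" for h
        using union(1) unfolding disjoint_family_on_def by blast
      show "prob ((F ^^ h) -` A \<inter> space M \<inter> B k) \<le> prob (B k)" for k h
        by (rule finite_measure_mono[OF _ B]) blast
      show "(\<lambda>h. prob ((F ^^ h) -` A \<inter> space M \<inter> B k)) \<longlonglongrightarrow> prob (B k) * prob A" for k
        using union(3)[of k] by (simp add: mult.commute)
    qed
    moreover have "(F ^^ h) -` A \<inter> space M \<inter> (\<Union>k. B k) = (\<Union>k. (F ^^ h) -` A \<inter> space M \<inter> B k)" for h
      by blast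
    ultimately show ?case by (simp only: mult.commute)
  qed
  show ?thesis
    unfolding ergodic_mixing_def using pres lim2 E(1) by blast
qed

lemma weakly_ergodic_mixing_if_mixing:
  assumes "ergodic_mixing M F"
  shows "weakly_ergodic_mixing M F"
  unfolding weakly_ergodic_mixing_def
proof (intro conjI ballI)
  show "preserves_measure M F" using assms by (simp add: ergodic_mixing_def)
  fix A B assume "A \<in> sets M" "B \<in> sets M"
  then have "(\<lambda>h. measure M ((F ^^ h) -` A \<inter> space M \<inter> B)) \<longlonglongrightarrow> measure M A * measure M B"
    using assms by (simp add: ergodic_mixing_def)
  then have "(\<lambda>h. \<bar>measure M ((F ^^ h) -` A \<inter> space M \<inter> B) - measure M A * measure M B\<bar>) \<longlonglongrightarrow> 0"
    by (intro tendsto_rabs_zero) (simp add: LIM_zero)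
  then show "(\<lambda>h. 1 / real h * (\<Sum>i<h. \<bar>measure M ((F ^^ i) -` A \<inter> space M \<inter> B)
      - measure M A * measure M B\<bar>)) \<longlonglongrightarrow> 0"
    by (rule cesaro_null)
qed

text \<open>For an invariant set paired with itself all terms of the average are the same number,
  which must therefore vanish.\<close>

lemma ergodic_if_weakly_mixing:
  assumes "weakly_ergodic_mixing M F"
  shows "ergodic M F"
  unfolding ergodic_def
proof (intro conjI ballI impI)
  show "preserves_measure M F" using assms by (simp add: weakly_ergodic_mixing_def)
  then have F: "F \<in> measurable M M" by (simp add: preserves_measure_def)
  fix A assume A: "A \<in> sets M" "A = F -` A \<inter> space M"
  have "(F ^^ i) -` A \<inter> space M = A" for i
  proof (induction i)
    case 0
    then show ?case using A(2) by auto
  next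
    case (Suc i)
    have "(F ^^ Suc i) -` A \<inter> space M = F -` ((F ^^ i) -` A \<inter> space M) \<inter> space M"
      unfolding funpow_Suc_right using measurable_space[OF F] by auto
    also have "\<dots> = A" unfolding Suc by (rule A(2)[symmetric])
    finally show ?case .
  qed
  then have "(\<lambda>h. 1 / real h * (\<Sum>i<h. \<bar>measure M A - measure M A * measure M A\<bar>)) \<longlonglongrightarrow> 0"
    using assms A(1) unfolding weakly_ergodic_mixing_def by fastforce
  \<comment> \<open>The average is this constant only for \<open>h > 0\<close>; at
    \<open>h = 0\<close> division by zero makes it \<open>0\<close>.\<close>
  moreover have "eventually (\<lambda>h. 1 / real h * (\<Sum>i<h. \<bar>measure M A - measure M A * measure M A\<bar>)
      = \<bar>measure M A - measure M A * measure M A\<bar>) sequentially"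
    using eventually_gt_at_top[of 0] by eventually_elim simp
  ultimately have "(\<lambda>h::nat. \<bar>measure M A - measure M A * measure M A\<bar>) \<longlonglongrightarrow> 0"
    by (simp add: tendsto_cong)
  then have "\<bar>measure M A - measure M A * measure M A\<bar> = 0"
    by (simp add: LIMSEQ_const_iff)
  then show "measure M A * (1 - measure M A) = 0" by (simp add: algebra_simps)
qed

section \<open>Implications between the topological properties\<close>

lemma top_mixingD:
  assumes "top_mixing T F" "openin T U" "openin T V" "U \<noteq> {}" "V \<noteq> {}"
  shows "\<exists>h0. \<forall>h\<ge>h0. (F ^^ h) ` U \<inter> V \<noteq> {}"
  using assms unfolding top_mixing_def by simp

lemma weakly_top_transitive_if_mixing:
  assumes "top_mixing T F"
  shows "weakly_top_transitive T F"
  unfolding weakly_top_transitive_def top_transitive_def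
proof (intro allI impI, elim conjE)
  fix U V assume UV: "openin (prod_topology T T) U" "openin (prod_topology T T) V" "U \<noteq> {}" "V \<noteq> {}"
  have rect: "\<exists>A B. openin T A \<and> openin T B \<and> A \<noteq> {} \<and> B \<noteq> {} \<and> A \<times> B \<subseteq> S"
    if "openin (prod_topology T T) S" "S \<noteq> {}" for S
    using that unfolding openin_prod_topology_alt by (metis empty_iff equals0I surj_pair)
  obtain U1 U2 where U: "openin T U1" "openin T U2" "U1 \<noteq> {}" "U2 \<noteq> {}" "U1 \<times> U2 \<subseteq> U"
    using rect[OF UV(1,3)] by blast
  obtain V1 V2 where V: "openin T V1" "openin T V2" "V1 \<noteq> {}" "V2 \<noteq> {}" "V1 \<times> V2 \<subseteq> V"
    using rect[OF UV(2,4)] by blast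
  obtain h1 where h1: "\<forall>h\<ge>h1. (F ^^ h) ` U1 \<inter> V1 \<noteq> {}"
    using top_mixingD[OF assms U(1) V(1) U(3) V(3)] by (elim exE)
  obtain h2 where h2: "\<forall>h\<ge>h2. (F ^^ h) ` U2 \<inter> V2 \<noteq> {}"
    using top_mixingD[OF assms U(2) V(2) U(4) V(4)] by (elim exE)
  \<comment> \<open>Mixing provides all large times, so one time serves both coordinates.\<close>
  let ?h = "max h1 h2"
  have pow: "(map_prod F F ^^ h) (x, y) = ((F ^^ h) x, (F ^^ h) y)" for h x y
    by (induction h) auto
  have "(F ^^ ?h) ` U1 \<inter> V1 \<noteq> {}" "(F ^^ ?h) ` U2 \<inter> V2 \<noteq> {}"
    using h1 h2 by simp_all
  then obtain x y where xy: "x \<in> U1" "(F ^^ ?h) x \<in> V1" "y \<in> U2" "(F ^^ ?h) y \<in> V2"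
    by blast
  have "(x, y) \<in> U" using xy(1,3) U(5) by blast
  moreover have "(map_prod F F ^^ ?h) (x, y) \<in> V" unfolding pow using xy(2,4) V(5) by blast
  ultimately have "(map_prod F F ^^ ?h) (x, y) \<in> (map_prod F F ^^ ?h) ` U \<inter> V" by blast
  then show "\<exists>h. (map_prod F F ^^ h) ` U \<inter> V \<noteq> {}" by blast
qed

lemma totally_transitive_if_mixing:
  assumes "top_mixing T F"
  shows "totally_transitive T F"
  unfolding totally_transitive_def top_transitive_def
proof (intro allI impI, elim conjE)
  fix h :: nat and U V assume h: "1 \<le> h" and UV: "openin T U" "openin T V" "U \<noteq> {}" "V \<noteq> {}"
  obtain h0 where h0: "\<forall>h\<ge>h0. (F ^^ h) ` U \<inter> V \<noteq> {}"
    using top_mixingD[OF assms UV] by (elim exE)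
  \<comment> \<open>The exponent \<open>h * h0\<close> is at least \<open>h0\<close> since
    \<open>h \<ge> 1\<close>.\<close>
  have "((F ^^ h) ^^ h0) ` U \<inter> V \<noteq> {}"
    unfolding funpow_mult using h by (intro h0[rule_format]) simp
  then show "\<exists>k. ((F ^^ h) ^^ k) ` U \<inter> V \<noteq> {}" by blast
qed

lemma top_transitive_if_totally: "totally_transitive T F \<Longrightarrow> top_transitive T F"
  unfolding totally_transitive_def by (auto dest!: spec[of _ "1::nat"])

lemma top_transitive_if_weakly:
  assumes "weakly_top_transitive T F"
  shows "top_transitive T F"
  unfolding top_transitive_def
proof (intro allI impI, elim conjE)
  fix U V assume UV: "openin T U" "openin T V" "U \<noteq> {}" "V \<noteq> {}"
  have pow: "(map_prod F F ^^ h) (x, y) = ((F ^^ h) x, (F ^^ h) y)" for h x y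
    by (induction h) auto
  have "openin (prod_topology T T) (U \<times> U)" "openin (prod_topology T T) (V \<times> V)"
    using UV by (simp_all add: openin_prod_Times_iff)
  moreover have "U \<times> U \<noteq> {}" "V \<times> V \<noteq> {}" using UV(3,4) by auto
  ultimately obtain h where "(map_prod F F ^^ h) ` (U \<times> U) \<inter> (V \<times> V) \<noteq> {}"
    using assms unfolding weakly_top_transitive_def top_transitive_def by meson
  then obtain w where w: "w \<in> (map_prod F F ^^ h) ` (U \<times> U)" "w \<in> V \<times> V"
    by (meson disjoint_iff)
  from w(1) obtain z where z: "w = (map_prod F F ^^ h) z" "z \<in> U \<times> U" by (rule imageE)
  obtain x y where "z = (x, y)" by (cases z)
  then have "x \<in> U" "(F ^^ h) x \<in> V" using z w(2) pow by simp_all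
  then have "(F ^^ h) ` U \<inter> V \<noteq> {}" by blast
  then show "\<exists>h. (F ^^ h) ` U \<inter> V \<noteq> {}" by (rule exI)
qed

section \<open>Open sets and cylinders\<close>

context finite_config
begin

lemma openin_config:
  "openin (config_topology G) S \<longleftrightarrow>
    S \<subseteq> C \<and> (\<forall>x\<in>S. \<exists>W. finite W \<and> (\<forall>y\<in>C. (\<forall>i\<in>W. y i = x i) \<longrightarrow> y \<in> S))"
proof
  assume open_S: "openin (config_topology G) S"
  have "topspace (config_topology G) = C"
    by (simp add: config_topology_def config_group_def)
  then have "S \<subseteq> C" using openin_subset[OF open_S] by simp
  moreover have "\<exists>W. finite W \<and> (\<forall>y\<in>C. (\<forall>i\<in>W. y i = x i) \<longrightarrow> y \<in> S)" if x: "x \<in> S" for x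
  proof -
    obtain N where N: "finite {i. N i \<noteq> carrier G}" "x \<in> Pi\<^sub>E UNIV N" "Pi\<^sub>E UNIV N \<subseteq> S"
      using open_S x unfolding config_topology_def openin_product_topology_alt by auto
    have "y \<in> S" if y: "y \<in> C" "\<forall>i\<in>{i. N i \<noteq> carrier G}. y i = x i" for y
    proof -
      have "y i \<in> N i" for i
        using y N(2) by (cases "N i = carrier G") auto
      then show ?thesis using N(3) by auto
    qed
    then show ?thesis using N(1) by (intro exI[of _ "{i. N i \<noteq> carrier G}"] conjI ballI impI)
  qed
  ultimately show "S \<subseteq> C \<and> (\<forall>x\<in>S. \<exists>W. finite W \<and> (\<forall>y\<in>C. (\<forall>i\<in>W. y i = x i) \<longrightarrow> y \<in> S))"
    by (intro conjI ballI)
next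
  assume S: "S \<subseteq> C \<and> (\<forall>x\<in>S. \<exists>W. finite W \<and> (\<forall>y\<in>C. (\<forall>i\<in>W. y i = x i) \<longrightarrow> y \<in> S))"
  show "openin (config_topology G) S"
    unfolding config_topology_def openin_product_topology_alt
  proof (intro ballI)
    fix x assume x: "x \<in> S"
    then obtain W where W: "finite W" "\<And>y. y \<in> C \<Longrightarrow> \<forall>i\<in>W. y i = x i \<Longrightarrow> y \<in> S"
      using S by metis
    define N where "N i = (if i \<in> W then {x i} else carrier G)" for i
    have x_C: "x \<in> C" using S x by blast
    have "{i \<in> UNIV. N i \<noteq> topspace (discrete_topology (carrier G))} \<subseteq> W"
      by (auto simp: N_def)
    then have "finite {i \<in> UNIV. N i \<noteq> topspace (discrete_topology (carrier G))}"
      using W(1) by (rule finite_subset)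
    moreover have "\<forall>i\<in>UNIV. openin (discrete_topology (carrier G)) (N i)"
      using x_C by (simp add: N_def)
    moreover have "x \<in> Pi\<^sub>E UNIV N" using x_C by (auto simp: N_def)
    moreover have "Pi\<^sub>E UNIV N \<subseteq> S"
    proof
      fix y assume "y \<in> Pi\<^sub>E UNIV N"
      then have y: "y i \<in> N i" for i by auto
      have "y i \<in> carrier G" for i using y[of i] x_C by (auto simp: N_def split: if_splits)
      moreover have "\<forall>i\<in>W. y i = x i"
      proof
        fix i assume "i \<in> W" then show "y i = x i" using y[of i] by (simp add: N_def)
      qed
      ultimately show "y \<in> S" by (intro W(2) configI)
    qed
    ultimately show "\<exists>U. finite {i \<in> UNIV. U i \<noteq> topspace (discrete_topology (carrier G))} \<and>
        (\<forall>i\<in>UNIV. openin (discrete_topology (carrier G)) (U i)) \<and> x \<in> Pi\<^sub>E UNIV U \<and> Pi\<^sub>E UNIV U \<subseteq> S"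
      by blast
  qed
qed

text \<open>Full support of \<open>\<mu>\<close>, the link from statements about measure to
  statements about open sets.\<close>

lemma cylinder_positive:
  assumes "finite W" "x \<in> C"
  shows "measure \<mu> {y \<in> C. \<forall>i\<in>W. y i = x i} > 0"
  using measure_product[of W "\<lambda>i. {x i}"] assms n_pos by (simp add: prod_pos)

end

section \<open>Equivalence of the seven properties with the absence of factors\<close>

context additive_automaton
begin

text \<open>On cylinders the product formula is not merely a limit but exact from some time on, once
  the joint map on a common window is onto.\<close>

lemma ergodic_mixing_if_factor_free:
  assumes free: "factor_free"
  shows "ergodic_mixing \<mu> F"
proof (rule ergodic_mixingI[OF preserves_config[OF free] _ Int_stable_prod_algebra])
  let ?E = "prod_algebra UNIV (\<lambda>_::int. uniform_count_measure (carrier G))"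
  show "sets \<mu> = sigma_sets (space \<mu>) ?E" unfolding space_config by (rule sets_config)
  show "?E \<subseteq> Pow (space \<mu>)"
    using prod_algebra_sets_into_space[of UNIV "\<lambda>_::int. uniform_count_measure (carrier G)"]
    by (simp add: space_config space_uniform_count_measure config_group_def)
  fix A B assume AB: "A \<in> ?E" "B \<in> ?E"
  obtain I where I: "finite I" "\<forall>W. I \<subseteq> W \<longrightarrow> (\<exists>P. A = {x \<in> C. restrict x W \<in> P})"
    using prod_algebra_window[OF AB(1)] by (elim exE conjE)
  obtain J where J: "finite J" "\<forall>W. J \<subseteq> W \<longrightarrow> (\<exists>P. B = {x \<in> C. restrict x W \<in> P})"
    using prod_algebra_window[OF AB(2)] by (elim exE conjE)
  define W where "W = I \<union> J"
  have W: "finite W" using I J by (simp add: W_def)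
  obtain P where A: "A = {x \<in> C. restrict x W \<in> P}"
    using I(2)[THEN spec, THEN mp, of W] by (auto simp: W_def)
  obtain Q where B: "B = {x \<in> C. restrict x W \<in> Q}"
    using J(2)[THEN spec, THEN mp, of W] by (auto simp: W_def)
  have vim: "(F ^^ h) -` A \<inter> space \<mu> \<inter> B
      = {x \<in> C. restrict x W \<in> Q \<and> restrict ((F ^^ h) x) W \<in> P}" for h
    unfolding A B space_config using Fpow.hom_closed by auto
  have "eventually (\<lambda>h. prob ((F ^^ h) -` A \<inter> space \<mu> \<inter> B) = prob A * prob B) sequentially"
    using factor_free_jointly_onto[OF free W]
  proof eventually_elim
    case (elim h)
    then have "prob {x \<in> C. restrict x W \<in> Q \<and> restrict ((F ^^ h) x) W \<in> P}
        = prob {x \<in> C. restrict x W \<in> Q} * prob {x \<in> C. restrict x W \<in> P}"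
      by (intro measure_joint_window[OF W Fpow_hom Fpow_measurable]) blast
    then show ?case unfolding vim by (simp only: A B mult.commute)
  qed
  then show "(\<lambda>h. prob ((F ^^ h) -` A \<inter> space \<mu> \<inter> B)) \<longlonglongrightarrow> prob A * prob B"
    by (rule tendsto_eventually)
qed

text \<open>Nonempty open sets contain cylinders of positive measure. Their correlations tend to a
  positive limit, and an intersection of positive measure is nonempty.\<close>

lemma top_mixing_if_ergodic_mixing:
  assumes "ergodic_mixing \<mu> F"
  shows "top_mixing (config_topology G) F"
  unfolding top_mixing_def
proof (intro allI impI, elim conjE)
  fix U V
  assume UV: "openin (config_topology G) U" "openin (config_topology G) V" "U \<noteq> {}" "V \<noteq> {}"
  have cyl: "\<exists>A. A \<in> sets \<mu> \<and> A \<subseteq> S \<and> prob A > 0" if S: "openin (config_topology G) S" "S \<noteq> {}" for S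
  proof -
    obtain x where x: "x \<in> S" using S(2) by blast
    note S' = S(1)[unfolded openin_config, THEN conjunct1] S(1)[unfolded openin_config, THEN conjunct2]
    obtain W where W: "finite W" "\<forall>y\<in>C. (\<forall>i\<in>W. y i = x i) \<longrightarrow> y \<in> S"
      using S'(2)[THEN bspec, OF x] by (elim exE conjE)
    show ?thesis
      using measurable_cylinder[OF W(1), of x] cylinder_positive[OF W(1), of x] W(2) S'(1) x
      by (intro exI[of _ "{y \<in> C. \<forall>i\<in>W. y i = x i}"]) auto
  qed
  obtain A where A: "A \<in> sets \<mu>" "A \<subseteq> V" "prob A > 0" using cyl[OF UV(2,4)] by blast
  obtain B where B: "B \<in> sets \<mu>" "B \<subseteq> U" "prob B > 0" using cyl[OF UV(1,3)] by blast
  have "(\<lambda>h. prob ((F ^^ h) -` A \<inter> space \<mu> \<inter> B)) \<longlonglongrightarrow> prob A * prob B"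
    using assms A(1) B(1) by (simp add: ergodic_mixing_def)
  then have "eventually (\<lambda>h. prob ((F ^^ h) -` A \<inter> space \<mu> \<inter> B) > 0) sequentially"
    by (rule order_tendstoD(1)) (rule mult_pos_pos[OF A(3) B(3)])
  then obtain h0 where h0: "\<And>h. h \<ge> h0 \<Longrightarrow> prob ((F ^^ h) -` A \<inter> space \<mu> \<inter> B) > 0"
    by (auto simp: eventually_sequentially)
  have "(F ^^ h) ` U \<inter> V \<noteq> {}" if "h \<ge> h0" for h
  proof -
    have "(F ^^ h) -` A \<inter> space \<mu> \<inter> B \<noteq> {}"
    proof
      assume empty: "(F ^^ h) -` A \<inter> space \<mu> \<inter> B = {}"
      show False using h0[OF that] unfolding empty by simp
    qed
    then show ?thesis using A(2) B(2) by blast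
  qed
  then show "\<exists>h0. \<forall>h\<ge>h0. (F ^^ h) ` U \<inter> V \<noteq> {}" by blast
qed

lemma proper_factor_funpow:
  assumes "proper_factor U" "x \<in> U"
  shows "(F ^^ h) x \<in> U"
  using assms by (induction h) (auto simp: proper_factor_def)

lemma factor_free_if_transitive:
  assumes "top_transitive (config_topology G) F"
  shows "factor_free"
  unfolding factor_free_def
proof (intro allI notI)
  fix U assume fac: "proper_factor U"
  then have U: "subgroup U X" "U \<noteq> C" by (simp_all add: proper_factor_def)
  obtain W where W: "finite W" "determined U W" using fac unfolding proper_factor_def by (elim conjE exE)
  have nearby: "y \<in> U \<longleftrightarrow> x \<in> U" if "x \<in> C" "y \<in> C" "\<forall>i\<in>W. y i = x i" for x y
    by (rule mem_determined_iff[OF U(1) W(2) that(1,2)]) (use that(3) in simp)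
  have U_C: "U \<subseteq> C" by (rule subgroup.subset[OF U(1)])
  have "openin (config_topology G) U" "openin (config_topology G) (C - U)"
    unfolding openin_config
    by (intro conjI ballI exI[of _ W] W(1) impI; use U_C nearby in blast)+
  moreover have "C - U \<noteq> {}" using U(2) U_C by blast
  moreover have "U \<noteq> {}" using subgroup.one_closed[OF U(1)] by blast
  ultimately obtain h where "(F ^^ h) ` U \<inter> (C - U) \<noteq> {}"
    using assms unfolding top_transitive_def by blast
  then show False using proper_factor_funpow[OF fac] by blast
qed

text \<open>Ergodicity concerns sets equal to their preimage, whereas \<open>U\<close> is only
  contained in its own. Its iterated preimages increase and have equal measure, so passing to their
  union keeps the measure, which lies strictly between \<open>0\<close> and \<open>1\<close> because
  \<open>U\<close> and its complement both contain cylinders.\<close>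

lemma factor_free_if_ergodic:
  assumes "ergodic \<mu> F"
  shows "factor_free"
  unfolding factor_free_def
proof (intro allI notI)
  fix U assume fac: "proper_factor U"
  then have U: "subgroup U X" "U \<noteq> C" by (simp_all add: proper_factor_def)
  obtain W where W: "finite W" "determined U W" using fac unfolding proper_factor_def by (elim conjE exE)
  have pres: "preserves_measure \<mu> F" using assms by (simp add: ergodic_def)
  have U_C: "U \<subseteq> C" by (rule subgroup.subset[OF U(1)])
  have nearby: "y \<in> U \<longleftrightarrow> x \<in> U" if "x \<in> C" "y \<in> C" "\<forall>i\<in>W. y i = x i" for x y
    by (rule mem_determined_iff[OF U(1) W(2) that(1,2)]) (use that(3) in simp)
  have eq: "U = {x \<in> C. restrict x W \<in> (\<lambda>u. restrict u W) ` U}"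
  proof (intro equalityI subsetI CollectI conjI)
    fix x assume "x \<in> {x \<in> C. restrict x W \<in> (\<lambda>u. restrict u W) ` U}"
    then obtain u where "x \<in> C" "u \<in> U" "\<forall>i\<in>W. x i = u i"
      by (auto simp: restrict_eq_iff simp del: restrict_apply)
    then show "x \<in> U" using nearby[of u x] U_C by blast
  qed (use U_C in blast)+
  have U_sets: "U \<in> sets \<mu>" by (subst eq) (rule measurable_window[OF W(1)])
  have U_pos: "prob U > 0"
  proof -
    have "{y \<in> C. \<forall>i\<in>W. y i = e i} \<subseteq> U"
      using determinedD[OF W(2)] by auto
    then show ?thesis
      using cylinder_positive[OF W(1) X.one_closed] finite_measure_mono[OF _ U_sets] by (meson less_le_trans)
  qed
  have U_less: "prob U < 1"
  proof -
    obtain a where a: "a \<in> C" "a \<notin> U" using U(2) U_C by blast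
    let ?A = "{y \<in> C. \<forall>i\<in>W. y i = a i}"
    have "u \<notin> ?A" if "u \<in> U" for u
      using nearby[of a u] a that U_C by (simp only: mem_Collect_eq) blast
    then have "U \<subseteq> space \<mu> - ?A" unfolding space_config using U_C by blast
    then have "prob U \<le> prob (space \<mu> - ?A)"
      using measurable_cylinder[OF W(1)] by (intro finite_measure_mono) auto
    also have "\<dots> = 1 - prob ?A" using measurable_cylinder[OF W(1)] by (rule prob_compl)
    finally show ?thesis using cylinder_positive[OF W(1) a(1)] by linarith
  qed
  define A where "A h = (F ^^ h) -` U \<inter> space \<mu>" for h
  have A_sets: "A h \<in> sets \<mu>" for h
    unfolding A_def by (rule measurable_sets[OF Fpow_measurable U_sets])
  have "A h \<subseteq> A (Suc h)" for h
    unfolding A_def using fac by (auto simp: proper_factor_def)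
  then have "incseq A" by (rule incseq_SucI)
  then have "(\<lambda>h. prob (A h)) \<longlonglongrightarrow> prob (\<Union>h. A h)"
    using A_sets by (intro finite_Lim_measure_incseq) auto
  moreover have "prob (A h) = prob U" for h
    unfolding A_def by (rule preserves_measure_funpow[OF pres U_sets])
  ultimately have prob_A: "prob (\<Union>h. A h) = prob U" by (simp add: LIMSEQ_const_iff)
  have "F -` (\<Union>h. A h) \<inter> space \<mu> = (\<Union>h. A (Suc h))"
    unfolding A_def funpow_Suc_right using F.hom_closed by (auto simp: space_config)
  also have "\<dots> = (\<Union>h. A h)"
    using \<open>\<And>h. A h \<subseteq> A (Suc h)\<close> by blast
  finally have "(\<Union>h. A h) = F -` (\<Union>h. A h) \<inter> space \<mu>" by simp
  moreover have "(\<Union>h. A h) \<in> sets \<mu>" using A_sets by blast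
  ultimately have "prob U * (1 - prob U) = 0"
    using assms unfolding ergodic_def prob_A[symmetric] by blast
  then show False using U_pos U_less by simp
qed

text \<open>Closes the cycles of implications: absence of factors gives ergodic mixing, which leads
  through topological mixing to transitivity and through weak ergodic mixing to ergodicity, and
  either of these excludes factors.\<close>

theorem dynamics_iff_factor_free:
  shows "top_transitive (config_topology G) F \<longleftrightarrow> factor_free"
    and "ergodic \<mu> F \<longleftrightarrow> factor_free"
    and "top_mixing (config_topology G) F \<longleftrightarrow> factor_free"
    and "weakly_top_transitive (config_topology G) F \<longleftrightarrow> factor_free"
    and "totally_transitive (config_topology G) F \<longleftrightarrow> factor_free"
    and "weakly_ergodic_mixing \<mu> F \<longleftrightarrow> factor_free"
    and "ergodic_mixing \<mu> F \<longleftrightarrow> factor_free"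
  using ergodic_mixing_if_factor_free top_mixing_if_ergodic_mixing factor_free_if_transitive
    factor_free_if_ergodic weakly_ergodic_mixing_if_mixing ergodic_if_weakly_mixing
    weakly_top_transitive_if_mixing totally_transitive_if_mixing top_transitive_if_totally
    top_transitive_if_weakly
  by metis+

end

section \<open>The decision procedure\<close>

text \<open>Words over \<open>{..<n}\<close> are numbers in base \<open>n\<close> whose least
  significant digit is the first letter, to match the order in which \<open>List.n_lists\<close>
  enumerates words.\<close>

definition digit :: "nat \<Rightarrow> nat \<Rightarrow> nat \<Rightarrow> nat" where
  "digit n v i = v div n ^ i mod n"

fun encode :: "nat \<Rightarrow> nat \<Rightarrow> (nat \<Rightarrow> nat) \<Rightarrow> nat" where
  "encode n 0 f = 0"
| "encode n (Suc k) f = f 0 + n * encode n k (\<lambda>i. f (Suc i))"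

lemma encode_cong: "(\<And>i. i < k \<Longrightarrow> f i = g i) \<Longrightarrow> encode n k f = encode n k g"
proof (induction k arbitrary: f g)
  case (Suc k)
  have "encode n k (\<lambda>i. f (Suc i)) = encode n k (\<lambda>i. g (Suc i))"
    using Suc.prems by (intro Suc.IH) simp
  then show ?case using Suc.prems[of 0] by simp
qed simp

lemma encode_less:
  assumes "\<And>i. i < k \<Longrightarrow> f i < n"
  shows "encode n k f < n ^ k"
  using assms
proof (induction k arbitrary: f)
  case (Suc k)
  have "encode n k (\<lambda>i. f (Suc i)) < n ^ k" using Suc.prems by (intro Suc.IH) simp
  then have "Suc (encode n k (\<lambda>i. f (Suc i))) \<le> n ^ k" by simp
  then have "n * Suc (encode n k (\<lambda>i. f (Suc i))) \<le> n * n ^ k" by (rule mult_le_mono2)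
  then show ?case using Suc.prems[of 0] by simp
qed simp

lemma digit_Suc: "digit n v (Suc i) = digit n (v div n) i"
  by (simp add: digit_def div_mult2_eq)

lemma digit_encode:
  assumes "\<And>i. i < k \<Longrightarrow> f i < n" "i < k"
  shows "digit n (encode n k f) i = f i"
  using assms
proof (induction k arbitrary: f i)
  case (Suc k)
  have "f 0 < n" using Suc.prems(1)[of 0] by simp
  then have "(f 0 + n * m) div n = m" "(f 0 + n * m) mod n = f 0" for m
    by simp_all
  then show ?case
    using Suc.IH[of "\<lambda>i. f (Suc i)" "i - 1"] Suc.prems
    by (cases i) (auto simp: digit_Suc digit_def[of _ _ 0])
qed simp

lemma encode_digit: "v < n ^ k \<Longrightarrow> encode n k (digit n v) = v"
proof (induction k arbitrary: v)
  case (Suc k)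
  have "v div n < n ^ k" using Suc.prems by (simp add: less_mult_imp_div_less mult.commute)
  then have "encode n k (digit n (v div n)) = v div n" by (rule Suc.IH)
  then show ?case by (simp add: digit_Suc digit_def[of _ _ 0])
qed simp

lemma encode_eqI: "v < n ^ k \<Longrightarrow> (\<And>i. i < k \<Longrightarrow> digit n v i = f i) \<Longrightarrow> v = encode n k f"
  using encode_digit[of v n k] encode_cong[of k "digit n v" f n] by simp

text \<open>Subwords are obtained by division and remainder with powers of \<open>n\<close>, so the
  search handles words by arithmetic alone.\<close>

lemma digit_window:
  assumes "j < b"
  shows "digit n (u div n ^ a mod n ^ b) j = digit n u (a + j)"
proof -
  have "u div n ^ a mod n ^ b div n ^ j mod n = u div n ^ a div n ^ j mod n ^ (b - j) mod n"
  proof (cases "n = 0")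
    case False
    have "n ^ b = n ^ j * n ^ (b - j)" using assms by (simp add: power_add[symmetric])
    then have "u div n ^ a mod n ^ b = n ^ j * (u div n ^ a div n ^ j mod n ^ (b - j)) + u div n ^ a mod n ^ j"
      by (simp add: mod_mult2_eq)
    then have "u div n ^ a mod n ^ b div n ^ j = u div n ^ a div n ^ j mod n ^ (b - j)"
      using False by simp
    then show ?thesis by simp
  qed (use assms in \<open>cases j; simp\<close>)
  also have "\<dots> = u div n ^ a div n ^ j mod n"
    using assms by (intro mod_mod_cancel) (simp add: dvd_power)
  finally show ?thesis by (simp add: digit_def power_add div_mult2_eq)
qed

lemma window_encode:
  assumes "\<And>i. i < k \<Longrightarrow> f i < n" "a + b \<le> k" "n > 0"
  shows "encode n k f div n ^ a mod n ^ b = encode n b (\<lambda>j. f (a + j))"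
  using assms by (intro encode_eqI) (simp_all add: digit_window digit_encode)

lemma nth_concat_map:
  assumes "\<And>x. x \<in> set xs \<Longrightarrow> length (f x) = n" "a < length xs" "b < n"
  shows "concat (map f xs) ! (a * n + b) = f (xs ! a) ! b"
  using assms
proof (induction xs arbitrary: a)
  case (Cons x xs)
  then show ?case by (cases a) (auto simp: nth_append)
qed simp

text \<open>\<open>List.n_lists\<close> varies the first letter fastest, so the position of a word
  in the enumeration is its number in base \<open>n\<close>; the rule table is indexed directly by
  words.\<close>

lemma nth_n_lists:
  assumes "v < n ^ k"
  shows "List.n_lists k [0..<n] ! v = map (digit n v) [0..<k]"
  using assms
proof (induction k arbitrary: v)
  case (Suc k)
  then have "n > 0" by (cases "n = 0") auto
  have v: "v div n < n ^ k" using Suc.prems by (simp add: less_mult_imp_div_less mult.commute)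
  have "List.n_lists (Suc k) [0..<n] ! (v div n * n + v mod n)
      = map (\<lambda>y. y # (List.n_lists k [0..<n] ! (v div n))) [0..<n] ! (v mod n)"
    unfolding List.n_lists.simps using v \<open>n > 0\<close>
    by (intro nth_concat_map) (simp_all add: length_n_lists)
  also have "\<dots> = v mod n # map (digit n (v div n)) [0..<k]"
    using \<open>n > 0\<close> Suc.IH[OF v] by simp
  also have "\<dots> = map (digit n v) [0..<Suc k]"
    by (simp only: upt_conv_Cons[OF zero_less_Suc] map_Suc_upt[symmetric])
      (simp add: digit_Suc digit_def[of _ _ 0])
  finally show ?case by simp
qed simp

abbreviation code_n :: "nat \<Rightarrow> nat" where "code_n z \<equiv> code_nth z 0"
abbreviation code_r :: "nat \<Rightarrow> nat" where "code_r z \<equiv> code_nth z 1"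

text \<open>A set of words of length \<open>w\<close> is given by the binary digits of \<open>S\<close>.\<close>

definition words_subgroup :: "nat \<Rightarrow> nat \<Rightarrow> nat \<Rightarrow> bool" where
  "words_subgroup z w S \<longleftrightarrow>
    (\<forall>x<code_n z ^ w. \<forall>y<code_n z ^ w. \<forall>u<code_n z ^ w.
      (\<forall>i<w. digit (code_n z) u i
        = code_nth z (2 + digit (code_n z) x i * code_n z + digit (code_n z) y i)) \<and>
      digit 2 S x = 1 \<longrightarrow> (digit 2 S y = 1 \<longleftrightarrow> digit 2 S u = 1))"

text \<open>The next state of \<open>w\<close> cells depends on \<open>w + 2 * r\<close> cells.
  These form \<open>u\<close>, whose middle part starts at position \<open>r\<close>, and the table
  lookups force \<open>v\<close> to be the image of \<open>u\<close>.\<close>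

definition words_invariant :: "nat \<Rightarrow> nat \<Rightarrow> nat \<Rightarrow> bool" where
  "words_invariant z w S \<longleftrightarrow>
    (\<forall>u<code_n z ^ (w + 2 * code_r z). \<forall>v<code_n z ^ w.
      (\<forall>i<w. digit (code_n z) v i = code_nth z (2 + code_n z * code_n z
        + u div code_n z ^ i mod code_n z ^ (2 * code_r z + 1))) \<and>
      digit 2 S (u div code_n z ^ code_r z mod code_n z ^ w) = 1 \<longrightarrow> digit 2 S v = 1)"

text \<open>\<open>Suc\<close> turns the bound on the window length into a strict one, and
  \<open>S\<close> ranges over all sets of words of length \<open>w\<close>. Products and images of
  words are quantified over and checked letter by letter rather than computed, which leaves only
  bounded quantifiers and arithmetic.\<close>

definition has_factor :: "nat \<Rightarrow> bool" where
  "has_factor z \<longleftrightarrow>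
    (\<exists>w<Suc (code_n z ^ (code_n z ^ (2 * code_r z))). \<exists>S<2 ^ (code_n z ^ w).
      (\<exists>x<code_n z ^ w. digit 2 S x = 1) \<and> (\<exists>x<code_n z ^ w. \<not> digit 2 S x = 1) \<and>
      words_subgroup z w S \<and> words_invariant z w S)"

lemma recursive_has_factor: "recursive 1 (\<lambda>xs. of_bool (\<not> has_factor (xs ! 0)))"
  unfolding has_factor_def words_subgroup_def words_invariant_def digit_def
  by (intro recursive_intros recursive_code_nth; simp)

section \<open>Correctness of the search\<close>

context additive_automaton
begin

abbreviation "inst \<equiv> instance_code G r \<delta>"

text \<open>The offsets skip the two header entries and, for the rule, also the \<open>n * n\<close>
  entries of the Cayley table.\<close>

lemma code_instance:
  shows "code_n inst = n" "code_r inst = r"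
    and "a < n \<Longrightarrow> b < n \<Longrightarrow> code_nth inst (2 + a * n + b) = a \<otimes>\<^bsub>G\<^esub> b"
    and "v < n ^ (2 * r + 1) \<Longrightarrow>
      code_nth inst (2 + n * n + v) = \<delta> (map (digit n v) [0..<2 * r + 1])"
proof -
  let ?T = "[x \<otimes>\<^bsub>G\<^esub> y. x \<leftarrow> [0..<n], y \<leftarrow> [0..<n]]"
  let ?R = "map \<delta> (List.n_lists (2 * r + 1) [0..<n])"
  have inst: "inst = list_encode ([n, r] @ ?T @ ?R)"
    by (simp only: instance_code_def Let_def)
  have T: "length ?T = n * n" by (simp add: length_concat comp_def sum_list_triv)
  have R: "length ?R = n ^ (2 * r + 1)" by (simp only: length_map length_n_lists length_upt diff_zero)
  show "code_n inst = n" unfolding inst by (subst code_nth_encode) simp_all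
  show "code_r inst = r" unfolding inst by (subst code_nth_encode) simp_all
  show "code_nth inst (2 + a * n + b) = a \<otimes>\<^bsub>G\<^esub> b" if "a < n" "b < n"
  proof -
    have less: "a * n + b < n * n"
    proof -
      have "a * n + b < Suc a * n" using that by simp
      also have "\<dots> \<le> n * n" using that by (intro mult_le_mono1) simp
      finally show ?thesis .
    qed
    have "([n, r] @ ?T @ ?R) ! (2 + a * n + b) = ?T ! (a * n + b)"
      using less T by (simp add: nth_append)
    also have "\<dots> = a \<otimes>\<^bsub>G\<^esub> b"
      using that by (subst nth_concat_map) simp_all
    finally show ?thesis
      unfolding inst using less T by (subst code_nth_encode) simp_all
  qed
  show "code_nth inst (2 + n * n + v) = \<delta> (map (digit n v) [0..<2 * r + 1])" if v: "v < n ^ (2 * r + 1)"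
  proof -
    have "([n, r] @ ?T @ ?R) ! (2 + n * n + v) = ?R ! v"
      using T by (simp add: nth_append)
    also have "\<dots> = \<delta> (map (digit n v) [0..<2 * r + 1])"
      using R v nth_n_lists[OF v] by (metis length_map nth_map)
    finally show ?thesis
      unfolding inst using v T R by (subst code_nth_encode) simp_all
  qed
qed

definition word :: "nat \<Rightarrow> int \<Rightarrow> (int \<Rightarrow> nat) \<Rightarrow> nat" where
  "word k a x = encode n k (\<lambda>i. x (a + int i))"

lemma carrier_iff: "g \<in> carrier G \<longleftrightarrow> g < n"
  by (subst carrier_G) simp

lemma config_less: "x \<in> C \<Longrightarrow> x i < n"
  using config_nth[of x i] by (simp add: carrier_iff)

lemma word_less: "x \<in> C \<Longrightarrow> word k a x < n ^ k"
  unfolding word_def by (rule encode_less) (rule config_less)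

lemma digit_word: "x \<in> C \<Longrightarrow> i < k \<Longrightarrow> digit n (word k a x) i = x (a + int i)"
  unfolding word_def by (rule digit_encode) (rule config_less)

lemma word_eqI: "v < n ^ k \<Longrightarrow> (\<And>i. i < k \<Longrightarrow> digit n v i = x (a + int i)) \<Longrightarrow> v = word k a x"
  unfolding word_def by (rule encode_eqI)

lemma word_cong: "(\<And>i. a \<le> i \<Longrightarrow> i < a + int k \<Longrightarrow> x i = y i) \<Longrightarrow> word k a x = word k a y"
  unfolding word_def by (rule encode_cong) simp

lemma word_window:
  assumes "x \<in> C" "c + b \<le> k"
  shows "word k a x div n ^ c mod n ^ b = word b (a + int c) x"
  unfolding word_def using assms n_pos
  by (subst window_encode) (auto simp: config_less algebra_simps)

lemma ex_word:
  assumes "v < n ^ k"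
  shows "\<exists>x\<in>C. v = word k a x"
proof -
  define x where "x i = (if a \<le> i \<and> i < a + int k then digit n v (nat (i - a)) else \<one>\<^bsub>G\<^esub>)" for i
  have "x \<in> C"
  proof (rule configI)
    show "x i \<in> carrier G" for i
      using n_pos G.one_closed by (simp add: x_def digit_def carrier_iff)
  qed
  moreover have "v = word k a x"
    using assms by (rule word_eqI) (simp add: x_def)
  ultimately show ?thesis by blast
qed

lemma digit_word_mult:
  assumes "x \<in> C" "y \<in> C" "u < n ^ k"
  shows "(\<forall>i<k. digit n u i = code_nth inst (2 + digit n (word k a x) i * n + digit n (word k a y) i))
    \<longleftrightarrow> u = word k a (x \<otimes>\<^bsub>X\<^esub> y)"
proof -
  have "code_nth inst (2 + digit n (word k a x) i * n + digit n (word k a y) i)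
      = (x \<otimes>\<^bsub>X\<^esub> y) (a + int i)" if "i < k" for i
    using assms that by (simp only: digit_word code_instance(3) config_less mult_config)
  moreover have "digit n (word k a (x \<otimes>\<^bsub>X\<^esub> y)) i = (x \<otimes>\<^bsub>X\<^esub> y) (a + int i)" if "i < k" for i
    using assms that by (intro digit_word) simp_all
  ultimately show ?thesis
    using word_eqI[OF assms(3), of "x \<otimes>\<^bsub>X\<^esub> y" a] by metis
qed

lemma F_word:
  assumes "x \<in> C"
  shows "F x i = code_nth inst (2 + n * n + word (2 * r + 1) (i - int r) x)"
proof -
  let ?v = "word (2 * r + 1) (i - int r) x"
  have "code_nth inst (2 + n * n + ?v) = \<delta> (map (digit n ?v) [0..<2 * r + 1])"
    by (rule code_instance(4)[OF word_less[OF assms]])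
  also have "map (digit n ?v) [0..<2 * r + 1] = map x [i - int r..i + int r]"
    using digit_word[OF assms, of _ "2 * r + 1" "i - int r"]
    by (intro nth_equalityI) (auto simp del: upt_Suc)
  finally show ?thesis by (simp add: ca_map_def)
qed

lemma digit_word_F:
  assumes "x \<in> C" "v < n ^ w"
  shows "(\<forall>i<w. digit n v i = code_nth inst (2 + n * n
      + word (w + 2 * r) (- int r) x div n ^ i mod n ^ (2 * r + 1)))
    \<longleftrightarrow> v = word w 0 (F x)"
proof -
  have "code_nth inst (2 + n * n + word (w + 2 * r) (- int r) x div n ^ i mod n ^ (2 * r + 1))
      = F x (0 + int i)" if "i < w" for i
    using assms that by (subst word_window) (simp_all add: F_word algebra_simps)
  moreover have "digit n (word w 0 (F x)) i = F x (0 + int i)" if "i < w" for i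
    using assms that by (intro digit_word) simp_all
  ultimately show ?thesis
    using word_eqI[OF assms(2), of "F x" 0] by metis
qed

text \<open>For a nonempty set this equivalence is the subgroup property, phrased without the
  neutral element and inverses, which the code of the instance does not list.\<close>

lemma words_subgroup_iff:
  "words_subgroup inst w S \<longleftrightarrow> (\<forall>x\<in>C. \<forall>y\<in>C. digit 2 S (word w 0 x) = 1 \<longrightarrow>
    (digit 2 S (word w 0 y) = 1 \<longleftrightarrow> digit 2 S (word w 0 (x \<otimes>\<^bsub>X\<^esub> y)) = 1))"
proof
  assume sub: "words_subgroup inst w S"
  show "\<forall>x\<in>C. \<forall>y\<in>C. digit 2 S (word w 0 x) = 1 \<longrightarrow>
    (digit 2 S (word w 0 y) = 1 \<longleftrightarrow> digit 2 S (word w 0 (x \<otimes>\<^bsub>X\<^esub> y)) = 1)"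
  proof (intro ballI impI)
    fix x y assume xy: "x \<in> C" "y \<in> C" "digit 2 S (word w 0 x) = 1"
    have u: "word w 0 (x \<otimes>\<^bsub>X\<^esub> y) < n ^ w" using xy by (intro word_less) simp
    show "digit 2 S (word w 0 y) = 1 \<longleftrightarrow> digit 2 S (word w 0 (x \<otimes>\<^bsub>X\<^esub> y)) = 1"
      using sub[unfolded words_subgroup_def code_instance(1), rule_format,
          OF word_less[OF xy(1)] word_less[OF xy(2)] u] digit_word_mult[OF xy(1,2) u] xy(3) by blast
  qed
next
  assume sub: "\<forall>x\<in>C. \<forall>y\<in>C. digit 2 S (word w 0 x) = 1 \<longrightarrow>
    (digit 2 S (word w 0 y) = 1 \<longleftrightarrow> digit 2 S (word w 0 (x \<otimes>\<^bsub>X\<^esub> y)) = 1)"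
  show "words_subgroup inst w S"
    unfolding words_subgroup_def code_instance(1)
  proof (intro allI impI, elim conjE)
    fix x y u
    assume less: "x < n ^ w" "y < n ^ w" "u < n ^ w"
      and dig: "\<forall>i<w. digit n u i = code_nth inst (2 + digit n x i * n + digit n y i)"
      and x: "digit 2 S x = 1"
    obtain x' where x': "x' \<in> C" "x = word w 0 x'" using ex_word[OF less(1)] by blast
    obtain y' where y': "y' \<in> C" "y = word w 0 y'" using ex_word[OF less(2)] by blast
    have "u = word w 0 (x' \<otimes>\<^bsub>X\<^esub> y')"
      using dig digit_word_mult[OF x'(1) y'(1) less(3)] unfolding x'(2) y'(2) by blast
    then show "digit 2 S y = 1 \<longleftrightarrow> digit 2 S u = 1"
      using sub x x' y' by blast
  qed
qed

lemma words_invariant_iff: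
  "words_invariant inst w S \<longleftrightarrow>
    (\<forall>x\<in>C. digit 2 S (word w 0 x) = 1 \<longrightarrow> digit 2 S (word w 0 (F x)) = 1)"
proof -
  \<comment> \<open>The long word is read from site \<open>- r\<close> on, so its part from position
    \<open>r\<close> starts at site \<open>0\<close>.\<close>
  have mid: "word (w + 2 * r) (- int r) x div n ^ r mod n ^ w = word w 0 x" if "x \<in> C" for x
    using that by (subst word_window) simp_all
  show ?thesis
  proof
    assume inv: "words_invariant inst w S"
    show "\<forall>x\<in>C. digit 2 S (word w 0 x) = 1 \<longrightarrow> digit 2 S (word w 0 (F x)) = 1"
    proof (intro ballI impI)
      fix x assume x: "x \<in> C" "digit 2 S (word w 0 x) = 1"
      have v: "word w 0 (F x) < n ^ w" using x by (intro word_less) simp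
      show "digit 2 S (word w 0 (F x)) = 1"
        using inv[unfolded words_invariant_def code_instance(1,2), rule_format, OF word_less[OF x(1)] v]
          digit_word_F[OF x(1) v] x(2) mid[OF x(1)] by metis
    qed
  next
    assume inv: "\<forall>x\<in>C. digit 2 S (word w 0 x) = 1 \<longrightarrow> digit 2 S (word w 0 (F x)) = 1"
    show "words_invariant inst w S"
      unfolding words_invariant_def code_instance(1,2)
    proof (intro allI impI, elim conjE)
      fix u v
      assume less: "u < n ^ (w + 2 * r)" "v < n ^ w"
        and dig: "\<forall>i<w. digit n v i
          = code_nth inst (2 + n * n + u div n ^ i mod n ^ (2 * r + 1))"
        and u: "digit 2 S (u div n ^ r mod n ^ w) = 1"
      obtain x where x: "x \<in> C" "u = word (w + 2 * r) (- int r) x" using ex_word[OF less(1)] by blast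
      have "v = word w 0 (F x)" using dig digit_word_F[OF x(1) less(2)] unfolding x(2) by blast
      then show "digit 2 S v = 1" using inv x u mid[OF x(1)] by simp
    qed
  qed
qed

lemma proper_factor_if_has_factor:
  assumes "has_factor inst"
  shows "\<exists>U. proper_factor U"
proof -
  obtain w S where S: "\<exists>x<n ^ w. digit 2 S x = 1" "\<exists>x<n ^ w. \<not> digit 2 S x = 1"
      "words_subgroup inst w S" "words_invariant inst w S"
    using assms unfolding has_factor_def code_instance(1,2) by blast
  define U where "U = {x \<in> C. digit 2 S (word w 0 x) = 1}"
  note sub = S(3)[unfolded words_subgroup_iff, rule_format]
  obtain x0 where x0: "x0 \<in> C" "digit 2 S (word w 0 x0) = 1" using S(1) ex_word by metis
  \<comment> \<open>The criterion with the identity in place of \<open>y\<close>, where the product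
    is \<open>x0\<close> again; inverses are obtained below by taking for \<open>y\<close> the
    inverse of \<open>x\<close>.\<close>
  have one: "digit 2 S (word w 0 e) = 1"
    using sub[OF x0(1) X.one_closed x0(2)] x0 by simp
  have "subgroup U X"
  proof (rule X.subgroupI)
    show "U \<subseteq> C" by (auto simp: U_def)
    show "U \<noteq> {}" using x0 by (auto simp: U_def)
  next
    fix a assume "a \<in> U"
    then have a: "a \<in> C" "digit 2 S (word w 0 a) = 1" by (auto simp: U_def)
    then show "inv\<^bsub>X\<^esub> a \<in> U"
      using sub[OF a(1) X.inv_closed[OF a(1)] a(2)] one by (simp add: U_def)
  next
    fix a b assume "a \<in> U" "b \<in> U"
    then show "a \<otimes>\<^bsub>X\<^esub> b \<in> U" using sub[of a b] by (simp add: U_def)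
  qed
  moreover have "U \<noteq> C"
  proof -
    obtain x where "x \<in> C" "\<not> digit 2 S (word w 0 x) = 1" using S(2) ex_word by metis
    then show ?thesis by (auto simp: U_def)
  qed
  moreover have "F ` U \<subseteq> U"
    using S(4) F.hom_closed unfolding words_invariant_iff U_def by blast
  moreover have "determined U {0..<int w}"
    unfolding determined_def
  proof (intro ballI impI)
    fix x assume x: "x \<in> C" "\<forall>i\<in>{0..<int w}. x i = \<one>\<^bsub>G\<^esub>"
    then have "word w 0 x = word w 0 e" by (intro word_cong) simp
    then show "x \<in> U" using x(1) one by (simp add: U_def)
  qed
  ultimately have "proper_factor U"
    unfolding proper_factor_def by blast
  then show ?thesis by blast
qed

lemma has_factor_if_proper_factor:
  assumes "proper_factor U0"
  shows "has_factor inst"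
proof -
  obtain U w where fac: "proper_factor U" and det: "determined U {0..<int w}"
    and w: "w \<le> n ^ (n ^ (2 * r))"
    using ex_short_factor[OF assms] by blast
  have U: "subgroup U X" "U \<noteq> C" "F ` U \<subseteq> U" using fac by (simp_all add: proper_factor_def)
  have U_C: "U \<subseteq> C" by (rule subgroup.subset[OF U(1)])
  \<comment> \<open>\<open>set_encode\<close> is the binary code of a finite set, as required by
    reading \<open>S\<close> with \<open>digit 2\<close>.\<close>
  define S where "S = set_encode (word w 0 ` U)"
  have sub: "word w 0 ` U \<subseteq> {..<n ^ w}" using word_less U_C by blast
  have S_iff: "digit 2 S (word w 0 x) = 1 \<longleftrightarrow> x \<in> U" if x: "x \<in> C" for x
  proof -
    have "digit 2 S v = 1 \<longleftrightarrow> v \<in> set_decode S" for v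
      by (simp add: digit_def set_decode_def odd_iff_mod_2_eq_one)
    then have "digit 2 S (word w 0 x) = 1 \<longleftrightarrow> word w 0 x \<in> word w 0 ` U"
      unfolding S_def using finite_subset[OF sub] by simp
    also have "\<dots> \<longleftrightarrow> x \<in> U"
    proof
      assume "word w 0 x \<in> word w 0 ` U"
      then obtain u where u: "u \<in> U" "word w 0 x = word w 0 u" by blast
      then have "u \<in> C" using U_C by blast
      have "x i = u i" if "i \<in> {0..<int w}" for i
      proof -
        have "nat i < w" "0 + int (nat i) = i" using that by auto
        then show ?thesis using digit_word[OF x, of "nat i" w 0] digit_word[OF \<open>u \<in> C\<close>, of "nat i" w 0] u(2)
          by simp
      qed
      then show "x \<in> U"
        using mem_determined_iff[OF U(1) det \<open>u \<in> C\<close> x] u(1) by blast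
    qed blast
    finally show ?thesis .
  qed
  \<comment> \<open>The largest code of a set of words is that of the full set,
    \<open>2 ^ (n ^ w) - 1\<close>.\<close>
  have "S \<le> set_encode {..<n ^ w}"
    unfolding S_def set_encode_def by (rule sum_mono2) (use sub in auto)
  also have "\<dots> = (\<Sum>i<n ^ w. 2 ^ i)" by (simp add: set_encode_def)
  also have "\<dots> < 2 ^ (n ^ w)" using sum_power2[of "n ^ w"] by (simp add: lessThan_atLeast0)
  finally have S_less: "S < 2 ^ (n ^ w)" .
  have "\<exists>x<n ^ w. digit 2 S x = 1"
    using S_iff[OF X.one_closed] subgroup.one_closed[OF U(1)] word_less[OF X.one_closed] by blast
  moreover have "\<exists>x<n ^ w. \<not> digit 2 S x = 1"
  proof -
    obtain a where "a \<in> C" "a \<notin> U" using U(2) U_C by blast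
    then show ?thesis using S_iff word_less by blast
  qed
  moreover have "words_subgroup inst w S"
    unfolding words_subgroup_iff
  proof (intro ballI impI)
    fix x y assume xy: "x \<in> C" "y \<in> C" "digit 2 S (word w 0 x) = 1"
    then have x: "x \<in> U" using S_iff by blast
    have "y = inv\<^bsub>X\<^esub> x \<otimes>\<^bsub>X\<^esub> (x \<otimes>\<^bsub>X\<^esub> y)"
      using xy by (simp add: X.m_assoc[symmetric] X.l_inv)
    then have "y \<in> U \<longleftrightarrow> x \<otimes>\<^bsub>X\<^esub> y \<in> U"
      using subgroup.m_closed[OF U(1)] subgroup.m_inv_closed[OF U(1)] x by metis
    then show "digit 2 S (word w 0 y) = 1 \<longleftrightarrow> digit 2 S (word w 0 (x \<otimes>\<^bsub>X\<^esub> y)) = 1"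
      using S_iff xy by simp
  qed
  moreover have "words_invariant inst w S"
    unfolding words_invariant_iff
  proof (intro ballI impI)
    fix x assume "x \<in> C" "digit 2 S (word w 0 x) = 1"
    then have "F x \<in> U" "F x \<in> C" using S_iff U(3) by auto
    then show "digit 2 S (word w 0 (F x)) = 1" using S_iff by blast
  qed
  moreover have "w < Suc (n ^ (n ^ (2 * r)))" using w by simp
  ultimately show ?thesis
    unfolding has_factor_def code_instance(1,2) using S_less by blast
qed

lemma has_factor_iff: "has_factor inst \<longleftrightarrow> \<not> factor_free"
  unfolding factor_free_def
  using proper_factor_if_has_factor has_factor_if_proper_factor by blast

end

text \<open>The program is fixed before \<open>G\<close>, \<open>r\<close> and
  \<open>\<delta>\<close>, since \<open>has_factor\<close> reads all of its data from the code of
  the instance; the same program decides every property equivalent to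
  \<open>factor_free\<close>.\<close>

lemma decidable_if_factor_free:
  assumes "\<And>G r \<delta>. additive_automaton G r \<delta> \<Longrightarrow>
    P G (ca_map r \<delta>) \<longleftrightarrow> additive_automaton.factor_free G r \<delta>"
  shows "decidable_for_additive_ca P"
proof -
  obtain p where p: "\<And>xs. length xs = 1 \<Longrightarrow> rec_eval p xs (of_bool (\<not> has_factor (xs ! 0)))"
    using recursive_has_factor by (auto simp: recursive_def)
  have "rec_eval p [instance_code G r \<delta>] (if P G (ca_map r \<delta>) then 1 else 0)"
    if "fin_abelian_group G \<and> additive_ca G r \<delta>" for G r \<delta>
  proof -
    from that have aut: "additive_automaton G r \<delta>"
      by (simp add: additive_automaton_def finite_config_def additive_automaton_axioms_def)
    show ?thesis
      using p[of "[instance_code G r \<delta>]"] additive_automaton.has_factor_iff[OF aut] assms[OF aut]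
      by (simp add: of_bool_def)
  qed
  then show ?thesis unfolding decidable_for_additive_ca_def by blast
qed

theorem corollary2p28:
  "decidable_for_additive_ca (\<lambda>G F. top_transitive (config_topology G) F) \<and>
   decidable_for_additive_ca (\<lambda>G F. ergodic (config_measure G) F) \<and>
   decidable_for_additive_ca (\<lambda>G F. top_mixing (config_topology G) F) \<and>
   decidable_for_additive_ca (\<lambda>G F. weakly_top_transitive (config_topology G) F) \<and>
   decidable_for_additive_ca (\<lambda>G F. totally_transitive (config_topology G) F) \<and>
   decidable_for_additive_ca (\<lambda>G F. weakly_ergodic_mixing (config_measure G) F) \<and>
   decidable_for_additive_ca (\<lambda>G F. ergodic_mixing (config_measure G) F)"
  by (intro conjI decidable_if_factor_free additive_automaton.dynamics_iff_factor_free)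

end
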